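(* Let $n=6$ and let $J$ be a matroidal ideal of degree $4$ in $R=K[x_1,\dots,x_6]$ with $\gcd(J)=1$. Then $J$ is sequentially Cohen-Macaulay (SCM) if and only if there is a permutation $y_1,\dots,y_6$ of the variables $x_1,\dots,x_6$ such that $$J=y_1y_2y_3\mathfrak{p}+y_1y_2J_1+y_1y_3J_2+y_2y_3J_3+J_4,$$ where $\mathfrak{p}=(y_4,y_5,y_6)$, $J_1,J_2,J_3$ are SCM matroidal ideals of degree $2$ with $\operatorname{supp}(J_i)=\{y_4,y_5,y_6\}$, $J_4$ is the (possibly zero) ideal generated by the elements of $G(J)$ not belonging to the other summands, $J_4\subseteq J_1\cap J_2\cap J_3$, and one of the following conditions holds: (a) $\gcd(J_i)=1$ for $i=1,2,3$ and $|G(J_4)|=3$; (b) $\gcd(J_i)=1$ for $i=1,2,3$ and $|G(J_4)|=2$; (c) $\gcd(J_i)=1$ for $i=1,2,3$ and $J_4=0$; or (d) $\gcd(J_i)=y_4$ for $i=1,2,3$ and $J_4=0$.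
   Context: $K$ is a field; polynomial rings have the standard grading. For a monomial ideal $I$, $G(I)$ is its unique minimal set of monomial generators, $\gcd(I)$ is the greatest common divisor of the elements of $G(I)$, and $\operatorname{supp}(I)$ is the set of variables dividing some element of $G(I)$. A monomial ideal $I$ generated in one degree is polymatroidal if for all $u,v\in G(I)$ and every $i$ with $\deg_{x_i}(v)<\deg_{x_i}(u)$ there is $j$ with $\deg_{x_j}(u)<\deg_{x_j}(v)$ and $x_j(u/x_i)\in G(I)$; it is matroidal if moreover it is generated by square-free monomials. Standing assumption: the given matroidal ideal of $R$ is fully supported, i.e. $\operatorname{supp}(J)=\{x_1,\dots,x_6\}$. Ideals of polynomial subrings of $R$ are identified with their extensions to $R$. A graded module $M$ is sequentially Cohen-Macaulay if there is a finite filtration by graded submodules $0=M_0\subset M_1\subset\dots\subset M_r=M$ with each $M_i/M_{i-1}$ Cohen-Macaulay and $\dim(M_1/M_0)<\dots<\dim(M_r/M_{r-1})$; an ideal $I\subset R$ is called SCM if $R/I$ is sequentially Cohen-Macaulay. *)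

theory Defs
  imports
    "HOL-Library.Poly_Mapping"
    "HOL-Library.Set_Algebras"
    "HOL-Library.Extended_Nat"
    "HOL-Library.Cardinality"
begin

text \<open>
  The polynomial ring over the field \<open>'k\<close> whose variables are indexed by the finite type \<open>'v\<close>.
  A monomial is represented by its exponent vector, of type \<open>'v \<Rightarrow>\<^sub>0 nat\<close>, so that products of
  monomials are sums of exponent vectors.
\<close>

type_synonym 'v monomial = "'v \<Rightarrow>\<^sub>0 nat"
type_synonym ('v, 'k) mpoly = "('v \<Rightarrow>\<^sub>0 nat) \<Rightarrow>\<^sub>0 'k"

definition mon :: "'v monomial \<Rightarrow> ('v, 'k::field) mpoly"
  where "mon u = Poly_Mapping.single u 1"

definition Var :: "'v \<Rightarrow> ('v, 'k::field) mpoly"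
  where "Var i = mon (Poly_Mapping.single i 1)"

definition mdeg :: "'v::finite monomial \<Rightarrow> nat"
  where "mdeg u = (\<Sum>i\<in>UNIV. Poly_Mapping.lookup u i)"

definition hom_component :: "nat \<Rightarrow> ('v::finite, 'k::field) mpoly \<Rightarrow> ('v, 'k) mpoly"
  where "hom_component d f =
    (\<Sum>u \<in> {u \<in> Poly_Mapping.keys f. mdeg u = d}. Poly_Mapping.single u (Poly_Mapping.lookup f u))"


section \<open>Ideals\<close>

definition is_ideal :: "'a::comm_ring_1 set \<Rightarrow> bool"
  where "is_ideal I \<longleftrightarrow> module.subspace (*) I"

definition ideal_gen :: "'a::comm_ring_1 set \<Rightarrow> 'a set"
  where "ideal_gen S = module.span (*) S"

definition is_prime_ideal :: "'a::comm_ring_1 set \<Rightarrow> bool"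
  where "is_prime_ideal P \<longleftrightarrow>
    is_ideal P \<and> P \<noteq> UNIV \<and> (\<forall>a b. a * b \<in> P \<longrightarrow> a \<in> P \<or> b \<in> P)"

definition graded_ideal :: "('v::finite, 'k::field) mpoly set \<Rightarrow> bool"
  where "graded_ideal I \<longleftrightarrow> is_ideal I \<and> (\<forall>f\<in>I. \<forall>d. hom_component d f \<in> I)"

definition max_graded_ideal :: "('v, 'k::field) mpoly set"
  where "max_graded_ideal = ideal_gen (range Var)"


section \<open>Sequentially Cohen-Macaulay modules\<close>

text \<open>
  The modules that occur are subquotients of the ring.  Such a module \<open>A / B\<close> is given by
  a pair of ideals with \<open>B \<subseteq> A\<close>.  The submodules of \<open>A / B\<close> are the \<open>C / B\<close> with \<open>C\<close> an ideal
  between \<open>B\<close> and \<open>A\<close>, and the quotient of two of them, \<open>C / B\<close> by \<open>D / B\<close>, is \<open>C / D\<close>.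
\<close>

definition annihilator :: "'a::comm_ring_1 set \<Rightarrow> 'a set \<Rightarrow> 'a set"
  where "annihilator A B = {r. \<forall>a\<in>A. r * a \<in> B}"

text \<open>The Krull dimension of the ring modulo \<open>I\<close>, for a proper ideal \<open>I\<close>.\<close>

definition krull_dim_mod :: "'a::comm_ring_1 set \<Rightarrow> enat"
  where "krull_dim_mod I = Sup {enat n | n. \<exists>P :: nat \<Rightarrow> 'a set.
    (\<forall>i\<le>n. is_prime_ideal (P i) \<and> I \<subseteq> P i) \<and> (\<forall>i<n. P i \<subset> P (Suc i))}"

definition module_dim :: "'a::comm_ring_1 set \<Rightarrow> 'a set \<Rightarrow> enat"
  where "module_dim A B = krull_dim_mod (annihilator A B)"

text \<open>The submodule \<open>(B + (rs) A) / B\<close> of \<open>A / B\<close>, represented by its numerator.\<close>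

definition seq_submodule :: "'a::comm_ring_1 set \<Rightarrow> 'a set \<Rightarrow> 'a list \<Rightarrow> 'a set"
  where "seq_submodule A B rs = B + ideal_gen {r * a | r a. r \<in> set rs \<and> a \<in> A}"

definition regular_sequence :: "'a::comm_ring_1 set \<Rightarrow> 'a set \<Rightarrow> 'a list \<Rightarrow> bool"
  where "regular_sequence A B rs \<longleftrightarrow>
    (\<forall>i < length rs. \<forall>a\<in>A. rs ! i * a \<in> seq_submodule A B (take i rs)
        \<longrightarrow> a \<in> seq_submodule A B (take i rs)) \<and>
    seq_submodule A B rs \<noteq> A"

definition module_depth :: "('v, 'k::field) mpoly set \<Rightarrow> ('v, 'k) mpoly set \<Rightarrow> enat"
  where "module_depth A B =
    Sup {enat (length rs) | rs. set rs \<subseteq> max_graded_ideal \<and> regular_sequence A B rs}"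

text \<open>The zero module counts as Cohen-Macaulay.\<close>

definition cohen_macaulay :: "('v, 'k::field) mpoly set \<Rightarrow> ('v, 'k) mpoly set \<Rightarrow> bool"
  where "cohen_macaulay A B \<longleftrightarrow> A = B \<or> module_depth A B = module_dim A B"

definition sequentially_CM :: "('v::finite, 'k::field) mpoly set \<Rightarrow> ('v, 'k) mpoly set \<Rightarrow> bool"
  where "sequentially_CM A B \<longleftrightarrow> (\<exists>(r::nat) (M :: nat \<Rightarrow> ('v, 'k) mpoly set).
    M 0 = B \<and> M r = A \<and>
    (\<forall>i\<le>r. graded_ideal (M i)) \<and>
    (\<forall>i<r. M i \<subset> M (Suc i)) \<and>
    (\<forall>i<r. cohen_macaulay (M (Suc i)) (M i)) \<and>
    (\<forall>i. Suc i < r \<longrightarrow>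
       module_dim (M (Suc i)) (M i) < module_dim (M (Suc (Suc i))) (M (Suc i))))"

definition SCM :: "('v::finite, 'k::field) mpoly set \<Rightarrow> bool"
  where "SCM I \<longleftrightarrow> sequentially_CM UNIV I"


section \<open>Monomial ideals and matroidal ideals\<close>

definition monomial_ideal :: "('v, 'k::field) mpoly set \<Rightarrow> bool"
  where "monomial_ideal I \<longleftrightarrow> (\<exists>U. I = ideal_gen (mon ` U))"

text \<open>\<open>min_gens I\<close> is \<open>G(I)\<close>; it is meaningful for monomial ideals only.\<close>

definition min_gens :: "('v, 'k::field) mpoly set \<Rightarrow> 'v monomial set"
  where "min_gens I = (THE U. I = ideal_gen (mon ` U) \<and> (\<forall>U'. U' \<subset> U \<longrightarrow> I \<noteq> ideal_gen (mon ` U')))"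

definition ideal_supp :: "('v, 'k::field) mpoly set \<Rightarrow> 'v set"
  where "ideal_supp I = {i. \<exists>u\<in>min_gens I. (Var i :: ('v, 'k) mpoly) dvd mon u}"

text \<open>The greatest common divisor of \<open>G(I)\<close>, normalised to be a monomial, as a ring element.\<close>

definition ideal_gcd :: "('v, 'k::field) mpoly set \<Rightarrow> ('v, 'k) mpoly"
  where "ideal_gcd I = (THE g. g \<in> range mon \<and> (\<forall>u\<in>min_gens I. g dvd mon u) \<and>
    (\<forall>h \<in> range mon. (\<forall>u\<in>min_gens I. h dvd mon u) \<longrightarrow> h dvd g))"

definition generated_in_degree :: "nat \<Rightarrow> ('v::finite, 'k::field) mpoly set \<Rightarrow> bool"
  where "generated_in_degree d I \<longleftrightarrow> (\<forall>u\<in>min_gens I. mdeg u = d)"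

definition polymatroidal :: "('v::finite, 'k::field) mpoly set \<Rightarrow> bool"
  where "polymatroidal I \<longleftrightarrow>
    monomial_ideal I \<and> (\<exists>d. generated_in_degree d I) \<and>
    (\<forall>u\<in>min_gens I. \<forall>v\<in>min_gens I. \<forall>i. Poly_Mapping.lookup v i < Poly_Mapping.lookup u i \<longrightarrow>
      (\<exists>j. Poly_Mapping.lookup u j < Poly_Mapping.lookup v j \<and>
        Poly_Mapping.single j 1 + (u - Poly_Mapping.single i 1) \<in> min_gens I))"

definition matroidal :: "('v::finite, 'k::field) mpoly set \<Rightarrow> bool"
  where "matroidal I \<longleftrightarrow>
    polymatroidal I \<and> (\<forall>u\<in>min_gens I. \<forall>i. Poly_Mapping.lookup u i \<le> 1)"

end

theory Submission
  imports Defs "HOL-Library.FuncSet"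
begin

text \<open>
  The bases of \<open>J\<close> are the complements of the bases of the dual matroid, which has rank two and is
  therefore given by a partition of the variables into parallel classes. The four forms of \<open>J\<close>
  are the partitions with at most one class of more than one variable: that class is empty,
  \<open>{y\<^sub>1, y\<^sub>2}\<close>, \<open>{y\<^sub>1, y\<^sub>2, y\<^sub>3}\<close> or \<open>{y\<^sub>1, y\<^sub>2, y\<^sub>3, y\<^sub>4}\<close>. So the claim is that \<open>J\<close> is SCM if and
  only if there are no two such classes.

  If \<open>C\<close> is the only such class, then \<open>J \<subseteq> I \<subseteq> R\<close> with \<open>I\<close> generated by the squarefree monomials of
  degree \<open>card C - 1\<close> in \<open>C\<close> is the required filtration. Both factors have filtrations with
  quotients isomorphic to polynomial rings on \<open>d\<close> of the variables, on which the elementary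
  symmetric polynomials \<open>e\<^sub>d, \<dots>, e\<^sub>1\<close> form a regular sequence.

  If \<open>{a, b}\<close> and \<open>{c, d}\<close> lie in different classes, then the last factor \<open>R/Q\<close> of a filtration as
  in the definition of SCM satisfies \<open>J \<subseteq> Q \<subseteq> (a, b) \<inter> (c, d)\<close> and has depth four, and this
  contradicts the connectedness of Cohen-Macaulay rings, here in the form that the Koszul cohomology
  of \<open>a, b, c, d\<close> on \<open>R/Q\<close> vanishes in degree one.
\<close>

section \<open>Ideals\<close>

text \<open>Dimension and depth are suprema and need upper bounds. Chains of primes and regular
  sequences both yield elements that are algebraically independent modulo an ideal, and counting
  monomials with bounded exponents limits their number; this takes the place of dimension theory.

  A squarefree monomial ideal is encoded by the sets of variables that its monomials omit. A factor
  of a filtration by such ideals is then a family of sets, and cutting the family into intervals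
  cuts the module into shifted polynomial rings. To pass through these extensions, a single sequence
  must be regular on all pieces, whichever variables they involve; this is why symmetric polynomials
  are used.

  In the converse direction the filtration consists of arbitrary graded ideals, so nothing monomial
  is known about Q itself. Instead of localising at (a, b, c, d), the grading is used to remove the
  other two variables from the Koszul complex: six variables and depth four give vanishing in degree
  three, and two removals leave degree one.\<close>

lemma module_times: "module ((*) :: 'a::comm_ring_1 \<Rightarrow> 'a \<Rightarrow> 'a)"
  by unfold_locales (simp_all add: algebra_simps)

lemma is_ideal_iff:
  "is_ideal I \<longleftrightarrow> 0 \<in> I \<and> (\<forall>x\<in>I. \<forall>y\<in>I. x + y \<in> I) \<and> (\<forall>r. \<forall>x\<in>I. r * x \<in> I)"
  for I :: "'a::comm_ring_1 set"
  by (auto simp: is_ideal_def module.subspace_def[OF module_times])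

context
  fixes I :: "'a::comm_ring_1 set"
  assumes ideal: "is_ideal I"
begin

lemma ideal_zero: "0 \<in> I"
  using ideal by (simp add: is_ideal_iff)

lemma ideal_add: "x \<in> I \<Longrightarrow> y \<in> I \<Longrightarrow> x + y \<in> I"
  using ideal by (simp add: is_ideal_iff)

lemma ideal_mult: "x \<in> I \<Longrightarrow> r * x \<in> I"
  using ideal by (simp add: is_ideal_iff)

lemma ideal_mult_right: "x \<in> I \<Longrightarrow> x * r \<in> I"
  using ideal_mult[of x r] by (simp add: mult.commute)

lemma ideal_uminus: "x \<in> I \<Longrightarrow> - x \<in> I"
  using ideal_mult[of x "-1"] by simp

lemma ideal_diff: "x \<in> I \<Longrightarrow> y \<in> I \<Longrightarrow> x - y \<in> I"
  using ideal_add[of x "- y"] ideal_uminus[of y] by simp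

lemma ideal_sum: "(\<And>x. x \<in> A \<Longrightarrow> f x \<in> I) \<Longrightarrow> sum f A \<in> I"
  by (induction A rule: infinite_finite_induct) (auto simp: ideal_zero ideal_add)

lemma ideal_add_cancel: "x \<in> I \<Longrightarrow> x + y \<in> I \<longleftrightarrow> y \<in> I"
  using ideal_add[of x y] ideal_diff[of "x + y" x] by auto

end

lemma is_ideal_UNIV: "is_ideal UNIV"
  by (simp add: is_ideal_iff)

lemma is_ideal_ideal_gen: "is_ideal (ideal_gen S)"
  by (simp add: is_ideal_def ideal_gen_def module.subspace_span[OF module_times])

lemma ideal_gen_superset: "S \<subseteq> ideal_gen S"
  by (simp add: ideal_gen_def module.span_superset[OF module_times])

lemma ideal_gen_minimal: "S \<subseteq> I \<Longrightarrow> is_ideal I \<Longrightarrow> ideal_gen S \<subseteq> I"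
  by (simp add: ideal_gen_def is_ideal_def module.span_minimal[OF module_times])

lemma ideal_gen_Un: "ideal_gen (S \<union> T) = ideal_gen S + ideal_gen T"
  by (auto simp: ideal_gen_def module.span_Un[OF module_times] set_plus_def)

lemma ideal_gen_empty: "ideal_gen {} = {0}"
  by (simp add: ideal_gen_def module.span_empty[OF module_times])

lemma ideal_gen_ideal: "is_ideal I \<Longrightarrow> ideal_gen I = I"
  using ideal_gen_minimal[of I I] ideal_gen_superset[of I] by auto

lemma is_ideal_plus: "is_ideal I \<Longrightarrow> is_ideal I' \<Longrightarrow> is_ideal (I + I')"
  using ideal_gen_Un[of I I'] by (metis ideal_gen_ideal is_ideal_ideal_gen)

lemma is_ideal_times:
  assumes "is_ideal I"
  shows "is_ideal (r *o I)"
  unfolding is_ideal_iff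
proof (intro conjI ballI allI)
  have "r * 0 \<in> r *o I"
    using ideal_zero[OF assms] by (rule set_times_intro2)
  then show "0 \<in> r *o I"
    by simp
next
  fix x y assume "x \<in> r *o I" "y \<in> r *o I"
  then obtain a b where "a \<in> I" "b \<in> I" "x = r * a" "y = r * b"
    unfolding elt_set_times_def by blast
  then show "x + y \<in> r *o I"
    using ideal_add[OF assms, of a b] by (auto simp flip: distrib_left)
next
  fix s x assume "x \<in> r *o I"
  then obtain y where "y \<in> I" "x = r * y"
    unfolding elt_set_times_def by blast
  then show "s * x \<in> r *o I"
    using set_times_intro2[OF ideal_mult[OF assms], of y r s] by (metis mult.left_commute)
qed

lemma ideal_plus_least: "I \<subseteq> H \<Longrightarrow> I' \<subseteq> H \<Longrightarrow> is_ideal H \<Longrightarrow> I + I' \<subseteq> H"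
  by (auto simp: set_plus_def intro: ideal_add)

lemma ideal_plus_upper1: "is_ideal I' \<Longrightarrow> I \<subseteq> I + I'"
  using ideal_zero[of I'] by (auto simp: set_plus_def) (metis add.right_neutral)

lemma ideal_plus_upper2: "is_ideal I \<Longrightarrow> I' \<subseteq> I + I'"
  using ideal_zero[of I] by (auto simp: set_plus_def) (metis add.left_neutral)

lemma is_ideal_annihilator:
  assumes "is_ideal B"
  shows "is_ideal (annihilator A B)"
  unfolding is_ideal_iff annihilator_def mem_Collect_eq
proof (intro conjI ballI allI)
  show "0 * a \<in> B" for a
    by (simp add: ideal_zero[OF assms])
  show "(r + s) * a \<in> B" if "r \<in> {r. \<forall>a\<in>A. r * a \<in> B}" "s \<in> {r. \<forall>a\<in>A. r * a \<in> B}" "a \<in> A" for r s a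
    unfolding distrib_right by (rule ideal_add[OF assms]) (use that in blast)+
  show "(r * s) * a \<in> B" if "s \<in> {r. \<forall>a\<in>A. r * a \<in> B}" "a \<in> A" for r s a
    unfolding mult.assoc by (rule ideal_mult[OF assms]) (use that in blast)
qed

lemma annihilator_UNIV:
  assumes "is_ideal B"
  shows "annihilator UNIV B = B"
proof
  show "annihilator UNIV B \<subseteq> B"
  proof
    fix r assume "r \<in> annihilator UNIV B"
    then have "r * 1 \<in> B"
      unfolding annihilator_def mem_Collect_eq by (rule bspec) simp
    then show "r \<in> B"
      by simp
  qed
  show "B \<subseteq> annihilator UNIV B"
    by (auto simp: annihilator_def intro: ideal_mult_right[OF assms])
qed


section \<open>Monomials\<close>

abbreviation (input) lk where "lk \<equiv> Poly_Mapping.lookup"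
abbreviation (input) keys where "keys \<equiv> Poly_Mapping.keys"

definition divides :: "'v monomial \<Rightarrow> 'v monomial \<Rightarrow> bool"
  where "divides u v \<longleftrightarrow> (\<forall>i. lk u i \<le> lk v i)"

lemma divides_iff_add: "divides u v \<longleftrightarrow> (\<exists>w. v = u + w)"
proof
  assume "divides u v"
  then have "v = u + (v - u)"
    by (intro poly_mapping_eqI) (simp add: divides_def lookup_add lookup_minus)
  then show "\<exists>w. v = u + w" ..
qed (auto simp: divides_def lookup_add)

lemma divides_refl: "divides u u"
  by (simp add: divides_def)

lemma divides_trans: "divides u v \<Longrightarrow> divides v w \<Longrightarrow> divides u w"
  unfolding divides_def using order_trans by blast

lemma divides_antisym: "divides u v \<Longrightarrow> divides v u \<Longrightarrow> u = v"
  by (intro poly_mapping_eqI) (simp add: divides_def antisym)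

lemma divides_add: "divides u (u + w)"
  by (auto simp: divides_iff_add)

lemma mdeg_add: "mdeg (u + v) = mdeg u + mdeg v"
  by (simp add: mdeg_def lookup_add sum.distrib)

lemma mdeg_zero_iff: "mdeg u = 0 \<longleftrightarrow> u = 0"
  by (auto simp: mdeg_def poly_mapping_eq_iff fun_eq_iff)

lemma divides_same_degree: "divides u v \<Longrightarrow> mdeg u = mdeg v \<Longrightarrow> u = v"
  by (auto simp: divides_iff_add mdeg_add mdeg_zero_iff)

definition zero_set :: "'v monomial \<Rightarrow> 'v set"
  where "zero_set u = {i. lk u i = 0}"

lemma zero_set_add: "zero_set (u + v) = zero_set u \<inter> zero_set v"
  by (auto simp: zero_set_def lookup_add)

lemma zero_set_zero: "zero_set 0 = UNIV"
  by (simp add: zero_set_def)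

definition ind :: "'v set \<Rightarrow> 'v::finite monomial"
  where "ind S = Abs_poly_mapping (\<lambda>i. if i \<in> S then 1 else 0)"

lemma lookup_ind: "lk (ind S) i = (if i \<in> S then 1 else 0)" for S :: "'v::finite set"
  by (simp add: ind_def)

lemma zero_set_ind: "zero_set (ind S) = - S"
  by (auto simp: zero_set_def lookup_ind)

lemma mdeg_ind: "mdeg (ind S) = card S"
  by (simp add: mdeg_def lookup_ind flip: sum.inter_filter)

lemma ind_inject: "ind S = ind T \<longleftrightarrow> S = T"
  by (metis zero_set_ind double_complement)

lemma ind_divides_iff: "divides (ind S) u \<longleftrightarrow> zero_set u \<subseteq> - S"
  by (auto simp: divides_def lookup_ind zero_set_def Suc_le_eq)

lemma ind_divides_ind_iff: "divides (ind S) (ind T) \<longleftrightarrow> S \<subseteq> T"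
  by (auto simp: ind_divides_iff zero_set_ind)

lemma ind_union: "S \<inter> T = {} \<Longrightarrow> ind S + ind T = ind (S \<union> T)"
  by (intro poly_mapping_eqI) (auto simp: lookup_add lookup_ind)

lemma single_eq_ind: "Poly_Mapping.single i 1 = ind {i}"
  by (intro poly_mapping_eqI) (auto simp: lookup_single lookup_ind)

lemma squarefree_eq_ind:
  assumes "\<forall>i. lk u i \<le> 1"
  shows "u = ind (- zero_set u)"
proof (intro poly_mapping_eqI)
  show "lk u i = lk (ind (- zero_set u)) i" for i
    using assms[rule_format, of i] by (auto simp: lookup_ind zero_set_def le_Suc_eq)
qed

lemma mon_inject: "mon u = (mon v :: ('v, 'k::field) mpoly) \<longleftrightarrow> u = v"
  using keys_single[of u "1::'k"] keys_single[of v "1::'k"]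
  by (auto simp: mon_def dest: arg_cong[of _ _ Poly_Mapping.keys])

lemma mon_mult: "mon u * mon v = mon (u + v)"
  by (simp add: mon_def mult_single)

lemma mon_zero: "mon 0 = 1"
  by (simp add: mon_def)

lemma keys_mon: "keys (mon u :: ('v, 'k::field) mpoly) = {u}"
  by (simp add: mon_def)

lemma Var_eq_ind: "Var i = mon (ind {i})" for i :: "'v::finite"
  by (simp only: Var_def single_eq_ind)

lemma lookup_mon_mult: "lk (mon u * f) (u + k) = lk f k"
proof -
  have "lk (mon u * f) (u + k) = (\<Sum>l. lk (mon u) l * (\<Sum>q. lk f q when u + k = l + q))"
    by (simp add: lookup_mult)
  also have "\<dots> = (\<Sum>l. (\<Sum>q. lk f q when u + k = u + q) when u = l)"
    by (rule Sum_any.cong) (auto simp: mon_def lookup_single when_def)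
  finally show ?thesis
    by simp
qed

lemma keys_mon_mult: "keys (mon u * f) = (+) u ` keys f"
proof
  show "keys (mon u * f) \<subseteq> (+) u ` keys f"
    using keys_mult[of "mon u" f] by (auto simp: keys_mon)
  show "(+) u ` keys f \<subseteq> keys (mon u * f)"
    by (auto simp: in_keys_iff lookup_mon_mult)
qed

lemma mon_dvd_mon_iff: "mon u dvd (mon v :: ('v, 'k::field) mpoly) \<longleftrightarrow> divides u v"
proof
  assume "mon u dvd (mon v :: ('v, 'k) mpoly)"
  then obtain f where "(mon v :: ('v, 'k) mpoly) = mon u * f" ..
  then have "{v} = (+) u ` keys f"
    using keys_mon_mult[of u f] keys_mon[of v, where ?'k = 'k] by simp
  then obtain w where "v = u + w"
    by blast
  then show "divides u v"
    by (simp add: divides_add)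
next
  assume "divides u v"
  then show "mon u dvd (mon v :: ('v, 'k) mpoly)"
    by (auto simp: divides_iff_add simp flip: mon_mult)
qed

lemma Var_dvd_mon_iff: "Var i dvd (mon v :: ('v::finite, 'k::field) mpoly) \<longleftrightarrow> i \<notin> zero_set v"
  by (auto simp: Var_eq_ind mon_dvd_mon_iff ind_divides_iff)

text \<open>The projection onto the span of the monomials in \<open>S\<close>; graded components,
  truncations and reduction modulo variables are all instances.\<close>

definition part :: "'v monomial set \<Rightarrow> ('v, 'k::field) mpoly \<Rightarrow> ('v, 'k) mpoly"
  where "part S f = (\<Sum>u\<in>keys f \<inter> S. Poly_Mapping.single u (lk f u))"

lemma lookup_part: "lk (part S f) u = (if u \<in> S then lk f u else 0)"
proof -
  have "lk (part S f) u = (\<Sum>v\<in>keys f \<inter> S. if v = u then lk f u else 0)"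
    unfolding part_def lookup_sum
    by (rule sum.cong) (auto simp: lookup_single when_def)
  then show ?thesis
    by (simp add: in_keys_iff)
qed

lemma keys_part: "keys (part S f) = keys f \<inter> S"
  by (auto simp: in_keys_iff lookup_part split: if_splits)

lemma part_add: "part S (f + g) = part S f + part S g"
  by (intro poly_mapping_eqI) (simp add: lookup_part lookup_add)

lemma part_diff: "part S (f - g) = part S f - part S g"
  by (intro poly_mapping_eqI) (simp add: lookup_part lookup_minus)

lemma part_split: "part S f + part (- S) f = f"
  by (intro poly_mapping_eqI) (simp add: lookup_part lookup_add)

lemma part_all: "keys f \<subseteq> S \<Longrightarrow> part S f = f"
  by (intro poly_mapping_eqI) (auto simp: lookup_part in_keys_iff)

lemma part_none: "keys f \<inter> S = {} \<Longrightarrow> part S f = 0"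
  by (intro poly_mapping_eqI) (auto simp: lookup_part in_keys_iff)

lemma hom_component_eq_part: "hom_component d f = part {u. mdeg u = d} f"
  by (auto simp: hom_component_def part_def intro: sum.cong)

section \<open>Monomial ideals\<close>

text \<open>Every monomial ideal has this form with an up-closed \<open>S\<close>, so inclusions and
  equalities of monomial ideals become statements about sets of exponent vectors.\<close>

definition keyideal :: "'v monomial set \<Rightarrow> ('v, 'k::field) mpoly set"
  where "keyideal S = {f. keys f \<subseteq> S}"

definition up_closed :: "'v monomial set \<Rightarrow> bool"
  where "up_closed S \<longleftrightarrow> (\<forall>u\<in>S. \<forall>v. u + v \<in> S)"

definition up :: "'v monomial set \<Rightarrow> 'v monomial set"
  where "up U = {v. \<exists>u\<in>U. divides u v}"

lemma up_closed_up: "up_closed (up U)"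
  using divides_add divides_trans by (fastforce simp: up_closed_def up_def)

lemma mon_in_keyideal_iff: "mon u \<in> (keyideal S :: ('v, 'k::field) mpoly set) \<longleftrightarrow> u \<in> S"
  by (simp add: keyideal_def keys_mon)

lemma keyideal_inject: "keyideal S = (keyideal T :: ('v, 'k::field) mpoly set) \<longleftrightarrow> S = T"
proof
  assume eq: "keyideal S = (keyideal T :: ('v, 'k) mpoly set)"
  have "u \<in> S \<longleftrightarrow> u \<in> T" for u
    using mon_in_keyideal_iff[of u S, where ?'k='k] mon_in_keyideal_iff[of u T, where ?'k='k]
    by (simp add: eq)
  then show "S = T" by blast
qed simp

lemma keyideal_mono: "S \<subseteq> T \<Longrightarrow> keyideal S \<subseteq> keyideal T"
  by (auto simp: keyideal_def)

lemma keyideal_subset_iff: "keyideal S \<subseteq> (keyideal T :: ('v, 'k::field) mpoly set) \<longleftrightarrow> S \<subseteq> T"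
proof
  assume eq: "keyideal S \<subseteq> (keyideal T :: ('v, 'k) mpoly set)"
  have "u \<in> S \<Longrightarrow> u \<in> T" for u
    using mon_in_keyideal_iff[of u S, where ?'k='k] mon_in_keyideal_iff[of u T, where ?'k='k] eq
    by auto
  then show "S \<subseteq> T" by blast
qed (rule keyideal_mono)

lemma is_ideal_keyideal:
  assumes "up_closed S"
  shows "is_ideal (keyideal S)"
  unfolding is_ideal_iff
proof (intro conjI ballI allI)
  show "0 \<in> keyideal S"
    by (simp add: keyideal_def)
  show "f + g \<in> keyideal S" if "f \<in> keyideal S" "g \<in> keyideal S" for f g
    using that keys_add[of f g] by (auto simp: keyideal_def)
  show "r * f \<in> keyideal S" if "f \<in> keyideal S" for r f
  proof -
    have "a + b \<in> S" if "b \<in> S" for a b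
      using assms that by (metis up_closed_def add.commute)
    then show ?thesis
      using that keys_mult[of r f] unfolding keyideal_def by blast
  qed
qed

lemma graded_ideal_keyideal: "up_closed S \<Longrightarrow> graded_ideal (keyideal S)"
  by (auto simp: graded_ideal_def is_ideal_keyideal) (auto simp: keyideal_def hom_component_eq_part keys_part)

lemma keyideal_subset_of_mon:
  assumes "is_ideal I" "\<And>u. u \<in> S \<Longrightarrow> mon u \<in> I"
  shows "keyideal S \<subseteq> I"
proof
  fix f :: "('a, 'b) mpoly"
  assume "f \<in> keyideal S"
  then have "f = part S f"
    by (simp add: keyideal_def part_all)
  also have "\<dots> = (\<Sum>u\<in>keys f \<inter> S. Poly_Mapping.single 0 (lk f u) * mon u)"
    by (simp add: part_def mon_def mult_single)
  also have "\<dots> \<in> I"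
    by (intro ideal_sum ideal_mult assms) auto
  finally show "f \<in> I" .
qed

lemma ideal_gen_mon: "ideal_gen (mon ` U) = keyideal (up U)"
proof
  show "ideal_gen (mon ` U) \<subseteq> keyideal (up U)"
  proof (intro ideal_gen_minimal is_ideal_keyideal up_closed_up)
    show "mon ` U \<subseteq> keyideal (up U)"
      unfolding up_def using divides_refl by (fastforce simp: mon_in_keyideal_iff)
  qed
  show "keyideal (up U) \<subseteq> ideal_gen (mon ` U)"
  proof (intro keyideal_subset_of_mon is_ideal_ideal_gen)
    fix v assume "v \<in> up U"
    then obtain u w where "u \<in> U" "v = w + u"
      by (auto simp: up_def divides_iff_add add.commute)
    then show "mon v \<in> ideal_gen (mon ` U)"
      using ideal_mult[OF is_ideal_ideal_gen, of "mon u" "mon ` U" "mon w"]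
        ideal_gen_superset[of "mon ` U"]
      by (auto simp: mon_mult)
  qed
qed

lemma times_ideal_gen_mon: "mon u *o ideal_gen (mon ` U) = ideal_gen (mon ` ((+) u ` U))"
proof
  show "mon u *o ideal_gen (mon ` U) \<subseteq> ideal_gen (mon ` ((+) u ` U))"
  proof
    fix x assume "x \<in> mon u *o ideal_gen (mon ` U)"
    then obtain f where f: "f \<in> ideal_gen (mon ` U)" "x = mon u * f"
      by (auto simp: elt_set_times_def)
    have "\<exists>w\<in>U. divides (u + w) (u + k)" if "k \<in> keys f" for k
      using f(1) that
      by (auto simp: ideal_gen_mon keyideal_def up_def divides_def lookup_add)
    then show "x \<in> ideal_gen (mon ` ((+) u ` U))"
      by (auto simp: f(2) ideal_gen_mon keyideal_def keys_mon_mult up_def)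
  qed
  show "ideal_gen (mon ` ((+) u ` U)) \<subseteq> mon u *o ideal_gen (mon ` U)"
  proof (intro ideal_gen_minimal is_ideal_times is_ideal_ideal_gen)
    show "mon ` (+) u ` U \<subseteq> mon u *o ideal_gen (mon ` U)"
      using ideal_gen_superset[of "mon ` U"] by (auto simp flip: mon_mult)
  qed
qed

lemma plus_ideal_gen_mon: "ideal_gen (mon ` U) + ideal_gen (mon ` V) = ideal_gen (mon ` (U \<union> V))"
  by (simp add: image_Un ideal_gen_Un)

section \<open>Minimal monomial generators and their gcd\<close>

definition antichain :: "'v monomial set \<Rightarrow> bool"
  where "antichain U \<longleftrightarrow> (\<forall>u\<in>U. \<forall>v\<in>U. divides u v \<longrightarrow> u = v)"

text \<open>An element of \<open>U\<close> lies above one of \<open>V\<close>, which in turn lies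
  above one of \<open>U\<close>; in an antichain both steps are equalities.\<close>

lemma antichain_up_eq_imp_subset:
  assumes "antichain U" "up U = up V"
  shows "U \<subseteq> V"
proof
  fix u assume u: "u \<in> U"
  then have "u \<in> up U"
    using divides_refl by (auto simp: up_def)
  then have "u \<in> up V"
    by (simp add: assms(2))
  then obtain v where v: "v \<in> V" "divides v u"
    by (auto simp: up_def)
  then have "v \<in> up V"
    using divides_refl by (auto simp: up_def)
  then have "v \<in> up U"
    by (simp add: assms(2))
  then obtain u' where u': "u' \<in> U" "divides u' v"
    by (auto simp: up_def)
  then have "u' = u"
    using assms(1) u v divides_trans by (metis antichain_def)
  then show "u \<in> V"
    using u' v divides_antisym by metis
qed

lemma minimal_imp_antichain:
  assumes "\<forall>V'. V' \<subset> V \<longrightarrow> up V \<noteq> up V'"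
  shows "antichain V"
  unfolding antichain_def
proof (intro ballI impI, rule ccontr)
  fix u v assume uv: "u \<in> V" "v \<in> V" "divides u v" "u \<noteq> v"
  have "up V = up (V - {v})"
    using uv divides_trans by (fastforce simp: up_def)
  then show False
    using assms uv by blast
qed

text \<open>\<open>min_gens\<close> is a definite description, so uniqueness has to be shown:
  irredundance forces a generating set to be an antichain, and antichains with the same up-set
  coincide.\<close>

lemma min_gens_eq:
  assumes "antichain U"
  shows "min_gens (ideal_gen (mon ` U) :: ('v, 'k::field) mpoly set) = U"
  unfolding min_gens_def
proof (rule the_equality)
  show "ideal_gen (mon ` U) = (ideal_gen (mon ` U) :: ('v, 'k) mpoly set) \<and>
    (\<forall>U'\<subset>U. ideal_gen (mon ` U) \<noteq> (ideal_gen (mon ` U') :: ('v, 'k) mpoly set))"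
    using antichain_up_eq_imp_subset[OF assms] by (auto simp: ideal_gen_mon keyideal_inject)
  fix V
  assume "ideal_gen (mon ` U) = (ideal_gen (mon ` V) :: ('v, 'k) mpoly set) \<and>
    (\<forall>U'\<subset>V. ideal_gen (mon ` U) \<noteq> (ideal_gen (mon ` U') :: ('v, 'k) mpoly set))"
  then have "up U = up V" "antichain V"
    by (auto simp: ideal_gen_mon keyideal_inject intro: minimal_imp_antichain)
  then show "V = U"
    using antichain_up_eq_imp_subset assms by (metis subset_antisym)
qed

lemma ex_minimal_divisor:
  fixes W :: "'v::finite monomial set"
  assumes "w \<in> W"
  shows "\<exists>u\<in>W. divides u w \<and> (\<forall>v\<in>W. divides v u \<longrightarrow> v = u)"
  using assms
proof (induction "mdeg w" arbitrary: w rule: less_induct)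
  case less
  show ?case
  proof (cases "\<forall>v\<in>W. divides v w \<longrightarrow> v = w")
    case False
    then obtain v where v: "v \<in> W" "divides v w" "v \<noteq> w" by blast
    then have "mdeg v < mdeg w"
      by (metis divides_iff_add divides_same_degree less_add_same_cancel1 mdeg_add neq0_conv add.right_neutral)
    then show ?thesis
      using less v divides_trans by metis
  qed (use less divides_refl in blast)
qed

lemma monomial_ideal_min_gens:
  fixes I :: "('v::finite, 'k::field) mpoly set"
  assumes "monomial_ideal I"
  shows "I = ideal_gen (mon ` min_gens I)" "antichain (min_gens I)"
proof -
  obtain W where W: "I = ideal_gen (mon ` W)"
    using assms by (auto simp: monomial_ideal_def)
  define U where "U = {u\<in>W. \<forall>v\<in>W. divides v u \<longrightarrow> v = u}"
  have "\<exists>u\<in>U. divides u w" if "w \<in> W" for w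
    using ex_minimal_divisor[OF that] by (auto simp: U_def)
  then have "up W = up U"
    unfolding up_def U_def using divides_trans by blast
  then have I: "I = ideal_gen (mon ` U)"
    by (simp add: W ideal_gen_mon)
  have U: "antichain U"
    by (auto simp: U_def antichain_def)
  have "min_gens I = U"
    using min_gens_eq[OF U] I by simp
  then show "I = ideal_gen (mon ` min_gens I)" "antichain (min_gens I)"
    using I U by auto
qed

lemma antichain_same_degree: "\<forall>u\<in>U. mdeg u = d \<Longrightarrow> antichain U"
  by (auto simp: antichain_def divides_same_degree)

lemma monomial_ideal_gen: "monomial_ideal (ideal_gen (mon ` U))"
  by (auto simp: monomial_ideal_def)

lemma ideal_supp_eq:
  fixes I :: "('v::finite, 'k::field) mpoly set"
  shows "ideal_supp I = {i. \<exists>u\<in>min_gens I. i \<notin> zero_set u}"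
  unfolding ideal_supp_def Var_dvd_mon_iff ..

lemma ideal_gcd_eq:
  fixes I :: "('v::finite, 'k::field) mpoly set"
  assumes "\<forall>u\<in>min_gens I. divides g u" "\<forall>i. \<exists>u\<in>min_gens I. lk u i = lk g i"
  shows "ideal_gcd I = mon g"
  unfolding ideal_gcd_def
proof (rule the_equality)
  show *: "mon g \<in> range mon \<and> (\<forall>u\<in>min_gens I. mon g dvd (mon u :: ('v, 'k) mpoly)) \<and>
    (\<forall>h\<in>range mon. (\<forall>u\<in>min_gens I. h dvd mon u) \<longrightarrow> h dvd (mon g :: ('v, 'k) mpoly))"
  proof (intro conjI ballI impI)
    show "mon g \<in> range mon"
      by simp
    show "mon g dvd (mon u :: ('v, 'k) mpoly)" if "u \<in> min_gens I" for u
      using assms(1) that by (simp add: mon_dvd_mon_iff)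
    fix h :: "('v, 'k) mpoly"
    assume "h \<in> range mon" and h: "\<forall>u\<in>min_gens I. h dvd mon u"
    then obtain h' where h': "h = mon h'"
      by auto
    have "lk h' i \<le> lk g i" for i
    proof -
      obtain u where "u \<in> min_gens I" "lk u i = lk g i"
        using assms(2) by blast
      then show ?thesis
        using h by (metis h' mon_dvd_mon_iff divides_def)
    qed
    then show "h dvd mon g"
      by (simp add: h' mon_dvd_mon_iff divides_def)
  qed
  show "h = mon g" if h: "h \<in> range mon \<and> (\<forall>u\<in>min_gens I. h dvd (mon u :: ('v, 'k) mpoly)) \<and>
    (\<forall>h'\<in>range mon. (\<forall>u\<in>min_gens I. h' dvd mon u) \<longrightarrow> h' dvd h)" for h
  proof -
    obtain h' where h': "h = mon h'"
      using h by auto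
    have "h dvd mon g" "mon g dvd h"
      using h * by auto
    then show ?thesis
      using divides_antisym by (auto simp: h' mon_dvd_mon_iff mon_inject)
  qed
qed

text \<open>The exponentwise minimum \<open>g'\<close> is attained by some generator in each
  variable, and it is the gcd; hence it equals \<open>g\<close>.\<close>

lemma ideal_gcd_spec:
  fixes I :: "('v::finite, 'k::field) mpoly set"
  assumes "min_gens I \<noteq> {}" "ideal_gcd I = mon g"
  shows "\<exists>u\<in>min_gens I. lk u i = lk g i"
proof -
  define g' where "g' = Abs_poly_mapping (\<lambda>i. LEAST n. \<exists>u\<in>min_gens I. lk u i = n)"
  have g': "lk g' i = (LEAST n. \<exists>u\<in>min_gens I. lk u i = n)" for i
    by (simp add: g'_def)
  have ex: "\<forall>i. \<exists>u\<in>min_gens I. lk u i = lk g' i"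
    unfolding g' using assms(1) LeastI_ex[of "\<lambda>n. \<exists>u\<in>min_gens I. lk u i = n" for i] by blast
  have "\<forall>u\<in>min_gens I. divides g' u"
    unfolding g' divides_def by (auto intro: Least_le)
  then have "ideal_gcd I = mon g'"
    using ex by (rule ideal_gcd_eq)
  then show ?thesis
    using ex assms(2) by (simp add: mon_inject)
qed


section \<open>Algebraic independence modulo an ideal\<close>

text \<open>Both chains of prime ideals and regular sequences give rise to such chains of ideals.\<close>

inductive regular_chain :: "'a::comm_ring_1 list \<Rightarrow> 'a set \<Rightarrow> bool" where
  Nil: "is_ideal C \<Longrightarrow> 1 \<notin> C \<Longrightarrow> regular_chain [] C"
| Cons: "is_ideal C \<Longrightarrow> C \<subseteq> C' \<Longrightarrow> f \<in> C' \<Longrightarrow> (\<And>r. f * r \<in> C \<Longrightarrow> r \<in> C) \<Longrightarrow>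
    regular_chain fs C' \<Longrightarrow> regular_chain (f # fs) C"

lemma regular_chain_is_ideal: "regular_chain fs C \<Longrightarrow> is_ideal C"
  by (erule regular_chain.cases) auto

fun power_product :: "'a::comm_ring_1 list \<Rightarrow> nat list \<Rightarrow> 'a" where
  "power_product (f # fs) (a # as) = f ^ a * power_product fs as"
| "power_product _ _ = 1"

abbreviation const :: "'k::field \<Rightarrow> ('v, 'k) mpoly"
  where "const c \<equiv> Poly_Mapping.single 0 c"

lemma lookup_const_mult: "lk (const c * f) k = c * lk f k"
  unfolding mult_map_scale_conv_mult[symmetric] by (simp add: map.rep_eq when_def)

text \<open>Among the terms with nonzero coefficient let \<open>k\<close> be the least exponent of
  \<open>f\<close>. Cancelling \<open>f ^ k\<close> modulo \<open>C\<close> and then passing to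
  \<open>C'\<close>, which contains \<open>f\<close>, leaves only the terms of exponent exactly
  \<open>k\<close>: a relation in \<open>fs\<close>, excluded by induction.\<close>

lemma regular_chain_independent:
  fixes C :: "('v, 'k::field) mpoly set"
  assumes "regular_chain fs C" "finite X" "\<forall>\<alpha>\<in>X. length \<alpha> = length fs"
    "(\<Sum>\<alpha>\<in>X. const (c \<alpha>) * power_product fs \<alpha>) \<in> C"
  shows "\<forall>\<alpha>\<in>X. c \<alpha> = 0"
  using assms
proof (induction arbitrary: X c rule: regular_chain.induct)
  case (Nil C)
  show ?case
  proof (rule ccontr)
    assume "\<not> ?thesis"
    then have X: "X = {[]}" and c: "c [] \<noteq> 0"
      using Nil.prems(2) by auto
    have "const (inverse (c [])) * const (c []) \<in> C"
      using Nil.prems(3) by (intro ideal_mult[OF Nil.hyps(1)]) (simp add: X)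
    then show False
      using Nil.hyps(2) c by (simp add: mult_single)
  qed
next
  case (Cons C C' f fs)
  show ?case
  proof (rule ccontr)
    assume neg: "\<not> (\<forall>\<alpha>\<in>X. c \<alpha> = 0)"
    define X0 where "X0 = {\<alpha>\<in>X. c \<alpha> \<noteq> 0}"
    have X0: "finite X0" "X0 \<noteq> {}"
      using neg Cons.prems(1) by (auto simp: X0_def)
    define k where "k = Min (hd ` X0)"
    have k_le: "k \<le> hd \<alpha>" if "\<alpha> \<in> X0" for \<alpha>
      using X0 that by (auto simp: k_def)
    have "k \<in> hd ` X0"
      using X0 by (auto simp: k_def intro: Min_in)
    define X1 where "X1 = {\<alpha>\<in>X0. hd \<alpha> = k}"
    have X1: "X1 \<noteq> {}" "finite X1" "X1 \<subseteq> X0"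
      using \<open>k \<in> hd ` X0\<close> X0 by (auto simp: X1_def)
    have hd_tl: "\<alpha> = hd \<alpha> # tl \<alpha>" if "\<alpha> \<in> X0" for \<alpha>
      using that Cons.prems(2) by (cases \<alpha>) (auto simp: X0_def)
    define g where "g \<alpha> = const (c \<alpha>) * (f ^ (hd \<alpha> - k) * power_product fs (tl \<alpha>))" for \<alpha>
    have cancel: "r \<in> C" if "f ^ m * r \<in> C" for m r
      using that by (induction m) (auto simp: mult.assoc intro: Cons.hyps(4))
    have "(\<Sum>\<alpha>\<in>X. const (c \<alpha>) * power_product (f # fs) \<alpha>)
        = (\<Sum>\<alpha>\<in>X0. const (c \<alpha>) * power_product (f # fs) \<alpha>)"
      using Cons.prems(1) by (intro sum.mono_neutral_right) (auto simp: X0_def)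
    also have "\<dots> = (\<Sum>\<alpha>\<in>X0. f ^ k * g \<alpha>)"
    proof (rule sum.cong[OF refl])
      fix \<alpha> assume \<alpha>: "\<alpha> \<in> X0"
      then have "f ^ hd \<alpha> = f ^ k * f ^ (hd \<alpha> - k)"
        using k_le by (simp flip: power_add)
      moreover have "power_product (f # fs) \<alpha> = f ^ hd \<alpha> * power_product fs (tl \<alpha>)"
        by (subst hd_tl[OF \<alpha>]) simp
      ultimately show "const (c \<alpha>) * power_product (f # fs) \<alpha> = f ^ k * g \<alpha>"
        by (simp only: g_def mult.assoc mult.left_commute)
    qed
    finally have "f ^ k * sum g X0 \<in> C"
      using Cons.prems(3) by (simp add: sum_distrib_left)
    then have "sum g X0 \<in> C'"
      using cancel Cons.hyps(2) by blast
    have C': "is_ideal C'"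
      using Cons.hyps(5) by (rule regular_chain_is_ideal)
    have "sum g (X0 - X1) \<in> C'"
    proof (rule ideal_sum[OF C'])
      fix \<alpha> assume "\<alpha> \<in> X0 - X1"
      then have "hd \<alpha> - k = Suc (hd \<alpha> - k - 1)"
        using k_le[of \<alpha>] by (auto simp: X1_def)
      then have "f ^ (hd \<alpha> - k) = f * f ^ (hd \<alpha> - k - 1)"
        by (metis power_Suc)
      then have "g \<alpha> = (const (c \<alpha>) * (f ^ (hd \<alpha> - k - 1) * power_product fs (tl \<alpha>))) * f"
        by (simp only: g_def ac_simps)
      then show "g \<alpha> \<in> C'"
        using ideal_mult[OF C' Cons.hyps(3)] by simp
    qed
    then have "sum g X1 \<in> C'"
      using \<open>sum g X0 \<in> C'\<close> X1 X0 ideal_diff[OF C', of "sum g X0" "sum g (X0 - X1)"]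
      by (simp add: sum_diff)
    also have "sum g X1 = (\<Sum>\<beta>\<in>tl ` X1. const (c (k # \<beta>)) * power_product fs \<beta>)"
    proof (subst sum.reindex)
      show "inj_on tl X1"
        using hd_tl X1(3) by (auto simp: inj_on_def X1_def) metis
      have "g \<alpha> = const (c (k # tl \<alpha>)) * power_product fs (tl \<alpha>)" if "\<alpha> \<in> X1" for \<alpha>
      proof -
        have "k # tl \<alpha> = \<alpha>"
          using that hd_tl[of \<alpha>] by (auto simp: X1_def)
        then show ?thesis
          using that by (simp add: g_def X1_def)
      qed
      then show "sum g X1 = sum ((\<lambda>\<beta>. const (c (k # \<beta>)) * power_product fs \<beta>) \<circ> tl) X1"
        by simp
    qed
    finally have "\<forall>\<beta>\<in>tl ` X1. c (k # \<beta>) = 0"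
      using X1 Cons.prems(2) by (intro Cons.IH) (auto simp: X0_def)
    moreover obtain \<alpha> where "\<alpha> \<in> X1"
      using X1 by blast
    moreover from this have "k # tl \<alpha> = \<alpha>" "c \<alpha> \<noteq> 0"
      using hd_tl[of \<alpha>] by (auto simp: X1_def X0_def)
    ultimately show False
      by auto
  qed
qed

text \<open>Gaussian elimination: a nonzero \<open>M x0 y\<close> is the pivot that clears column
  \<open>y\<close>, and the coefficient of \<open>x0\<close> is chosen afterwards to undo the
  subtracted multiples of its row.\<close>

lemma ex_linear_relation:
  fixes M :: "'x \<Rightarrow> 'y \<Rightarrow> 'k::field"
  assumes "finite Y" "finite X" "card Y < card X"
  shows "\<exists>c. (\<exists>x\<in>X. c x \<noteq> 0) \<and> (\<forall>y\<in>Y. (\<Sum>x\<in>X. c x * M x y) = 0)"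
  using assms
proof (induction Y arbitrary: X M rule: finite_induct)
  case empty
  then show ?case
    by (intro exI[of _ "\<lambda>_. 1"]) (auto simp: card_gt_0_iff)
next
  case (insert y Y)
  show ?case
  proof (cases "\<forall>x\<in>X. M x y = 0")
    case True
    moreover have "card Y < card X"
      using insert by simp
    then obtain c where "\<exists>x\<in>X. c x \<noteq> 0" "\<forall>y\<in>Y. (\<Sum>x\<in>X. c x * M x y) = 0"
      using insert.IH[of X M] insert.prems by blast
    ultimately show ?thesis
      by (intro exI[of _ c]) auto
  next
    case False
    then obtain x0 where x0: "x0 \<in> X" "M x0 y \<noteq> 0" by blast
    define q where "q x = M x y / M x0 y" for x
    have "card Y < card (X - {x0})" "finite (X - {x0})"
      using insert x0 by auto
    then obtain c where c: "\<exists>x\<in>X - {x0}. c x \<noteq> 0"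
      "\<forall>z\<in>Y. (\<Sum>x\<in>X - {x0}. c x * (M x z - q x * M x0 z)) = 0"
      using insert.IH[of "X - {x0}" "\<lambda>x z. M x z - q x * M x0 z"] by blast
    define b where "b = c(x0 := - (\<Sum>x\<in>X - {x0}. c x * q x))"
    have sum_b: "(\<Sum>x\<in>X. b x * M x z) = (\<Sum>x\<in>X - {x0}. c x * (M x z - q x * M x0 z))" for z
    proof -
      have "(\<Sum>x\<in>X. b x * M x z) = b x0 * M x0 z + (\<Sum>x\<in>X - {x0}. b x * M x z)"
        using insert.prems x0 by (simp add: sum.remove)
      also have "(\<Sum>x\<in>X - {x0}. b x * M x z) = (\<Sum>x\<in>X - {x0}. c x * M x z)"
        by (intro sum.cong) (auto simp: b_def)
      also have "b x0 * M x0 z = - (\<Sum>x\<in>X - {x0}. c x * (q x * M x0 z))"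
        by (simp only: b_def fun_upd_same mult_minus_left sum_distrib_right mult.assoc)
      finally show ?thesis
        by (simp add: right_diff_distrib sum_subtractf)
    qed
    have "(\<Sum>x\<in>X. b x * M x y) = 0"
      using x0 by (simp add: sum_b q_def)
    moreover have "\<exists>x\<in>X. b x \<noteq> 0"
      using c(1) by (auto simp: b_def)
    ultimately show ?thesis
      using c(2) by (intro exI[of _ b]) (simp add: sum_b)
  qed
qed

section \<open>Counting monomials with bounded exponents\<close>

definition exps_bounded :: "nat \<Rightarrow> ('v, 'k::field) mpoly \<Rightarrow> bool"
  where "exps_bounded T f \<longleftrightarrow> (\<forall>k\<in>keys f. \<forall>i. lk k i \<le> T)"

lemma exps_bounded_mult: "exps_bounded S f \<Longrightarrow> exps_bounded T g \<Longrightarrow> exps_bounded (S + T) (f * g)"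
  unfolding exps_bounded_def
proof (intro ballI allI)
  fix k i
  assume *: "\<forall>k\<in>keys f. \<forall>i. lk k i \<le> S" "\<forall>k\<in>keys g. \<forall>i. lk k i \<le> T" and "k \<in> keys (f * g)"
  then obtain a b where "k = a + b" "a \<in> keys f" "b \<in> keys g"
    using keys_mult[of f g] by blast
  then show "lk k i \<le> S + T"
    using * by (simp add: lookup_add add_mono)
qed

lemma exps_bounded_one: "exps_bounded T 1"
  by (simp add: exps_bounded_def)

lemma exps_bounded_power: "exps_bounded S f \<Longrightarrow> exps_bounded (n * S) (f ^ n)"
  by (induction n) (auto intro: exps_bounded_mult exps_bounded_one)

lemma exps_bounded_mono: "exps_bounded S f \<Longrightarrow> S \<le> T \<Longrightarrow> exps_bounded T f"
  unfolding exps_bounded_def using le_trans by blast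

text \<open>What matters is that the bound is linear in \<open>t\<close>: the number of monomials
  below it in at most \<open>d\<close> variables then grows only like \<open>t ^ d\<close>.\<close>

lemma exps_bounded_power_product:
  assumes "\<forall>f\<in>set fs. exps_bounded D f" "\<forall>a\<in>set as. a \<le> t"
  shows "exps_bounded (length fs * (t * D)) (power_product fs as)"
  using assms
proof (induction fs as rule: power_product.induct)
  case (1 f fs a as)
  have "exps_bounded (t * D) (f ^ a)"
    using 1 exps_bounded_power[of D f a] by (auto intro: exps_bounded_mono)
  then show ?case
    using 1 by (auto intro: exps_bounded_mult)
qed (auto intro: exps_bounded_one)

lemma ex_exps_bounded: "\<exists>D. \<forall>f\<in>set fs. exps_bounded D f" for fs :: "('v::finite, 'k::field) mpoly list"
proof (induction fs)
  case (Cons f fs)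
  then obtain D where D: "\<forall>f\<in>set fs. exps_bounded D f" by blast
  define D' where "D' = (\<Sum>k\<in>keys f. mdeg k)"
  have "lk k i \<le> D'" if "k \<in> keys f" for k i
  proof -
    have "lk k i \<le> mdeg k"
      unfolding mdeg_def by (rule member_le_sum) auto
    also have "\<dots> \<le> D'"
      unfolding D'_def using that by (intro member_le_sum) auto
    finally show ?thesis .
  qed
  then have "exps_bounded D' f"
    by (simp add: exps_bounded_def)
  then show ?case
    using D by (intro exI[of _ "max D D'"]) (auto intro: exps_bounded_mono)
qed simp

text \<open>A monomial is determined by its support and the exponents there. The crude count of all
  supports is a factor independent of \<open>T\<close>, so the order of growth is still
  \<open>d\<close>.\<close>

lemma card_bounded_monomials:
  fixes d T :: nat
  defines "Y \<equiv> {k :: 'v::finite monomial. card (- zero_set k) \<le> d \<and> (\<forall>i. lk k i \<le> T)}"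
  shows "finite Y" "card Y \<le> 2 ^ CARD('v) * (T + 1) ^ d"
proof -
  define Z where "Z = Sigma {S :: 'v set. card S \<le> d} (\<lambda>S. PiE S (\<lambda>_. {..T}))"
  define h where "h k = (- zero_set k, restrict (lk k) (- zero_set k))" for k :: "'v monomial"
  have "inj h"
  proof (rule injI, rule poly_mapping_eqI)
    fix k l :: "'v monomial" and i assume "h k = h l"
    then have zero_set: "zero_set k = zero_set l"
      and "restrict (lk k) (- zero_set k) = restrict (lk l) (- zero_set l)"
      by (auto simp: h_def)
    then have "restrict (lk k) (- zero_set k) i = restrict (lk l) (- zero_set l) i"
      by metis
    moreover have "lk k i = 0 \<and> lk l i = 0" if "i \<in> zero_set k"
      using that zero_set[symmetric] by (auto simp: zero_set_def)
    ultimately show "lk k i = lk l i"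
      using zero_set by (cases "i \<in> zero_set k") simp_all
  qed
  then have inj: "inj_on h Y"
    by (rule inj_on_subset) simp
  have sub: "h ` Y \<subseteq> Z"
    by (auto simp: h_def Y_def Z_def)
  have fin: "finite Z"
    unfolding Z_def by (intro finite_SigmaI finite_PiE) auto
  show "finite Y"
    using finite_subset[OF sub fin] inj finite_imageD by blast
  have "card Y \<le> card Z"
    using card_inj_on_le[OF inj sub fin] .
  also have "card Z = (\<Sum>S | card S \<le> d. card (PiE (S :: 'v set) (\<lambda>_. {..T})))"
    unfolding Z_def by (intro card_SigmaI) (auto intro: finite_PiE)
  also have "\<dots> \<le> (\<Sum>S | card (S :: 'v set) \<le> d. (T + 1) ^ d)"
    by (intro sum_mono) (auto simp: card_PiE intro: power_increasing)
  also have "\<dots> \<le> 2 ^ CARD('v) * (T + 1) ^ d"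
  proof -
    have "card {S :: 'v set. card S \<le> d} \<le> card (Pow (UNIV :: 'v set))"
      by (intro card_mono) auto
    then show ?thesis
      by (simp add: card_Pow)
  qed
  finally show "card Y \<le> 2 ^ CARD('v) * (T + 1) ^ d" .
qed

text \<open>For a squarefree monomial ideal, containing all of these monomials says that no face of
  its complex has more than \<open>d\<close> vertices. This is the form in which dimension at most
  \<open>d\<close> is used.\<close>

definition large_support :: "nat \<Rightarrow> 'v::finite monomial set"
  where "large_support d = {k. d < card (- zero_set k)}"

text \<open>Modulo the monomials with more than \<open>d\<close> variables, the number of monomials with exponents
  up to \<open>t\<close> grows like \<open>t ^ d\<close>, while the power products of \<open>fs\<close> grow with exponent \<open>length fs\<close>.\<close>

lemma regular_chain_length:
  fixes C :: "('v::finite, 'k::field) mpoly set"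
  assumes "regular_chain fs C" "keyideal (large_support d) \<subseteq> C"
  shows "length fs \<le> d"
proof (rule ccontr)
  assume "\<not> length fs \<le> d"
  define n where "n = length fs"
  obtain D where D: "\<forall>f\<in>set fs. exps_bounded D f"
    using ex_exps_bounded by blast
  \<comment> \<open>Chosen so that the constant factor is absorbed:
    \<open>card Y \<le> t * (t + 1) ^ d < (t + 1) ^ Suc d \<le> card X\<close>.\<close>
  define t where "t = 2 ^ CARD('v) * (n * D + 1) ^ d"
  define T where "T = n * (t * D)"
  define X where "X = {\<alpha>. set \<alpha> \<subseteq> {..t} \<and> length \<alpha> = n}"
  define Y where "Y = {k :: 'v monomial. card (- zero_set k) \<le> d \<and> (\<forall>i. lk k i \<le> T)}"
  have X: "finite X" "card X = (t + 1) ^ n"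
    by (simp_all add: X_def finite_lists_length_eq card_lists_length_eq)
  have "card Y \<le> 2 ^ CARD('v) * (T + 1) ^ d"
    unfolding Y_def by (rule card_bounded_monomials)
  also have "\<dots> \<le> 2 ^ CARD('v) * ((n * D + 1) * (t + 1)) ^ d"
    by (intro mult_left_mono power_mono) (auto simp: T_def algebra_simps)
  also have "\<dots> = t * (t + 1) ^ d"
    by (simp only: t_def power_mult_distrib mult.assoc)
  also have "\<dots> < (t + 1) ^ Suc d"
    by simp
  also have "\<dots> \<le> (t + 1) ^ n"
    using \<open>\<not> length fs \<le> d\<close> by (intro power_increasing) (auto simp: n_def)
  finally have "card Y < card X"
    using X by simp
  moreover have "finite Y"
    unfolding Y_def by (rule card_bounded_monomials)
  \<comment> \<open>There are more power products than monomials in \<open>Y\<close>, so some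
    combination \<open>F\<close> has no monomial in \<open>Y\<close>. Its exponents are at most
    \<open>T\<close>, hence all of its monomials have more than \<open>d\<close> variables and
    \<open>F\<close> lies in \<open>C\<close>.\<close>
  ultimately obtain c where c: "\<exists>\<alpha>\<in>X. c \<alpha> \<noteq> 0"
    "\<forall>k\<in>Y. (\<Sum>\<alpha>\<in>X. c \<alpha> * lk (power_product fs \<alpha>) k) = 0"
    using ex_linear_relation[of Y X "\<lambda>\<alpha>. lk (power_product fs \<alpha>)"] X(1) by blast
  define F where "F = (\<Sum>\<alpha>\<in>X. const (c \<alpha>) * power_product fs \<alpha>)"
  have lookup_F: "lk F k = (\<Sum>\<alpha>\<in>X. c \<alpha> * lk (power_product fs \<alpha>) k)" for k
    by (simp add: F_def lookup_sum lookup_const_mult)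
  have "k \<in> large_support d" if k: "k \<in> keys F" for k
  proof -
    have "lk F k \<noteq> 0"
      using k by (simp add: in_keys_iff)
    then obtain \<alpha> where \<alpha>: "\<alpha> \<in> X" "k \<in> keys (power_product fs \<alpha>)"
      unfolding lookup_F by (metis (no_types, lifting) sum.neutral mult_zero_right in_keys_iff)
    have "exps_bounded T (power_product fs \<alpha>)"
      unfolding T_def n_def using D \<alpha>(1) by (intro exps_bounded_power_product) (auto simp: X_def)
    then have "\<forall>i. lk k i \<le> T"
      using \<alpha>(2) by (simp add: exps_bounded_def)
    moreover have "k \<notin> Y"
      using \<open>lk F k \<noteq> 0\<close> c(2) lookup_F by auto
    ultimately show ?thesis
      by (auto simp: Y_def large_support_def)
  qed
  then have "F \<in> C"
    using assms(2) by (auto simp: keyideal_def)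
  then have "\<forall>\<alpha>\<in>X. c \<alpha> = 0"
    using assms(1) X(1) unfolding F_def by (intro regular_chain_independent) (auto simp: X_def n_def)
  then show False
    using c(1) by blast
qed


section \<open>Krull dimension\<close>

text \<open>An element of \<open>P (Suc i)\<close> outside \<open>P i\<close> is no zero divisor
  modulo \<open>P i\<close>, because \<open>P i\<close> is prime; one such element is taken for each
  inclusion.\<close>

lemma ex_regular_chain_of_prime_chain:
  assumes "\<forall>i\<le>n. is_prime_ideal (P i)" "\<forall>i<n. P i \<subset> P (Suc i)"
  shows "\<exists>fs. length fs = n \<and> regular_chain fs (P 0)"
  using assms
proof (induction n arbitrary: P)
  case 0
  have "1 \<notin> P 0"
  proof
    assume "1 \<in> P 0"
    then have "r * 1 \<in> P 0" for r
      using 0 by (intro ideal_mult) (auto simp: is_prime_ideal_def)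
    then show False
      using 0 by (auto simp: is_prime_ideal_def)
  qed
  then show ?case
    using 0 by (auto simp: is_prime_ideal_def intro: regular_chain.Nil)
next
  case (Suc n)
  obtain fs where fs: "length fs = n" "regular_chain fs (P (Suc 0))"
    using Suc.IH[of "\<lambda>i. P (Suc i)"] Suc.prems by auto
  obtain f where f: "f \<in> P (Suc 0)" "f \<notin> P 0"
    using Suc.prems(2) by blast
  have "regular_chain (f # fs) (P 0)"
  proof (rule regular_chain.Cons[OF _ _ f(1) _ fs(2)])
    show "is_ideal (P 0)" "P 0 \<subseteq> P (Suc 0)"
      using Suc.prems by (auto simp: is_prime_ideal_def)
    show "r \<in> P 0" if "f * r \<in> P 0" for r
      using that f Suc.prems(1) by (auto simp: is_prime_ideal_def)
  qed
  then show ?case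
    using fs by (intro exI[of _ "f # fs"]) simp
qed

lemma krull_dim_mod_le:
  fixes I :: "('v::finite, 'k::field) mpoly set"
  assumes "keyideal (large_support d) \<subseteq> I"
  shows "krull_dim_mod I \<le> enat d"
  unfolding krull_dim_mod_def
proof (rule Sup_least)
  fix x
  assume "x \<in> {enat n | n. \<exists>P :: nat \<Rightarrow> ('v, 'k) mpoly set.
    (\<forall>i\<le>n. is_prime_ideal (P i) \<and> I \<subseteq> P i) \<and> (\<forall>i<n. P i \<subset> P (Suc i))}"
  then obtain n and P :: "nat \<Rightarrow> ('v, 'k) mpoly set" where n: "x = enat n"
    "\<forall>i\<le>n. is_prime_ideal (P i)" "I \<subseteq> P 0" "\<forall>i<n. P i \<subset> P (Suc i)"
    by blast
  then obtain fs where "length fs = n" "regular_chain fs (P 0)"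
    using ex_regular_chain_of_prime_chain by blast
  then show "x \<le> enat d"
    using regular_chain_length[of fs "P 0" d] assms n by auto
qed

text \<open>The prime generated by the variables in \<open>D\<close>.\<close>

definition vars_prime :: "'v set \<Rightarrow> ('v, 'k::field) mpoly set"
  where "vars_prime D = keyideal {k. \<not> D \<subseteq> zero_set k}"

lemma is_ideal_vars_prime: "is_ideal (vars_prime D)"
  unfolding vars_prime_def by (rule is_ideal_keyideal) (auto simp: up_closed_def zero_set_add)

lemma vars_prime_subset_iff:
  "vars_prime D \<subseteq> (vars_prime D' :: ('v::finite, 'k::field) mpoly set) \<longleftrightarrow> D \<subseteq> D'"
proof
  assume "vars_prime D \<subseteq> (vars_prime D' :: ('v, 'k) mpoly set)"
  then have "\<not> D \<subseteq> zero_set (ind (- D')) \<longrightarrow> \<not> D' \<subseteq> zero_set (ind (- D'))"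
    unfolding vars_prime_def keyideal_subset_iff by blast
  then show "D \<subseteq> D'"
    by (auto simp: zero_set_ind)
qed (auto simp: vars_prime_def keyideal_def)

lemma mon_in_vars_prime_iff: "mon u \<in> (vars_prime D :: ('v, 'k::field) mpoly set) \<longleftrightarrow> \<not> D \<subseteq> zero_set u"
  by (simp add: vars_prime_def mon_in_keyideal_iff)

text \<open>Only the parts of \<open>f\<close> and \<open>g\<close> in the variables outside
  \<open>D\<close> matter. Their product stays in these variables, and the polynomial ring is a
  domain; the order on \<open>'v\<close> enters through this last fact, by way of an ordering of the
  monomials.\<close>

lemma is_prime_ideal_vars_prime:
  "is_prime_ideal (vars_prime D :: ('v::{finite, linorder}, 'k::field) mpoly set)"
  unfolding is_prime_ideal_def
proof (intro conjI allI impI)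
  let ?P = "vars_prime D :: ('v, 'k) mpoly set"
  let ?S = "{k :: 'v monomial. D \<subseteq> zero_set k}"
  have compl: "- ?S = {k. \<not> D \<subseteq> zero_set k}"
    by auto
  show "is_ideal ?P"
    by (rule is_ideal_vars_prime)
  have "mon 0 \<notin> ?P"
    by (simp add: mon_in_vars_prime_iff zero_set_zero)
  then show "?P \<noteq> UNIV"
    by auto
  fix f g assume fg: "f * g \<in> ?P"
  have in_P_iff: "h \<in> ?P \<longleftrightarrow> part ?S h = 0" for h
  proof -
    have "h \<in> ?P \<longleftrightarrow> keys (part ?S h) = {}"
      by (auto simp: keys_part vars_prime_def keyideal_def)
    then show ?thesis
      by simp
  qed
  have rest: "part (- ?S) h \<in> ?P" for h
    by (auto simp: vars_prime_def keyideal_def keys_part)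
  have "f * g = part ?S f * part ?S g + (part ?S f * part (- ?S) g + part (- ?S) f * g)"
  proof -
    have "part ?S f * part ?S g + (part ?S f * part (- ?S) g + part (- ?S) f * g)
        = part ?S f * (part ?S g + part (- ?S) g) + part (- ?S) f * g"
      by (simp only: distrib_left add.assoc)
    also have "\<dots> = f * g"
      by (simp only: part_split flip: distrib_right)
    finally show ?thesis ..
  qed
  moreover have "part ?S f * part (- ?S) g + part (- ?S) f * g \<in> ?P"
    by (intro ideal_add ideal_mult ideal_mult_right rest is_ideal_vars_prime)
  ultimately have "part ?S f * part ?S g \<in> ?P"
    using fg ideal_add_cancel[OF is_ideal_vars_prime] by (metis add.commute)
  moreover have "keys (part ?S f * part ?S g) \<subseteq> ?S"
    using keys_mult[of "part ?S f" "part ?S g"] by (fastforce simp: keys_part zero_set_add)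
  ultimately have "part ?S f * part ?S g = 0"
    unfolding in_P_iff by (simp add: part_all)
  then show "f \<in> ?P \<or> g \<in> ?P"
    by (simp add: in_P_iff)
qed

text \<open>Adding the remaining variables to \<open>D\<close> one at a time gives a chain of primes
  with one step for each variable outside \<open>D\<close>.\<close>

lemma krull_dim_mod_ge:
  fixes I :: "('v::{finite, linorder}, 'k::field) mpoly set"
  assumes "I \<subseteq> vars_prime D"
  shows "enat (card (- D)) \<le> krull_dim_mod I"
proof -
  obtain xs where xs: "set xs = - D" "distinct xs"
    using finite_distinct_list[of "- D"] by auto
  define P where "P i = (vars_prime (D \<union> set (take i xs)) :: ('v, 'k) mpoly set)" for i
  show ?thesis
    unfolding krull_dim_mod_def
  proof (rule Sup_upper, rule CollectI, intro exI conjI allI impI)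
    show "enat (card (- D)) = enat (card (- D))" ..
    fix i
    show "is_prime_ideal (P i)"
      unfolding P_def by (rule is_prime_ideal_vars_prime)
    show "I \<subseteq> P i"
      using assms vars_prime_subset_iff[of D "D \<union> set (take i xs)", where ?'k='k] by (auto simp: P_def)
    assume "i < card (- D)"
    then have i: "i < length xs"
      using xs distinct_card[of xs] by simp
    have "distinct (take i xs @ [xs ! i])" "xs ! i \<in> - D"
      using i xs distinct_take[of xs "Suc i"] nth_mem[of i xs] by (simp_all add: take_Suc_conv_app_nth)
    then have "xs ! i \<notin> D \<union> set (take i xs)"
      by simp
    moreover have "xs ! i \<in> set (take (Suc i) xs)"
      using i by (simp add: take_Suc_conv_app_nth)
    moreover have "set (take i xs) \<subseteq> set (take (Suc i) xs)"
      by (simp add: set_take_subset_set_take)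
    ultimately have "D \<union> set (take i xs) \<subseteq> D \<union> set (take (Suc i) xs)"
      "\<not> D \<union> set (take (Suc i) xs) \<subseteq> D \<union> set (take i xs)"
      by blast+
    then show "P i \<subset> P (Suc i)"
      unfolding P_def psubset_eq by (metis vars_prime_subset_iff)
  qed
qed


section \<open>Regular sequences\<close>

text \<open>Properness of the last quotient is split off: this part passes through isomorphisms and
  extensions by recursion on the list, while properness is checked separately. Each step only
  enlarges the denominator, so the module remains a pair of ideals.\<close>

fun weakly_regular :: "'a::comm_ring_1 list \<Rightarrow> 'a set \<Rightarrow> 'a set \<Rightarrow> bool" where
  "weakly_regular [] A B \<longleftrightarrow> True"
| "weakly_regular (r # rs) A B \<longleftrightarrow> (\<forall>a\<in>A. r * a \<in> B \<longrightarrow> a \<in> B) \<and> weakly_regular rs A (B + r *o A)"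

lemma seq_submodule_Nil: "seq_submodule A B [] = B"
  by (simp add: seq_submodule_def ideal_gen_empty flip: set_zero)

lemma seq_submodule_Cons:
  assumes "is_ideal A"
  shows "seq_submodule A B (r # rs) = seq_submodule A (B + r *o A) rs"
proof -
  have "{s * a | s a. s \<in> set (r # rs) \<and> a \<in> A} = r *o A \<union> {s * a | s a. s \<in> set rs \<and> a \<in> A}"
    by (auto simp: elt_set_times_def)
  then show ?thesis
    by (simp only: seq_submodule_def ideal_gen_Un ideal_gen_ideal is_ideal_times[OF assms] add.assoc)
qed

lemma regular_sequence_iff:
  assumes "is_ideal A"
  shows "regular_sequence A B rs \<longleftrightarrow> weakly_regular rs A B \<and> seq_submodule A B rs \<noteq> A"
proof -
  have "weakly_regular rs A B \<longleftrightarrow> (\<forall>i<length rs. \<forall>a\<in>A.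
    rs ! i * a \<in> seq_submodule A B (take i rs) \<longrightarrow> a \<in> seq_submodule A B (take i rs))"
  proof (induction rs arbitrary: B)
    case (Cons r rs)
    then show ?case
      by (simp add: All_less_Suc2 seq_submodule_Cons[OF assms] seq_submodule_Nil)
  qed simp
  then show ?thesis
    by (simp add: regular_sequence_def)
qed

lemma seq_submodule_subset:
  assumes "is_ideal A" "B \<subseteq> A"
  shows "seq_submodule A B rs \<subseteq> A"
  unfolding seq_submodule_def
  by (intro ideal_plus_least ideal_gen_minimal assms) (use ideal_mult[OF assms(1)] in auto)

text \<open>The annihilators of the class of \<open>a\<close> in the successive quotients form the
  chain: \<open>r\<close> cancels from \<open>r * (s * a)\<close> by regularity,
  \<open>r * a\<close> vanishes in the next quotient, and \<open>1\<close> stays outside to the end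
  because \<open>a\<close> survives.\<close>

lemma regular_chain_of_weakly_regular:
  assumes "is_ideal A" "is_ideal B" "weakly_regular rs A B" "a \<in> A" "a \<notin> seq_submodule A B rs"
  shows "regular_chain rs {r. r * a \<in> B}"
  using assms(2,3,5)
proof (induction rs arbitrary: B)
  have ideal: "is_ideal {r. r * a \<in> B}" if "is_ideal B" for B
    using is_ideal_annihilator[OF that, of "{a}"] by (simp add: annihilator_def)
  {
    case Nil
    then show ?case
      by (auto intro!: regular_chain.Nil ideal simp: seq_submodule_Nil)
  next
    case (Cons r rs)
    let ?B = "B + r *o A"
    have B: "is_ideal ?B"
      by (intro is_ideal_plus is_ideal_times Cons assms)
    show ?case
    proof (rule regular_chain.Cons[where C' = "{s. s * a \<in> ?B}"])
      show "is_ideal {s. s * a \<in> B}"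
        by (rule ideal[OF Cons.prems(1)])
      show "{s. s * a \<in> B} \<subseteq> {s. s * a \<in> ?B}"
        using ideal_plus_upper1[OF is_ideal_times[OF assms(1)], of B r] by auto
      show "r \<in> {s. s * a \<in> ?B}"
        using ideal_plus_upper2[OF Cons.prems(1), of "r *o A"] assms(4) by auto
      show "s \<in> {s. s * a \<in> B}" if "r * s \<in> {s. s * a \<in> B}" for s
      proof -
        have "r * (s * a) \<in> B"
          using that by (simp add: mult.assoc)
        then show ?thesis
          using Cons.prems(2) ideal_mult[OF assms(1,4), of s] by simp
      qed
      show "regular_chain rs {s. s * a \<in> ?B}"
        using Cons B seq_submodule_Cons[OF assms(1)] by (intro Cons.IH) auto
    qed
  }
qed

lemma module_depth_le:
  fixes A B :: "('v::finite, 'k::field) mpoly set"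
  assumes "is_ideal A" "is_ideal B" "B \<subseteq> A" "keyideal (large_support d) \<subseteq> annihilator A B"
  shows "module_depth A B \<le> enat d"
  unfolding module_depth_def
proof (rule Sup_least)
  fix x
  assume "x \<in> {enat (length rs) |rs. set rs \<subseteq> max_graded_ideal \<and> regular_sequence A B rs}"
  then obtain rs where rs: "x = enat (length rs)" "weakly_regular rs A B" "seq_submodule A B rs \<noteq> A"
    using regular_sequence_iff[OF assms(1)] by blast
  then obtain a where a: "a \<in> A" "a \<notin> seq_submodule A B rs"
    using seq_submodule_subset[OF assms(1,3), of rs] by blast
  have "annihilator A B \<subseteq> {r. r * a \<in> B}"
    using a(1) by (auto simp: annihilator_def)
  then show "x \<le> enat d"
    using regular_chain_length[OF regular_chain_of_weakly_regular[OF assms(1,2) rs(2) a], of d] assms(4) rs(1)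
    by simp
qed

text \<open>The monomials of large support bound dimension and depth from above by the same number;
  the prime bounds the dimension and the sequence the depth from below.\<close>

lemma cohen_macaulayI:
  fixes A B :: "('v::{finite, linorder}, 'k::field) mpoly set"
  assumes "is_ideal A" "is_ideal B" "B \<subseteq> A"
    and "weakly_regular rs A B" "set rs \<subseteq> max_graded_ideal" "seq_submodule A B rs \<noteq> A"
    and "keyideal (large_support (length rs)) \<subseteq> annihilator A B"
    and "annihilator A B \<subseteq> vars_prime D" "card (- D) = length rs"
  shows "cohen_macaulay A B" "module_dim A B = enat (length rs)"
proof -
  have "enat (length rs) \<le> module_depth A B"
    unfolding module_depth_def
    by (rule Sup_upper) (use assms regular_sequence_iff in blast)
  then have "module_depth A B = enat (length rs)"
    using module_depth_le[OF assms(1-3,7)] by simp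
  moreover show "module_dim A B = enat (length rs)"
    unfolding module_dim_def
    using krull_dim_mod_le[OF assms(7)] krull_dim_mod_ge[OF assms(8)] assms(9) by simp
  ultimately show "cohen_macaulay A B"
    by (simp add: cohen_macaulay_def)
qed


section \<open>Cohen-Macaulay quotients of squarefree monomial ideals\<close>

text \<open>Multiplication by \<open>u\<close> is an isomorphism from \<open>A / B\<close> to
  \<open>A' / B'\<close>: the last two assumptions say that it is onto, well defined and injective.
  Both persist when \<open>r\<close> times the modules is divided out, which carries the
  induction.\<close>

lemma weakly_regular_transfer:
  assumes "is_ideal A" "is_ideal B" "is_ideal B'" "weakly_regular rs A B"
    and "A' = u *o A + B'" "\<forall>a\<in>A. u * a \<in> B' \<longleftrightarrow> a \<in> B"
  shows "weakly_regular rs A' B'"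
  using assms(2-)
proof (induction rs arbitrary: B B')
  case (Cons r rs)
  note A = assms(1)
  have A': "is_ideal A'"
    unfolding Cons.prems(4) by (intro is_ideal_plus is_ideal_times A Cons.prems)
  have uA: "u * a \<in> A'" if "a \<in> A" for a
    unfolding Cons.prems(4) using ideal_plus_upper1[OF Cons.prems(2), of "u *o A"] that by auto
  have B'_le: "B' \<subseteq> A'"
    unfolding Cons.prems(4) by (intro ideal_plus_upper2 is_ideal_times A)
  have nonzero_divisor: "a' \<in> B'" if a': "a' \<in> A'" "r * a' \<in> B'" for a'
  proof -
    obtain a b where ab: "a \<in> A" "b \<in> B'" "a' = u * a + b"
      using a'(1) unfolding Cons.prems(4) set_plus_def elt_set_times_def by blast
    have "r * a' - r * b \<in> B'"
      by (rule ideal_diff[OF Cons.prems(2) a'(2) ideal_mult[OF Cons.prems(2) ab(2)]])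
    then have "u * (r * a) \<in> B'"
      by (simp add: ab algebra_simps)
    then have "a \<in> B"
      using Cons.prems(3,5) ideal_mult[OF A ab(1)] ab(1) by auto
    then have "u * a \<in> B'"
      using Cons.prems(5) ab(1) by blast
    then show ?thesis
      unfolding ab(3) using ideal_add[OF Cons.prems(2) _ ab(2)] by blast
  qed
  have "weakly_regular rs A' (B' + r *o A')"
  proof (rule Cons.IH)
    show B1: "is_ideal (B + r *o A)" "is_ideal (B' + r *o A')"
      by (intro is_ideal_plus is_ideal_times A A' Cons.prems)+
    show "weakly_regular rs A (B + r *o A)"
      using Cons.prems(3) by simp
    show "A' = u *o A + (B' + r *o A')"
    proof
      show "A' \<subseteq> u *o A + (B' + r *o A')"
        using ideal_plus_upper1[OF is_ideal_times[OF A'], of "u *o A + B'" r]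
        by (simp add: Cons.prems(4) add.assoc)
      have "r *o A' \<subseteq> A'"
        using ideal_mult[OF A'] by (auto simp: elt_set_times_def)
      then show "u *o A + (B' + r *o A') \<subseteq> A'"
        using uA B'_le A' by (intro ideal_plus_least) (auto simp: elt_set_times_def)
    qed
    show "\<forall>a\<in>A. u * a \<in> B' + r *o A' \<longleftrightarrow> a \<in> B + r *o A"
    proof (intro ballI iffI)
      fix a assume a: "a \<in> A" "u * a \<in> B' + r *o A'"
      then obtain b a' where "b \<in> B'" "a' \<in> A'" "u * a = b + r * a'"
        by (auto simp: set_plus_def elt_set_times_def)
      moreover obtain a1 b1 where "a1 \<in> A" "b1 \<in> B'" "a' = u * a1 + b1"
        using \<open>a' \<in> A'\<close> unfolding Cons.prems(4) set_plus_def elt_set_times_def by blast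
      ultimately have "u * (a - r * a1) = b + r * b1"
        by (simp add: algebra_simps)
      then have "u * (a - r * a1) \<in> B'"
        using \<open>b \<in> B'\<close> \<open>b1 \<in> B'\<close> ideal_add[OF Cons.prems(2)] ideal_mult[OF Cons.prems(2)] by auto
      moreover have "a - r * a1 \<in> A"
        using a(1) \<open>a1 \<in> A\<close> A ideal_diff ideal_mult by blast
      ultimately have "a - r * a1 \<in> B"
        using Cons.prems(5) by blast
      then show "a \<in> B + r *o A"
        using \<open>a1 \<in> A\<close> set_plus_intro[of "a - r * a1" B "r * a1" "r *o A"] by auto
    next
      fix a assume a: "a \<in> A" "a \<in> B + r *o A"
      then obtain b a1 where b: "b \<in> B" "a1 \<in> A" "a = b + r * a1"
        by (auto simp: set_plus_def elt_set_times_def)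
      then have "b = a - r * a1"
        by simp
      then have "b \<in> A"
        using a(1) b(2) A ideal_diff ideal_mult by blast
      then have "u * b \<in> B'"
        using b(1) Cons.prems(5) by blast
      then have "u * b + r * (u * a1) \<in> B' + r *o A'"
        using uA[OF b(2)] by auto
      then show "u * a \<in> B' + r *o A'"
        by (simp add: b(3) algebra_simps)
    qed
  qed
  then show ?case
    using nonzero_divisor by simp
qed simp

text \<open>This is the exact sequence of \<open>C / B\<close>, \<open>A / B\<close> and
  \<open>A / C\<close>. It stays exact modulo \<open>r\<close> because \<open>r\<close> is regular
  on \<open>A / C\<close>: if \<open>r * a1\<close> lies in \<open>C\<close>, so does
  \<open>a1\<close>, hence \<open>C / (B + r C)\<close> embeds in
  \<open>A / (B + r A)\<close>.\<close>

lemma weakly_regular_extension: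
  assumes "is_ideal A" "is_ideal B" "is_ideal C" "B \<subseteq> C" "C \<subseteq> A"
    and "weakly_regular rs C B" "weakly_regular rs A C"
  shows "weakly_regular rs A B"
  using assms(2-)
proof (induction rs arbitrary: B C)
  case (Cons r rs)
  note A = assms(1)
  have ideals: "is_ideal (B + r *o A)" "is_ideal (C + r *o A)" "is_ideal (B + r *o C)"
    by (intro is_ideal_plus is_ideal_times A Cons.prems)+
  have C_eq: "C + r *o A = 1 *o C + (B + r *o A)"
  proof -
    have "C + B = C"
      using ideal_plus_least[OF order_refl Cons.prems(3,2)] ideal_plus_upper1[OF Cons.prems(1), of C]
      by blast
    then show ?thesis
      by (simp flip: add.assoc)
  qed
  have "weakly_regular rs A (B + r *o A)"
  proof (rule Cons.IH[OF ideals(1,2)])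
    show "B + r *o A \<subseteq> C + r *o A"
      by (rule set_plus_mono2[OF Cons.prems(3) order_refl])
    show "C + r *o A \<subseteq> A"
      using Cons.prems(4) ideal_mult[OF A]
      by (intro ideal_plus_least A) (auto simp: elt_set_times_def)
    show "weakly_regular rs A (C + r *o A)"
      using Cons.prems(6) by simp
    show "weakly_regular rs (C + r *o A) (B + r *o A)"
    proof (rule weakly_regular_transfer[OF Cons.prems(2) ideals(3,1) _ C_eq])
      show "weakly_regular rs C (B + r *o C)"
        using Cons.prems(5) by simp
      show "\<forall>a\<in>C. 1 * a \<in> B + r *o A \<longleftrightarrow> a \<in> B + r *o C"
      proof (intro ballI iffI)
        fix a assume a: "a \<in> C" "1 * a \<in> B + r *o A"
        then obtain b a1 where b: "b \<in> B" "a1 \<in> A" "a = b + r * a1"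
          by (auto simp: set_plus_def elt_set_times_def)
        then have "r * a1 = a - b"
          by simp
        then have "r * a1 \<in> C"
          using ideal_diff[OF Cons.prems(2) a(1), of b] b(1) Cons.prems(3) by auto
        then have "a1 \<in> C"
          using Cons.prems(6) b(2) by simp
        then show "a \<in> B + r *o C"
          using b by auto
      next
        fix a assume "a \<in> B + r *o C"
        then show "1 * a \<in> B + r *o A"
          using Cons.prems(4) by (auto simp: set_plus_def elt_set_times_def)
      qed
    qed
  qed
  then show ?case
    using Cons.prems by auto
qed simp

section \<open>Squarefree monomial ideals as families of sets, and clean filtrations\<close>

definition down_closed :: "'v set set \<Rightarrow> bool"
  where "down_closed \<D> \<longleftrightarrow> (\<forall>S\<in>\<D>. \<forall>T\<subseteq>S. T \<in> \<D>)"

text \<open>Membership of a monomial depends only on the set of variables that it omits.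
  Multiplication shrinks this set, hence \<open>down_closed\<close>; for such \<open>\<D>\<close>, a
  set \<open>D\<close> is outside \<open>\<D>\<close> iff \<open>vars_prime D\<close> contains the
  ideal.\<close>

definition zideal :: "'v set set \<Rightarrow> ('v, 'k::field) mpoly set"
  where "zideal \<D> = keyideal {k. zero_set k \<in> \<D>}"

lemma down_closed_imp_up_closed: "down_closed \<D> \<Longrightarrow> up_closed {k. zero_set k \<in> \<D>}"
  by (auto simp: down_closed_def up_closed_def zero_set_add)

lemma is_ideal_zideal: "down_closed \<D> \<Longrightarrow> is_ideal (zideal \<D>)"
  unfolding zideal_def by (intro is_ideal_keyideal down_closed_imp_up_closed)

lemma graded_ideal_zideal: "down_closed \<D> \<Longrightarrow> graded_ideal (zideal \<D>)"
  unfolding zideal_def by (intro graded_ideal_keyideal down_closed_imp_up_closed)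

lemma mon_in_zideal_iff: "mon k \<in> (zideal \<D> :: ('v, 'k::field) mpoly set) \<longleftrightarrow> zero_set k \<in> \<D>"
  by (simp add: zideal_def mon_in_keyideal_iff)

lemma zideal_mono: "\<D> \<subseteq> \<D>' \<Longrightarrow> zideal \<D> \<subseteq> zideal \<D>'"
  by (auto simp: zideal_def keyideal_def)

lemma zideal_UNIV: "zideal UNIV = UNIV"
  by (simp add: zideal_def keyideal_def)

lemma zideal_subset_iff:
  "zideal \<D> \<subseteq> (zideal \<D>' :: ('v::finite, 'k::field) mpoly set) \<longleftrightarrow> \<D> \<subseteq> \<D>'"
proof
  assume sub: "zideal \<D> \<subseteq> (zideal \<D>' :: ('v, 'k) mpoly set)"
  show "\<D> \<subseteq> \<D>'"
  proof
    fix D assume "D \<in> \<D>"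
    then have "mon (ind (- D)) \<in> (zideal \<D> :: ('v, 'k) mpoly set)"
      by (simp add: mon_in_zideal_iff zero_set_ind)
    then have "mon (ind (- D)) \<in> (zideal \<D>' :: ('v, 'k) mpoly set)"
      using sub by blast
    then show "D \<in> \<D>'"
      by (simp add: mon_in_zideal_iff zero_set_ind)
  qed
qed (rule zideal_mono)

lemma vars_prime_eq_zideal: "vars_prime D = zideal {Z. \<not> D \<subseteq> Z}"
  by (simp add: vars_prime_def zideal_def)

text \<open>A combinatorial form of a clean filtration: each interval contributes a factor that is
  isomorphic to a polynomial ring in \<open>d\<close> variables.\<close>

inductive clean :: "nat \<Rightarrow> 'v::finite set set \<Rightarrow> bool" for d where
  empty: "clean d {}"
| interval: "card (- D) = d \<Longrightarrow> D \<subseteq> D' \<Longrightarrow> clean d {E. D \<subseteq> E \<and> E \<subseteq> D'}"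
| union: "clean d \<S> \<Longrightarrow> clean d \<T> \<Longrightarrow> (\<And>S T. S \<in> \<S> \<Longrightarrow> T \<in> \<T> \<Longrightarrow> \<not> T \<subseteq> S) \<Longrightarrow> clean d (\<S> \<union> \<T>)"

lemma card_add_card_Compl: "card D + card (- D) = CARD('v)" for D :: "'v::finite set"
  using card_Un_disjoint[of D "- D"] by simp

lemma clean_interval:
  fixes D :: "'v::finite set"
  assumes "card D + d = CARD('v)" "D \<subseteq> D'"
  shows "clean d {E. D \<subseteq> E \<and> E \<subseteq> D'}"
proof (rule clean.interval)
  show "card (- D) = d"
    using assms(1) card_add_card_Compl[of D] by simp
qed (rule assms)

text \<open>The elements of \<open>V\<close> are decided one at a time, sets without
  \<open>w\<close> coming before sets with it, until \<open>D \<inter> V\<close> is fixed. What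
  remains has a lower bound \<open>A'\<close> larger by \<open>p\<close> elements and an upper bound
  \<open>X'\<close>; the last assumption handles it.\<close>

lemma clean_exact:
  fixes V :: "'v::finite set"
  assumes "V \<inter> A = {}" "V \<subseteq> X" "A \<subseteq> X"
    and "\<And>A' X'. A \<subseteq> A' \<Longrightarrow> A' \<subseteq> A \<union> V \<Longrightarrow> A' \<subseteq> X' \<Longrightarrow> X - V \<subseteq> X' \<Longrightarrow> card A' = card A + p \<Longrightarrow>
      clean d {D. A' \<subseteq> D \<and> D \<subseteq> X' \<and> R D}"
  shows "clean d {D. A \<subseteq> D \<and> D \<subseteq> X \<and> card (D \<inter> V) = p \<and> R D}"
  using finite[of V] assms
proof (induction V arbitrary: A X p rule: finite_induct)
  case empty
  then show ?case
    by (cases p) (auto intro: clean.empty)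
next
  case (insert w V)
  have wV: "w \<notin> A" "w \<in> X" "V \<inter> A = {}" "V \<subseteq> X"
    using insert.prems by auto
  define \<S> where "\<S> = {D. A \<subseteq> D \<and> D \<subseteq> X - {w} \<and> card (D \<inter> V) = p \<and> R D}"
  define \<T> where "\<T> = {D. insert w A \<subseteq> D \<and> D \<subseteq> X \<and> Suc (card (D \<inter> V)) = p \<and> R D}"
  have card_insert: "card (D \<inter> insert w V) = (if w \<in> D then Suc (card (D \<inter> V)) else card (D \<inter> V))" for D
    using insert.hyps(2) by (simp add: Int_insert_right)
  have "clean d \<S>"
    unfolding \<S>_def
  proof (rule insert.IH)
    show "clean d {D. A' \<subseteq> D \<and> D \<subseteq> X' \<and> R D}"
      if "A \<subseteq> A'" "A' \<subseteq> A \<union> V" "A' \<subseteq> X'" "X - {w} - V \<subseteq> X'" "card A' = card A + p" for A' X'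
      using that insert.prems(4)[of A' X'] by auto
  qed (use wV insert.prems(3) insert.hyps(2) in auto)
  moreover have "clean d \<T>"
  proof (cases p)
    case (Suc p')
    have "clean d {D. insert w A \<subseteq> D \<and> D \<subseteq> X \<and> card (D \<inter> V) = p' \<and> R D}"
    proof (rule insert.IH)
      show "clean d {D. A' \<subseteq> D \<and> D \<subseteq> X' \<and> R D}"
        if "insert w A \<subseteq> A'" "A' \<subseteq> insert w A \<union> V" "A' \<subseteq> X'" "X - V \<subseteq> X'"
          "card A' = card (insert w A) + p'" for A' X'
        using that insert.prems(4)[of A' X'] Suc wV by auto
    qed (use wV insert.prems(3) insert.hyps(2) in auto)
    then show ?thesis
      by (simp add: \<T>_def Suc)
  qed (simp add: \<T>_def clean.empty)
  moreover have "\<not> T \<subseteq> S" if "S \<in> \<S>" "T \<in> \<T>" for S T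
    using that by (auto simp: \<S>_def \<T>_def)
  ultimately have "clean d (\<S> \<union> \<T>)"
    by (rule clean.union)
  also have "\<S> \<union> \<T> = {D. A \<subseteq> D \<and> D \<subseteq> X \<and> card (D \<inter> insert w V) = p \<and> R D}"
    by (auto simp: \<S>_def \<T>_def card_insert split: if_splits)
  finally show ?case .
qed

text \<open>Either \<open>w\<close> is in \<open>D\<close> together with exactly
  \<open>q - 1\<close> elements of \<open>W\<close>, or \<open>D\<close> has at least
  \<open>q\<close> elements of \<open>W\<close>. A set of the second kind is never contained in one
  of the first, and the lower ends of all intervals have \<open>card A + q\<close> elements, which
  fixes \<open>d\<close>.\<close>

lemma clean_at_least:
  fixes W :: "'v::finite set"
  assumes "W \<inter> A = {}" "W \<subseteq> X" "A \<subseteq> X" "card A + q + d = CARD('v)"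
  shows "clean d {D. A \<subseteq> D \<and> D \<subseteq> X \<and> q \<le> card (D \<inter> W)}"
  using finite[of W] assms
proof (induction W arbitrary: q rule: finite_induct)
  case empty
  then show ?case
    by (cases q) (auto intro: clean.empty clean_interval)
next
  case (insert w W)
  show ?case
  proof (cases q)
    case 0
    then show ?thesis
      using insert.prems by (auto intro: clean_interval)
  next
    case (Suc q')
    define \<S> where "\<S> = {D. insert w A \<subseteq> D \<and> D \<subseteq> X \<and> card (D \<inter> W) = q' \<and> True}"
    define \<T> where "\<T> = {D. A \<subseteq> D \<and> D \<subseteq> X \<and> q \<le> card (D \<inter> W)}"
    have card_insert: "card (D \<inter> insert w W) = (if w \<in> D then Suc (card (D \<inter> W)) else card (D \<inter> W))" for D
      using insert.hyps(2) by (simp add: Int_insert_right)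
    have w: "w \<notin> A" "w \<in> X"
      using insert.prems by auto
    have "clean d \<S>"
      unfolding \<S>_def
    proof (rule clean_exact)
      show "clean d {D. A' \<subseteq> D \<and> D \<subseteq> X' \<and> True}"
        if "A' \<subseteq> X'" "card A' = card (insert w A) + q'" for A' X' :: "'v set"
        using that clean_interval[of A' d X'] Suc insert.prems(4) w by simp
    qed (use insert w in auto)
    moreover have "clean d \<T>"
      unfolding \<T>_def using insert by (intro insert.IH) auto
    moreover have "\<not> T \<subseteq> S" if "S \<in> \<S>" "T \<in> \<T>" for S T
    proof
      assume "T \<subseteq> S"
      then have "card (T \<inter> W) \<le> card (S \<inter> W)"
        by (intro card_mono) auto
      then show False
        using that Suc by (simp add: \<S>_def \<T>_def)
    qed
    ultimately have "clean d (\<S> \<union> \<T>)"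
      by (rule clean.union)
    also have "\<S> \<union> \<T> = {D. A \<subseteq> D \<and> D \<subseteq> X \<and> q \<le> card (D \<inter> insert w W)}"
      using Suc by (auto simp: \<S>_def \<T>_def card_insert split: if_splits)
    finally show ?thesis .
  qed
qed

lemma clean_card:
  assumes "clean d \<S>"
  shows "D \<in> \<S> \<Longrightarrow> card (- D) \<le> d" "\<S> \<noteq> {} \<Longrightarrow> \<exists>D\<in>\<S>. card (- D) = d"
proof -
  have "(\<forall>D\<in>\<S>. card (- D) \<le> d) \<and> (\<S> \<noteq> {} \<longrightarrow> (\<exists>D\<in>\<S>. card (- D) = d))"
    using assms
  proof induction
    case (interval D D')
    have "card (- E) \<le> d" if "D \<subseteq> E" for E
      using that interval(1) card_mono[of "- D" "- E"] by auto
    then show ?case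
      using interval by auto
  qed auto
  then show "D \<in> \<S> \<Longrightarrow> card (- D) \<le> d" "\<S> \<noteq> {} \<Longrightarrow> \<exists>D\<in>\<S>. card (- D) = d"
    by auto
qed

text \<open>The elementary symmetric polynomial. It does not depend on \<open>D\<close>, so one
  sequence serves all rings modulo \<open>vars_prime D\<close> with \<open>card (- D) = d\<close>,
  as \<open>weakly_regular_clean\<close> requires.\<close>

definition esym :: "nat \<Rightarrow> ('v::finite, 'k::field) mpoly"
  where "esym d = (\<Sum>S | card S = d. mon (ind S))"

fun esyms :: "nat \<Rightarrow> ('v::finite, 'k::field) mpoly list" where
  "esyms 0 = []"
| "esyms (Suc d) = esym (Suc d) # esyms d"

lemma length_esyms: "length (esyms d) = d"
  by (induction d) auto

text \<open>The monomials with zero set in the interval are the product of the variables outside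
  \<open>D'\<close> times a monomial in the variables outside \<open>D\<close>. Multiplication by
  that product is therefore an isomorphism from the ring modulo \<open>vars_prime D\<close>.\<close>

lemma weakly_regular_interval:
  assumes "weakly_regular rs UNIV (vars_prime D :: ('v::finite, 'k::field) mpoly set)" "D \<subseteq> D'"
    and "down_closed \<D>" "down_closed (\<D> \<union> {E. D \<subseteq> E \<and> E \<subseteq> D'})" "\<D> \<inter> {E. D \<subseteq> E \<and> E \<subseteq> D'} = {}"
  shows "weakly_regular rs (zideal (\<D> \<union> {E. D \<subseteq> E \<and> E \<subseteq> D'})) (zideal \<D>)"
proof (rule weakly_regular_transfer[OF is_ideal_UNIV is_ideal_vars_prime _ assms(1)])
  let ?u = "mon (ind (- D')) :: ('v, 'k) mpoly"
  let ?A = "zideal (\<D> \<union> {E. D \<subseteq> E \<and> E \<subseteq> D'}) :: ('v, 'k) mpoly set"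
  have below: "D' \<inter> Z \<in> \<D> \<union> {E. D \<subseteq> E \<and> E \<subseteq> D'}" for Z
    using assms(4)[unfolded down_closed_def, rule_format, of D' "D' \<inter> Z"] assms(2) by simp
  show B: "is_ideal (zideal \<D> :: ('v, 'k) mpoly set)"
    by (rule is_ideal_zideal[OF assms(3)])
  show "?A = ?u *o UNIV + zideal \<D>"
  proof
    show "?A \<subseteq> ?u *o UNIV + zideal \<D>"
      unfolding zideal_def[of "_ \<union> _"]
    proof (rule keyideal_subset_of_mon)
      show "is_ideal (?u *o UNIV + zideal \<D>)"
        by (intro is_ideal_plus is_ideal_times is_ideal_UNIV B)
      fix k assume "k \<in> {k. zero_set k \<in> \<D> \<union> {E. D \<subseteq> E \<and> E \<subseteq> D'}}"
      then consider "zero_set k \<in> \<D>" | "zero_set k \<subseteq> D'"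
        by auto
      then show "mon k \<in> ?u *o UNIV + zideal \<D>"
      proof cases
        case 1
        then show ?thesis
          using ideal_plus_upper2[OF is_ideal_times[OF is_ideal_UNIV], of "zideal \<D>" ?u]
          by (auto simp: mon_in_zideal_iff)
      next
        case 2
        then have "divides (ind (- D')) k"
          by (simp add: ind_divides_iff)
        then have "mon k \<in> ?u *o UNIV"
          by (auto simp: divides_iff_add simp flip: mon_mult)
        then show ?thesis
          using ideal_plus_upper1[OF B, of "?u *o UNIV"] by auto
      qed
    qed
    show "?u *o UNIV + zideal \<D> \<subseteq> ?A"
    proof (rule ideal_plus_least)
      show "?u *o UNIV \<subseteq> ?A"
      proof
        fix f assume "f \<in> ?u *o UNIV"
        then obtain g where f: "f = ?u * g"
          by (auto simp: elt_set_times_def)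
        have "zero_set k \<in> \<D> \<union> {E. D \<subseteq> E \<and> E \<subseteq> D'}" if k: "k \<in> keys f" for k
        proof -
          obtain l where "k = ind (- D') + l"
            using k by (auto simp: f keys_mon_mult)
          then have "zero_set k = D' \<inter> zero_set l"
            by (simp add: zero_set_add zero_set_ind)
          then show ?thesis
            using below by metis
        qed
        then show "f \<in> ?A"
          unfolding zideal_def keyideal_def by blast
      qed
    qed (simp_all only: is_ideal_zideal[OF assms(4)] zideal_mono[OF Un_upper1])
  qed
  have inter_iff: "D' \<inter> Z \<in> \<D> \<longleftrightarrow> \<not> D \<subseteq> Z" for Z
    using below[of Z] assms(2,5) by auto
  show "\<forall>f\<in>UNIV. ?u * f \<in> zideal \<D> \<longleftrightarrow> f \<in> vars_prime D"
    unfolding zideal_def vars_prime_def keyideal_def keys_mon_mult mem_Collect_eq image_subset_iff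
    by (auto simp: zero_set_add zero_set_ind inter_iff)
qed

lemma weakly_regular_clean:
  assumes "\<And>D. card (- D) = d \<Longrightarrow> weakly_regular rs UNIV (vars_prime D :: ('v::finite, 'k::field) mpoly set)"
    and "clean d \<S>" "down_closed \<D>" "down_closed (\<D> \<union> \<S>)" "\<D> \<inter> \<S> = {}"
  shows "weakly_regular rs (zideal (\<D> \<union> \<S>)) (zideal \<D> :: ('v, 'k) mpoly set)"
  using assms(2-)
proof (induction arbitrary: \<D> rule: clean.induct)
  case empty
  have self: "weakly_regular rs A A" if "is_ideal A" for A :: "('v, 'k) mpoly set"
  proof (induction rs)
    case (Cons r rs)
    have "r *o A \<subseteq> A"
      using ideal_mult[OF that] by (auto simp: elt_set_times_def)
    then have "A + r *o A = A"
      using ideal_plus_least[of A A "r *o A"] ideal_plus_upper1[OF is_ideal_times[OF that], of A r] that by blast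
    then show ?case
      using Cons by simp
  qed simp
  then show ?case
    using self[OF is_ideal_zideal[OF empty.prems(1)]] by simp
next
  case (interval D D')
  then show ?case
    using assms(1) by (intro weakly_regular_interval)
next
  case (union \<S> \<T>)
  \<comment> \<open>The order condition of \<open>clean.union\<close> serves here: a subset of a
    member of \<open>\<S>\<close> cannot lie in \<open>\<T>\<close>.\<close>
  have down: "down_closed (\<D> \<union> \<S>)"
    unfolding down_closed_def
  proof (intro ballI allI impI)
    fix S T assume ST: "S \<in> \<D> \<union> \<S>" "T \<subseteq> S"
    then have "T \<in> \<D> \<union> \<S> \<union> \<T>"
      using union.prems(2) unfolding down_closed_def by blast
    moreover have "T \<notin> \<T>" if "S \<in> \<S>"
      using union.hyps(3) that ST(2) by blast
    moreover have "T \<in> \<D>" if "S \<in> \<D>"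
      using union.prems(1) that ST(2) unfolding down_closed_def by blast
    ultimately show "T \<in> \<D> \<union> \<S>"
      using ST(1) by blast
  qed
  have down': "down_closed (\<D> \<union> \<S> \<union> \<T>)"
    using union.prems(2) by (simp add: Un_assoc)
  have disj: "\<S> \<inter> \<T> = {}"
    using union.hyps(3) by blast
  have "weakly_regular rs (zideal (\<D> \<union> \<S>)) (zideal \<D> :: ('v, 'k) mpoly set)"
    using union.prems down by (intro union.IH) auto
  moreover have "weakly_regular rs (zideal (\<D> \<union> \<S> \<union> \<T>)) (zideal (\<D> \<union> \<S>) :: ('v, 'k) mpoly set)"
    using union.prems disj down by (intro union.IH) (auto simp: Un_assoc)
  ultimately have "weakly_regular rs (zideal (\<D> \<union> \<S> \<union> \<T>)) (zideal \<D> :: ('v, 'k) mpoly set)"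
    by (rule weakly_regular_extension[OF is_ideal_zideal[OF down'] is_ideal_zideal[OF union.prems(1)]
          is_ideal_zideal[OF down] zideal_mono[OF Un_upper1] zideal_mono[OF Un_upper1]])
  then show ?case
    by (simp add: Un_assoc)
qed

text \<open>Modulo the variables in \<open>D\<close>, the highest elementary symmetric polynomial is the product of the
  remaining variables; the quotient by it is again clean, in one dimension less.\<close>

lemma weakly_regular_vars_prime:
  assumes "card (- D) = d"
  shows "weakly_regular (esyms d) UNIV (vars_prime D :: ('v::{finite, linorder}, 'k::field) mpoly set)"
  using assms
proof (induction d arbitrary: D)
  case (Suc d)
  let ?P = "vars_prime D :: ('v, 'k) mpoly set"
  let ?e = "esym (Suc d) :: ('v, 'k) mpoly"
  let ?x = "mon (ind (- D)) :: ('v, 'k) mpoly"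
  \<comment> \<open>Every term of the symmetric polynomial except \<open>?x\<close> involves a
    variable of \<open>D\<close>.\<close>
  have "?e - ?x = (\<Sum>S\<in>{S. card S = Suc d} - {- D}. mon (ind S))"
    using Suc.prems by (simp add: esym_def sum_diff1)
  also have "\<dots> \<in> ?P"
  proof (intro ideal_sum is_ideal_vars_prime)
    fix S assume "S \<in> {S. card S = Suc d} - {- D}"
    then have "\<not> S \<subseteq> - D"
      using card_subset_eq[of "- D" S] Suc.prems by auto
    then show "mon (ind S) \<in> ?P"
      by (auto simp: mon_in_vars_prime_iff zero_set_ind)
  qed
  finally have e: "?e - ?x \<in> ?P" .
  have "?x \<notin> ?P"
    by (simp add: mon_in_vars_prime_iff zero_set_ind)
  then have "?e \<notin> ?P"
    using ideal_diff[OF is_ideal_vars_prime _ e, of ?e] by auto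
  then have nonzero_divisor: "\<forall>a\<in>UNIV. ?e * a \<in> ?P \<longrightarrow> a \<in> ?P"
    using is_prime_ideal_vars_prime[of D] unfolding is_prime_ideal_def by blast
  \<comment> \<open>This family encodes the ideal generated by \<open>vars_prime D\<close> and
    \<open>?x\<close>; the sets outside it are \<open>D\<close> with at least one further
    element.\<close>
  let ?D = "{Z. \<not> D \<subset> Z}"
  have down: "down_closed ?D"
    by (auto simp: down_closed_def)
  have "card D + 1 + d = CARD('v)"
    using Suc.prems card_add_card_Compl[of D] by simp
  then have "clean d {Z. D \<subseteq> Z \<and> Z \<subseteq> UNIV \<and> 1 \<le> card (Z \<inter> - D)}"
    by (intro clean_at_least) auto
  also have "{Z. D \<subseteq> Z \<and> Z \<subseteq> UNIV \<and> 1 \<le> card (Z \<inter> - D)} = {Z. D \<subset> Z}"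
    by (auto simp: Suc_le_eq card_gt_0_iff)
  finally have "weakly_regular (esyms d) (zideal (?D \<union> {Z. D \<subset> Z})) (zideal ?D :: ('v, 'k) mpoly set)"
    using Suc.IH down by (intro weakly_regular_clean) (auto simp: down_closed_def)
  also have "?D \<union> {Z. D \<subset> Z} = UNIV"
    by auto
  also have "zideal ?D = ?P + ?e *o UNIV"
  proof
    have ideal: "is_ideal (?P + ?e *o UNIV)"
      by (intro is_ideal_plus is_ideal_times is_ideal_UNIV is_ideal_vars_prime)
    have P_le: "?P \<subseteq> ?P + ?e *o UNIV"
      by (intro ideal_plus_upper1 is_ideal_times is_ideal_UNIV)
    have "?e * 1 \<in> ?e *o UNIV"
      by blast
    then have "?e \<in> ?P + ?e *o UNIV"
      using ideal_plus_upper2[OF is_ideal_vars_prime, of "?e *o UNIV" D] by auto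
    then have x: "?x \<in> ?P + ?e *o UNIV"
      using ideal_diff[OF ideal, of ?e "?e - ?x"] e P_le by auto
    show "zideal ?D \<subseteq> ?P + ?e *o UNIV"
      unfolding zideal_def
    proof (rule keyideal_subset_of_mon[OF ideal])
      fix k assume "k \<in> {k. zero_set k \<in> ?D}"
      then consider "\<not> D \<subseteq> zero_set k" | "zero_set k = D"
        by auto
      then show "mon k \<in> ?P + ?e *o UNIV"
      proof cases
        case 1
        then have "mon k \<in> ?P"
          by (simp add: mon_in_vars_prime_iff)
        then show ?thesis
          using P_le by blast
      next
        case 2
        then have "divides (ind (- D)) k"
          by (simp add: ind_divides_iff)
        then show ?thesis
          using ideal_mult_right[OF ideal x] by (auto simp: divides_iff_add simp flip: mon_mult)
      qed
    qed
    have P_D: "?P \<subseteq> zideal ?D"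
      by (auto simp: vars_prime_eq_zideal intro!: zideal_mono)
    have "?x \<in> zideal ?D"
      by (simp add: mon_in_zideal_iff zero_set_ind)
    then have "?e \<in> zideal ?D"
      using ideal_add[OF is_ideal_zideal[OF down], of "?e - ?x" ?x] e P_D by auto
    then show "?P + ?e *o UNIV \<subseteq> zideal ?D"
      using P_D is_ideal_zideal[OF down] ideal_mult_right[OF is_ideal_zideal[OF down]]
      by (intro ideal_plus_least) (auto simp: elt_set_times_def)
  qed
  finally show ?case
    using nonzero_divisor by (simp add: zideal_UNIV)
qed simp

lemma max_graded_ideal_eq: "max_graded_ideal = (keyideal {k. k \<noteq> 0} :: ('v::finite, 'k::field) mpoly set)"
proof -
  have "(range Var :: ('v, 'k) mpoly set) = mon ` (range (\<lambda>i. ind {i}))"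
    by (auto simp: Var_eq_ind)
  moreover have "up (range (\<lambda>i :: 'v. ind {i})) = {k. k \<noteq> 0}"
    by (auto simp: up_def ind_divides_iff zero_set_def poly_mapping_eq_iff fun_eq_iff)
  ultimately show ?thesis
    by (simp add: max_graded_ideal_def ideal_gen_mon)
qed

lemma set_esyms: "set (esyms d) \<subseteq> max_graded_ideal"
proof (induction d)
  case (Suc d)
  have "is_ideal (max_graded_ideal :: ('a, 'b) mpoly set)"
    unfolding max_graded_ideal_def by (rule is_ideal_ideal_gen)
  then have "(esym (Suc d) :: ('a, 'b) mpoly) \<in> max_graded_ideal"
    unfolding esym_def
  proof (rule ideal_sum)
    fix S :: "'a set" assume "S \<in> {S. card S = Suc d}"
    then have "ind S \<noteq> ind {}"
      by (auto simp: ind_inject)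
    moreover have "ind ({} :: 'a set) = 0"
      by (intro poly_mapping_eqI) (simp add: lookup_ind)
    ultimately show "mon (ind S) \<in> (max_graded_ideal :: ('a, 'b) mpoly set)"
      by (simp add: max_graded_ideal_eq mon_in_keyideal_iff)
  qed
  then show ?case
    using Suc by simp
qed simp

lemma cohen_macaulay_zideal:
  assumes "clean d \<S>" "down_closed \<D>" "down_closed (\<D> \<union> \<S>)" "\<D> \<inter> \<S> = {}" "\<S> \<noteq> {}"
  shows "cohen_macaulay (zideal (\<D> \<union> \<S>)) (zideal \<D> :: ('v::{finite, linorder}, 'k::field) mpoly set)"
    "module_dim (zideal (\<D> \<union> \<S>)) (zideal \<D> :: ('v, 'k) mpoly set) = enat d"
proof -
  let ?A = "zideal (\<D> \<union> \<S>) :: ('v, 'k) mpoly set" and ?B = "zideal \<D> :: ('v, 'k) mpoly set"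
  have ideals: "is_ideal ?A" "is_ideal ?B" "?B \<subseteq> ?A"
    using assms by (simp_all add: is_ideal_zideal zideal_mono)
  have wr: "weakly_regular (esyms d) ?A ?B"
    by (rule weakly_regular_clean[OF weakly_regular_vars_prime assms(1-4)])
  \<comment> \<open>A graded Nakayama argument: for \<open>D\<close> maximal in \<open>\<S>\<close>
    the monomial of \<open>- D\<close> is a minimal generator of \<open>?A\<close> outside
    \<open>?B\<close>. The other monomials of \<open>?A\<close> span an ideal that contains
    \<open>?B\<close> and all products of \<open>?A\<close> with the maximal ideal.\<close>
  have proper: "seq_submodule ?A ?B (esyms d) \<noteq> ?A"
  proof -
    obtain D where D: "D \<in> \<S>" "\<And>E. E \<in> \<S> \<Longrightarrow> D \<subseteq> E \<Longrightarrow> E = D"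
      using finite_has_maximal[OF finite assms(5)] by metis
    define N where "N = {k. zero_set k \<in> \<D> \<union> \<S> \<and> k \<noteq> ind (- D)}"
    have N: "k + l \<in> N" if "zero_set k \<in> \<D> \<union> \<S>" "k \<noteq> ind (- D) \<or> l \<noteq> 0" for k l
    proof -
      have "zero_set (k + l) \<in> \<D> \<union> \<S>"
        using assms(3) that(1) unfolding down_closed_def by (metis zero_set_add Int_lower1)
      moreover have False if eq: "k + l = ind (- D)"
      proof -
        have "D \<subseteq> zero_set k"
          using arg_cong[OF eq, of zero_set] by (auto simp: zero_set_add zero_set_ind)
        then have "zero_set k \<notin> \<D>"
          using assms(2,4) D(1) unfolding down_closed_def by blast
        then have "zero_set k = D"
          using D(2)[of "zero_set k"] \<open>D \<subseteq> zero_set k\<close> \<open>zero_set k \<in> \<D> \<union> \<S>\<close> by blast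
        then have "divides (ind (- D)) k"
          by (simp add: ind_divides_iff)
        moreover have "divides k (ind (- D))"
          unfolding eq[symmetric] by (rule divides_add)
        ultimately have "k = ind (- D)"
          by (rule divides_antisym[symmetric])
        then show False
          using eq \<open>k \<noteq> ind (- D) \<or> l \<noteq> 0\<close> by (metis add_cancel_right_right)
      qed
      ultimately show ?thesis
        by (auto simp: N_def)
    qed
    have "is_ideal (keyideal N :: ('v, 'k) mpoly set)"
      by (intro is_ideal_keyideal) (use N in \<open>auto simp: up_closed_def N_def\<close>)
    moreover have "?B \<subseteq> keyideal N"
      unfolding zideal_def using assms(4) D(1) by (intro keyideal_mono) (auto simp: N_def zero_set_ind)
    moreover have "r * a \<in> keyideal N" if r: "r \<in> set (esyms d)" and a: "a \<in> ?A" for r a :: "('v, 'k) mpoly"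
    proof -
      have "r \<in> keyideal {k. k \<noteq> 0}"
        using r set_esyms unfolding max_graded_ideal_eq by blast
      then have "k \<in> N" if "k \<in> keys (r * a)" for k
        using that keys_mult[of r a] a N by (fastforce simp: keyideal_def zideal_def add.commute)
      then show ?thesis
        by (auto simp: keyideal_def)
    qed
    ultimately have "seq_submodule ?A ?B (esyms d) \<subseteq> keyideal N"
      unfolding seq_submodule_def by (intro ideal_plus_least ideal_gen_minimal) auto
    moreover have "mon (ind (- D)) \<in> ?A" "mon (ind (- D)) \<notin> (keyideal N :: ('v, 'k) mpoly set)"
      using D(1) by (simp_all add: mon_in_zideal_iff mon_in_keyideal_iff zero_set_ind N_def)
    ultimately show ?thesis
      by blast
  qed
  \<comment> \<open>Multiplication by a monomial with more than \<open>d\<close> variables leaves a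
    zero set too small for \<open>\<S>\<close>, so the product falls into \<open>?B\<close>.\<close>
  have large: "keyideal (large_support (length (esyms d :: ('v, 'k) mpoly list))) \<subseteq> annihilator ?A ?B"
    unfolding length_esyms
  proof
    fix r :: "('v, 'k) mpoly" assume r: "r \<in> keyideal (large_support d)"
    have "zero_set k \<in> \<D>" if a: "a \<in> ?A" and k: "k \<in> keys (r * a)" for a k
    proof -
      obtain i j where ij: "k = i + j" "i \<in> keys r" "j \<in> keys a"
        using k keys_mult[of r a] by blast
      have "zero_set j \<in> \<D> \<union> \<S>"
        using ij(3) a by (auto simp: zideal_def keyideal_def)
      then have "zero_set k \<in> \<D> \<union> \<S>"
        using assms(3) unfolding down_closed_def ij(1) zero_set_add by (metis Int_lower2)
      moreover have "d < card (- zero_set i)"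
        using r ij(2) by (auto simp: keyideal_def large_support_def)
      then have "d < card (- zero_set k)"
        using card_mono[of "- zero_set k" "- zero_set i"] by (simp add: ij(1) zero_set_add)
      then have "zero_set k \<notin> \<S>"
        using clean_card(1)[OF assms(1)] by force
      ultimately show ?thesis
        by blast
    qed
    then show "r \<in> annihilator ?A ?B"
      by (auto simp: annihilator_def zideal_def keyideal_def)
  qed
  obtain D where D: "D \<in> \<S>" "card (- D) = d"
    using clean_card(2)[OF assms(1,5)] by blast
  have small: "annihilator ?A ?B \<subseteq> vars_prime D"
  proof
    fix r assume r: "r \<in> annihilator ?A ?B"
    have "mon (ind (- D)) \<in> ?A"
      using D(1) by (simp add: mon_in_zideal_iff zero_set_ind)
    then have "r * mon (ind (- D)) \<in> ?B"
      using r by (simp add: annihilator_def)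
    then have "mon (ind (- D)) * r \<in> ?B"
      by (simp only: mult.commute)
    then have "D \<inter> zero_set k \<in> \<D>" if "k \<in> keys r" for k
      using that by (auto simp: zideal_def keyideal_def keys_mon_mult zero_set_add zero_set_ind)
    moreover have "D \<notin> \<D>"
      using D(1) assms(4) by blast
    ultimately have "\<not> D \<subseteq> zero_set k" if "k \<in> keys r" for k
      using that by (metis Int_absorb2)
    then show "r \<in> vars_prime D"
      by (auto simp: vars_prime_def keyideal_def)
  qed
  show "cohen_macaulay ?A ?B" "module_dim ?A ?B = enat d"
    using cohen_macaulayI[OF ideals wr set_esyms proper large small] D(2) by (simp_all add: length_esyms)
qed


section \<open>Koszul complexes\<close>

text \<open>The cochain module of the Koszul complex of \<open>xs\<close> is free on the subsets of \<open>xs\<close>, encoded as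
  bit vectors. Splitting off the head makes the complex the mapping cone of multiplication by
  \<open>x\<close>, so that no explicit signs are needed.\<close>

fun koszul_d :: "'a::comm_ring_1 list \<Rightarrow> (bool list \<Rightarrow> 'a) \<Rightarrow> bool list \<Rightarrow> 'a" where
  "koszul_d (x # xs) z (False # l) = koszul_d xs (\<lambda>l. z (False # l)) l"
| "koszul_d (x # xs) z (True # l) = x * z (False # l) - koszul_d xs (\<lambda>l. z (True # l)) l"
| "koszul_d _ _ _ = 0"

definition cells :: "'a list \<Rightarrow> nat \<Rightarrow> bool list set"
  where "cells xs i = {l. length l = length xs \<and> count_list l True = i}"

text \<open>Cochains with values in the ring modulo \<open>B\<close> are represented by lifts to the
  ring. Only values on cells of the relevant size count, so functions on all bit lists serve in
  every degree.\<close>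

definition koszul_vanishes :: "'a::comm_ring_1 list \<Rightarrow> nat \<Rightarrow> 'a set \<Rightarrow> bool"
  where "koszul_vanishes xs i B \<longleftrightarrow> (\<forall>z. (\<forall>l\<in>cells xs (Suc i). koszul_d xs z l \<in> B) \<longrightarrow>
    (\<exists>w. \<forall>l\<in>cells xs i. z l - koszul_d xs w l \<in> B))"

lemma koszul_d_linear:
  "koszul_d xs (\<lambda>l. a * z l + b * w l) l = a * koszul_d xs z l + b * koszul_d xs w l"
proof (induction xs z l arbitrary: w rule: koszul_d.induct)
  case (2 x xs z l)
  show ?case
    unfolding koszul_d.simps 2[of "\<lambda>l. w (True # l)"] by (simp add: algebra_simps)
qed simp_all

lemma koszul_d_zero: "koszul_d xs (\<lambda>_. 0) l = 0"
  using koszul_d_linear[of xs 0 "\<lambda>_. 0" 0 "\<lambda>_. 0" l] by simp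

lemma koszul_d_mult: "koszul_d xs (\<lambda>l. a * z l) l = a * koszul_d xs z l"
  using koszul_d_linear[of xs a z 0 z l] by simp

lemma koszul_d_diff: "koszul_d xs (\<lambda>l. z l - w l) l = koszul_d xs z l - koszul_d xs w l"
  using koszul_d_linear[of xs 1 z "-1" w l] by simp

lemma koszul_d_in_ideal:
  assumes "is_ideal B" "length l = length xs"
    and "\<And>l'. length l' = length xs \<Longrightarrow> Suc (count_list l' True) = count_list l True \<Longrightarrow> z l' \<in> B"
  shows "koszul_d xs z l \<in> B"
  using assms(2-)
proof (induction xs z l rule: koszul_d.induct)
  case (1 x xs z l)
  then show ?case
    by simp
next
  case (2 x xs z l)
  have "koszul_d xs (\<lambda>l. z (True # l)) l \<in> B"
    using 2 by simp
  moreover have "x * z (False # l) \<in> B"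
    using 2 by (intro ideal_mult[OF assms(1)]) simp
  ultimately show ?case
    using ideal_diff[OF assms(1)] by simp
qed (auto intro: ideal_zero[OF assms(1)])

lemma koszul_d_d: "koszul_d xs (koszul_d xs z) l = 0"
proof (induction xs arbitrary: z l)
  case (Cons x xs)
  show ?case
  proof (cases l)
    case (Cons e l')
    show ?thesis
      using Cons.IH by (cases e) (simp_all add: Cons koszul_d_diff koszul_d_mult)
  qed simp
qed simp

text \<open>Contraction with the vector \<open>gs\<close>, in the same recursive form as
  \<open>koszul_d\<close>. By \<open>koszul_homotopy\<close> it is a null homotopy for
  multiplication by the combination of \<open>xs\<close> with coefficients \<open>gs\<close>, so the
  ideal of \<open>xs\<close> annihilates the cohomology.\<close>

fun koszul_h :: "'a::comm_ring_1 list \<Rightarrow> (bool list \<Rightarrow> 'a) \<Rightarrow> bool list \<Rightarrow> 'a" where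
  "koszul_h (g # gs) z (False # l) = g * z (True # l) + koszul_h gs (\<lambda>l. z (False # l)) l"
| "koszul_h (g # gs) z (True # l) = - koszul_h gs (\<lambda>l. z (True # l)) l"
| "koszul_h _ _ _ = 0"

lemma koszul_h_linear:
  "koszul_h gs (\<lambda>l. a * z l + b * w l) l = a * koszul_h gs z l + b * koszul_h gs w l"
proof (induction gs z l arbitrary: w rule: koszul_h.induct)
  case (1 g gs z l)
  show ?case
    unfolding koszul_h.simps 1[of "\<lambda>l. w (False # l)"] by (simp add: algebra_simps)
qed simp_all

lemma koszul_h_in_ideal:
  assumes "is_ideal B" "length l = length gs"
    and "\<And>l'. length l' = length gs \<Longrightarrow> count_list l' True = Suc (count_list l True) \<Longrightarrow> z l' \<in> B"
  shows "koszul_h gs z l \<in> B"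
  using assms(2-)
proof (induction gs z l rule: koszul_h.induct)
  case (1 g gs z l)
  have "koszul_h gs (\<lambda>l. z (False # l)) l \<in> B"
    using 1 by simp
  moreover have "g * z (True # l) \<in> B"
    using 1 by (intro ideal_mult[OF assms(1)]) simp
  ultimately show ?case
    using ideal_add[OF assms(1)] by simp
next
  case (2 g gs z l)
  have "koszul_h gs (\<lambda>l. z (True # l)) l \<in> B"
    using 2 by simp
  then show ?case
    using ideal_uminus[OF assms(1)] by simp
qed (auto intro: ideal_zero[OF assms(1)])

lemma koszul_homotopy:
  assumes "length gs = length xs" "length l = length xs"
  shows "koszul_d xs (koszul_h gs z) l + koszul_h gs (koszul_d xs z) l
    = sum_list (map2 (*) gs xs) * z l"
  using assms
proof (induction gs xs arbitrary: z l rule: list_induct2)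
  case (Cons g gs x xs)
  obtain e l' where l: "l = e # l'" "length l' = length xs"
    using Cons.prems by (cases l) auto
  have IH: "koszul_h gs (koszul_d xs z) l' = sum_list (map2 (*) gs xs) * z l' - koszul_d xs (koszul_h gs z) l'" for z
    using Cons.IH[OF l(2), of z] by (simp add: algebra_simps)
  have h: "koszul_h gs (\<lambda>l. x * z l - w l) l' = x * koszul_h gs z l' - koszul_h gs w l'" for z w
    using koszul_h_linear[of gs x z "-1" w l'] by simp
  have d: "koszul_d xs (\<lambda>l. g * z l + w l) l' = g * koszul_d xs z l' + koszul_d xs w l'" for z w
    using koszul_d_linear[of xs g z 1 w l'] by simp
  have neg: "koszul_d xs (\<lambda>l. - w l) l' = - koszul_d xs w l'" for w
    using koszul_d_mult[of xs "-1" w l'] by simp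
  show ?case
    by (cases e) (simp_all add: l(1) h d neg IH algebra_simps)
qed simp

lemma ideal_gen_set_combination:
  assumes "f \<in> ideal_gen (set xs)"
  shows "\<exists>gs. length gs = length xs \<and> f = sum_list (map2 (*) gs xs)"
  using assms
proof (induction xs arbitrary: f)
  case Nil
  then show ?case
    by (simp add: ideal_gen_empty)
next
  case (Cons x xs)
  have "ideal_gen (set (x # xs)) = ideal_gen {x} + ideal_gen (set xs)"
    using ideal_gen_Un[of "{x}" "set xs"] by simp
  moreover have "ideal_gen {x} = range (\<lambda>g. g * x)"
    by (simp add: ideal_gen_def module.span_singleton[OF module_times])
  ultimately obtain g f' where "f = g * x + f'" "f' \<in> ideal_gen (set xs)"
    using Cons.prems by (auto simp: set_plus_def)
  then show ?case
    using Cons.IH[of f'] by (metis length_Cons list.simps(9) zip_Cons_Cons sum_list.Cons case_prod_conv)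
qed

text \<open>As \<open>f\<close> kills the cohomology, the long exact sequence of multiplication by
  \<open>f\<close> makes the connecting map from degree \<open>i - 1\<close> modulo
  \<open>B + (f)\<close> to degree \<open>i\<close> modulo \<open>B\<close> onto. The proof is this
  diagram chase on lifts.\<close>

lemma koszul_vanishes_of_weakly_regular:
  assumes "weakly_regular fs UNIV B" "set fs \<subseteq> ideal_gen (set xs)" "is_ideal B" "i < length fs"
  shows "koszul_vanishes xs i B"
  using assms
proof (induction fs arbitrary: B i)
  case (Cons f fs)
  note B = Cons.prems(3)
  have regular: "r \<in> B" if "f * r \<in> B" for r
    using that Cons.prems(1) by simp
  obtain gs where gs: "length gs = length xs" "f = sum_list (map2 (*) gs xs)"
    using ideal_gen_set_combination Cons.prems(2) by auto
  show ?case
    unfolding koszul_vanishes_def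
  proof (intro allI impI)
    fix z assume z: "\<forall>l\<in>cells xs (Suc i). koszul_d xs z l \<in> B"
    define w where "w = koszul_h gs z"
    have fz: "f * z l - koszul_d xs w l \<in> B" if "l \<in> cells xs i" for l
    proof -
      have "f * z l - koszul_d xs w l = koszul_h gs (koszul_d xs z) l"
        using koszul_homotopy[OF gs(1), of l z] that by (simp add: w_def gs(2) cells_def algebra_simps)
      also have "\<dots> \<in> B"
        using z that gs(1) by (intro koszul_h_in_ideal[OF B]) (auto simp: cells_def)
      finally show ?thesis .
    qed
    show "\<exists>w. \<forall>l\<in>cells xs i. z l - koszul_d xs w l \<in> B"
    proof (cases i)
      case 0
      \<comment> \<open>There are no cochains below degree zero, so the coboundary is trivial and
        \<open>f * z l\<close> itself lies in \<open>B\<close>.\<close>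
      have "z l - koszul_d xs (\<lambda>_. 0) l \<in> B" if "l \<in> cells xs i" for l
      proof -
        have "koszul_d xs w l \<in> B"
          using that 0 by (intro koszul_d_in_ideal[OF B]) (auto simp: cells_def)
        then have "f * z l \<in> B"
          using fz[OF that] ideal_add[OF B] by fastforce
        then show ?thesis
          using regular by (simp add: koszul_d_zero)
      qed
      then show ?thesis by blast
    next
      case (Suc j)
      let ?B = "B + f *o UNIV"
      have B': "is_ideal ?B"
        by (intro is_ideal_plus is_ideal_times is_ideal_UNIV B)
      have "koszul_vanishes xs j ?B"
        using Cons.prems Suc by (intro Cons.IH B') auto
      moreover have "\<forall>l\<in>cells xs (Suc j). koszul_d xs w l \<in> ?B"
      proof
        fix l assume "l \<in> cells xs (Suc j)"
        then have "f * z l - koszul_d xs w l \<in> B"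
          using fz Suc by simp
        then have "- (f * z l - koszul_d xs w l) + f * z l \<in> ?B"
          using ideal_uminus[OF B] by blast
        then show "koszul_d xs w l \<in> ?B"
          by simp
      qed
      ultimately obtain v where v: "\<forall>l\<in>cells xs j. w l - koszul_d xs v l \<in> ?B"
        unfolding koszul_vanishes_def by blast
      have "\<exists>u. \<forall>l\<in>cells xs j. w l - koszul_d xs v l - f * u l \<in> B"
      proof (rule bchoice[of "cells xs j" "\<lambda>l r. w l - koszul_d xs v l - f * r \<in> B"], rule ballI)
        fix l assume "l \<in> cells xs j"
        then obtain b r where "b \<in> B" "w l - koszul_d xs v l = b + f * r"
          using v by (auto simp: set_plus_def elt_set_times_def)
        then show "\<exists>r. w l - koszul_d xs v l - f * r \<in> B"
          by (intro exI[of _ r]) simp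
      qed
      then obtain u where u: "\<forall>l\<in>cells xs j. w l - koszul_d xs v l - f * u l \<in> B"
        by blast
      \<comment> \<open>Modulo \<open>B\<close>, \<open>w\<close> is the coboundary of
        \<open>v\<close> plus \<open>f * u\<close>. Applying \<open>koszul_d\<close> removes
        \<open>v\<close>, and cancelling \<open>f\<close> shows that \<open>z\<close> is the
        coboundary of \<open>u\<close>.\<close>
      have "z l - koszul_d xs u l \<in> B" if l: "l \<in> cells xs i" for l
      proof -
        have "koszul_d xs (\<lambda>l. w l - koszul_d xs v l - f * u l) l \<in> B"
          using l Suc u by (intro koszul_d_in_ideal[OF B]) (auto simp: cells_def)
        then have "koszul_d xs w l - f * koszul_d xs u l \<in> B"
          by (simp add: koszul_d_diff koszul_d_mult koszul_d_d)
        then have "(f * z l - koszul_d xs w l) + (koszul_d xs w l - f * koszul_d xs u l) \<in> B"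
          using fz[OF l] ideal_add[OF B] by blast
        then have "f * (z l - koszul_d xs u l) \<in> B"
          by (simp add: algebra_simps)
        then show ?thesis
          by (rule regular)
      qed
      then show ?thesis by blast
    qed
  qed
qed simp

section \<open>Truncation by degree and removal of a variable from the Koszul complex\<close>

abbreviation trunc :: "nat \<Rightarrow> ('v::finite, 'k::field) mpoly \<Rightarrow> ('v, 'k) mpoly"
  where "trunc D \<equiv> part {u. mdeg u \<le> D}"

lemma trunc_in_graded_ideal:
  assumes "graded_ideal Q" "f \<in> Q"
  shows "trunc D f \<in> Q"
proof -
  have "trunc D f = (\<Sum>d\<le>D. hom_component d f)"
    by (intro poly_mapping_eqI) (simp add: hom_component_eq_part lookup_sum lookup_part)
  also have "\<dots> \<in> Q"
    using assms by (intro ideal_sum) (auto simp: graded_ideal_def)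
  finally show ?thesis .
qed

lemma mdeg_ind_single: "mdeg (ind {i} + u) = Suc (mdeg u)"
  by (simp add: mdeg_add mdeg_ind)

lemma trunc_0_Var_mult: "trunc 0 (Var i * f) = 0"
  by (rule part_none) (auto simp: Var_eq_ind keys_mon_mult mdeg_ind_single)

lemma trunc_Suc_Var_mult: "trunc (Suc D) (Var i * f) = Var i * trunc D f"
proof (rule poly_mapping_eqI)
  fix k
  show "lk (trunc (Suc D) (Var i * f)) k = lk (Var i * trunc D f) k"
  proof (cases "\<exists>l. k = ind {i} + l")
    case True
    then show ?thesis
      by (auto simp: Var_eq_ind lookup_part lookup_mon_mult mdeg_ind_single)
  next
    case False
    then have "k \<notin> keys (Var i * f)" "k \<notin> keys (Var i * trunc D f)"
      by (auto simp: Var_eq_ind keys_mon_mult)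
    then show ?thesis
      by (simp add: in_keys_iff lookup_part)
  qed
qed

lemma trunc_Var_power_mult: "D < t \<Longrightarrow> trunc D (Var i ^ t * f) = 0"
proof (induction t arbitrary: D)
  case (Suc t)
  then show ?case
    by (cases D) (simp_all only: power_Suc mult.assoc trunc_0_Var_mult trunc_Suc_Var_mult, simp)
qed simp

lemma trunc_koszul_d:
  "trunc (Suc D) (koszul_d (map Var vs) w l) = koszul_d (map Var vs) (\<lambda>l. trunc D (w l)) l"
proof (induction vs arbitrary: w l)
  case Nil
  then show ?case
    by (simp add: part_none)
next
  case (Cons v vs)
  show ?case
  proof (cases l)
    case Nil
    then show ?thesis
      by (simp add: part_none)
  next
    case (Cons e l')
    then show ?thesis
      using Cons.IH by (cases e) (simp_all add: part_diff trunc_Suc_Var_mult)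
  qed
qed

text \<open>Multiplication by \<open>x\<close> is onto on the cohomology of \<open>xs\<close>, so a class is divisible by every power
  of \<open>x\<close>; as the module is graded, it vanishes.\<close>

lemma koszul_vanishes_Cons:
  fixes Q :: "('v::finite, 'k::field) mpoly set"
  assumes "graded_ideal Q" "koszul_vanishes (map Var (v # vs)) (Suc i) Q"
  shows "koszul_vanishes (map Var vs) i Q"
  unfolding koszul_vanishes_def
proof (intro allI impI)
  let ?xs = "map Var vs :: ('v, 'k) mpoly list" and ?x = "Var v :: ('v, 'k) mpoly"
  have Q: "is_ideal Q"
    using assms(1) by (simp add: graded_ideal_def)
  fix z assume z: "\<forall>l\<in>cells ?xs (Suc i). koszul_d ?xs z l \<in> Q"
  have "\<exists>w u. (\<forall>l\<in>cells ?xs (Suc i). koszul_d ?xs w l \<in> Q) \<and>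
    (\<forall>l\<in>cells ?xs i. z l - (?x ^ t * w l + koszul_d ?xs u l) \<in> Q)" for t
  proof (induction t)
    case 0
    show ?case
      using z by (intro exI[of _ z] exI[of _ "\<lambda>_. 0"]) (simp add: koszul_d_zero ideal_zero[OF Q])
  next
    case (Suc t)
    then obtain w u where w: "\<forall>l\<in>cells ?xs (Suc i). koszul_d ?xs w l \<in> Q"
      and u: "\<forall>l\<in>cells ?xs i. z l - (?x ^ t * w l + koszul_d ?xs u l) \<in> Q"
      by blast
    \<comment> \<open>\<open>y\<close> places \<open>w\<close> in the \<open>True\<close> half of
      the cone. That it is a coboundary of \<open>W\<close> modulo \<open>Q\<close> says, in the two
      halves, that \<open>W0\<close> is a cocycle and that \<open>w\<close> equals
      \<open>x * W0\<close> minus the coboundary of \<open>W1\<close>.\<close>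
    define y where "y l = (if hd l then w (tl l) else 0)" for l
    have y: "\<forall>l\<in>cells (?x # ?xs) (Suc (Suc i)). koszul_d (?x # ?xs) y l \<in> Q"
    proof
      fix l assume l: "l \<in> cells (?x # ?xs) (Suc (Suc i))"
      then obtain e l' where "l = e # l'"
        by (cases l) (auto simp: cells_def)
      then show "koszul_d (?x # ?xs) y l \<in> Q"
        using l w by (cases e) (simp_all add: y_def cells_def koszul_d_zero ideal_zero[OF Q] ideal_uminus[OF Q])
    qed
    from assms(2)[unfolded koszul_vanishes_def list.map, THEN spec, THEN mp, OF y]
    obtain W where W: "\<forall>l\<in>cells (?x # ?xs) (Suc i). y l - koszul_d (?x # ?xs) W l \<in> Q"
      by blast
    define W0 where "W0 l = W (False # l)" for l
    define W1 where "W1 l = W (True # l)" for l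
    have "koszul_d ?xs W0 l \<in> Q" if "l \<in> cells ?xs (Suc i)" for l
    proof -
      have "- koszul_d ?xs W0 l \<in> Q"
        using that W[rule_format, of "False # l"] by (simp add: cells_def y_def W0_def[abs_def])
      then show ?thesis
        using ideal_uminus[OF Q] by fastforce
    qed
    moreover have "z l - (?x ^ Suc t * W0 l + koszul_d ?xs (\<lambda>l. u l - ?x ^ t * W1 l) l) \<in> Q"
      if l: "l \<in> cells ?xs i" for l
    proof -
      have "w l - (?x * W0 l - koszul_d ?xs W1 l) \<in> Q"
        using l W[rule_format, of "True # l"] by (simp add: cells_def y_def W0_def[abs_def] W1_def[abs_def])
      then have "(z l - (?x ^ t * w l + koszul_d ?xs u l)) +
          ?x ^ t * (w l - (?x * W0 l - koszul_d ?xs W1 l)) \<in> Q"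
        using u l by (intro ideal_add[OF Q] ideal_mult[OF Q]) auto
      then show ?thesis
        unfolding koszul_d_diff koszul_d_mult by (simp add: algebra_simps)
    qed
    ultimately show ?case by blast
  qed
  note divisible = this
  \<comment> \<open>A degree bound for the finitely many values of \<open>z\<close>. Truncation
    above it fixes \<open>z\<close>, kills multiples of a higher power of \<open>x\<close>, and
    preserves \<open>Q\<close> because \<open>Q\<close> is graded.\<close>
  define D where "D = (\<Sum>l\<in>cells ?xs i. \<Sum>k\<in>keys (z l). mdeg k)"
  have fin: "finite (cells ?xs i)"
    by (rule finite_subset[OF _ finite_lists_length_eq[of "UNIV :: bool set" "length ?xs"]])
      (auto simp: cells_def)
  have D: "trunc (Suc D) (z l) = z l" if "l \<in> cells ?xs i" for l
  proof (rule part_all)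
    have "mdeg k \<le> D" if k: "k \<in> keys (z l)" for k
    proof -
      have "mdeg k \<le> (\<Sum>k\<in>keys (z l). mdeg k)"
        by (rule member_le_sum[OF k]) auto
      also have "\<dots> \<le> D"
        unfolding D_def by (rule member_le_sum[OF \<open>l \<in> cells ?xs i\<close>]) (auto simp: fin)
      finally show ?thesis .
    qed
    then show "keys (z l) \<subseteq> {u. mdeg u \<le> Suc D}"
      by (auto intro: le_SucI)
  qed
  obtain w u where u: "\<forall>l\<in>cells ?xs i. z l - (?x ^ Suc (Suc D) * w l + koszul_d ?xs u l) \<in> Q"
    using divisible by blast
  have "z l - koszul_d ?xs (\<lambda>l. trunc D (u l)) l \<in> Q" if l: "l \<in> cells ?xs i" for l
  proof -
    have "trunc (Suc D) (z l - (?x ^ Suc (Suc D) * w l + koszul_d ?xs u l)) \<in> Q"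
      using u l by (intro trunc_in_graded_ideal assms(1)) auto
    then show ?thesis
      unfolding part_diff part_add D[OF l] trunc_koszul_d trunc_Var_power_mult[OF lessI] by simp
  qed
  then show "\<exists>w. \<forall>l\<in>cells ?xs i. z l - koszul_d ?xs w l \<in> Q" by blast
qed

text \<open>Locally at \<open>(a, b, c, d)\<close> the ideal \<open>Q\<close> is
  \<open>(a, b) \<inter> (c, d)\<close>, whose zero set is disconnected after removing \<open>a = b = c = d = 0\<close>. The
  cocycle in the proof is \<open>ef\<close> times the function that is \<open>0\<close> on one component and \<open>1\<close> on the other.\<close>

lemma depth_obstruction:
  fixes Q :: "('v::{finite, linorder}, 'k::field) mpoly set"
  assumes "graded_ideal Q" "weakly_regular rs UNIV Q" "set rs \<subseteq> max_graded_ideal" "4 \<le> length rs"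
    and "distinct [e, f, a, b, c, d]" "set [e, f, a, b, c, d] = UNIV"
    and "Q \<subseteq> vars_prime {a, b}" "Q \<subseteq> vars_prime {c, d}"
    and "\<And>i j. i \<in> {a, b} \<Longrightarrow> j \<in> {c, d} \<Longrightarrow> mon (ind {e, f, i, j}) \<in> Q"
  shows False
proof -
  have Q: "is_ideal Q"
    using assms(1) by (simp add: graded_ideal_def)
  have "range Var = (set (map Var [e, f, a, b, c, d]) :: ('v, 'k) mpoly set)"
    unfolding set_map assms(6) ..
  \<comment> \<open>Vanishing holds since \<open>3 < 4 \<le> length rs\<close>; removing
    \<open>e\<close> and then \<open>f\<close> lowers the degree to \<open>1\<close>.\<close>
  then have "koszul_vanishes (map Var [e, f, a, b, c, d]) 3 Q"
    using assms(1-4) Q unfolding max_graded_ideal_def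
    by (intro koszul_vanishes_of_weakly_regular[of rs]) simp_all
  then have "koszul_vanishes (map Var [f, a, b, c, d]) 2 Q"
    using koszul_vanishes_Cons[OF assms(1), of e "[f, a, b, c, d]" 2] by (simp add: numeral_eq_Suc)
  then have vanishes: "koszul_vanishes (map Var [a, b, c, d]) 1 Q"
    using koszul_vanishes_Cons[OF assms(1), of f "[a, b, c, d]" 1] by (simp add: numeral_eq_Suc)
  let ?xs = "map Var [a, b, c, d] :: ('v, 'k) mpoly list"
  define s where "s = (mon (ind {e, f}) :: ('v, 'k) mpoly)"
  define z where "z l = (if l = [False, False, True, False] then s * Var c
    else if l = [False, False, False, True] then s * Var d else 0)" for l
  have in_Q: "Var i * (s * Var j) \<in> Q" if "i \<in> {a, b}" "j \<in> {c, d}" for i j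
  proof -
    have "{i} \<inter> ({e, f} \<union> {j}) = {}" "{e, f} \<inter> {j} = {}"
      using that assms(5) by auto
    then have "Var i * (s * Var j) = mon (ind {e, f, i, j})"
      by (simp add: s_def Var_eq_ind mon_mult ind_union insert_commute)
    then show ?thesis
      using assms(9)[OF that] by simp
  qed
  \<comment> \<open>At a cell with one index from each pair the coboundary is, up to sign, a product
    covered by \<open>in_Q\<close>; at the cell of \<open>c\<close> and \<open>d\<close> the two
    contributions cancel.\<close>
  have "\<forall>l\<in>cells ?xs (Suc 1). koszul_d ?xs z l \<in> Q"
  proof
    fix l assume "l \<in> cells ?xs (Suc 1)"
    then obtain p q r t where l: "l = [p, q, r, t]" "count_list [p, q, r, t] True = 2"
      by (auto simp: cells_def numeral_eq_Suc length_Suc_conv)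
    show "koszul_d ?xs z l \<in> Q"
      using l in_Q[of a c] in_Q[of a d] in_Q[of b c] in_Q[of b d] ideal_zero[OF Q] ideal_uminus[OF Q]
      by (cases p; cases q; cases r; cases t) (auto simp: z_def ac_simps)
  qed
  then obtain w where w: "\<forall>l\<in>cells ?xs 1. z l - koszul_d ?xs w l \<in> Q"
    using vanishes unfolding koszul_vanishes_def by blast
  define w0 where "w0 = w [False, False, False, False]"
  have prime: "r \<in> vars_prime D" if "Var i * r \<in> vars_prime D" "i \<notin> D" for i D and r :: "('v, 'k) mpoly"
  proof -
    have "(Var i :: ('v, 'k) mpoly) \<notin> vars_prime D"
      using that(2) by (auto simp: Var_eq_ind mon_in_vars_prime_iff zero_set_ind)
    then show ?thesis
      using that(1) is_prime_ideal_vars_prime[of D] unfolding is_prime_ideal_def by blast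
  qed
  \<comment> \<open>The bounding element \<open>w0\<close> vanishes modulo \<open>(c, d)\<close> and
    agrees with \<open>s\<close> modulo \<open>(a, b)\<close>. So \<open>s\<close>, the product of
    the variables \<open>e\<close> and \<open>f\<close>, would lie in
    \<open>(a, b, c, d)\<close>.\<close>
  have "- (Var a * w0) \<in> Q"
    using w[rule_format, of "[True, False, False, False]"] by (simp add: cells_def z_def w0_def)
  then have "Var a * w0 \<in> vars_prime {c, d}"
    using ideal_uminus[OF Q] assms(8) by fastforce
  then have w0: "w0 \<in> vars_prime {c, d}"
    using prime assms(5) by auto
  have "s * Var c - Var c * w0 \<in> Q"
    using w[rule_format, of "[False, False, True, False]"] by (simp add: cells_def z_def w0_def)
  then have "Var c * (s - w0) \<in> vars_prime {a, b}"
    using assms(7) by (auto simp: algebra_simps)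
  then have "s - w0 \<in> vars_prime {a, b}"
    using prime assms(5) by auto
  then have "(s - w0) + w0 \<in> vars_prime {a, b, c, d}"
    using w0 vars_prime_subset_iff[of "{a, b}" "{a, b, c, d}", where ?'k='k]
      vars_prime_subset_iff[of "{c, d}" "{a, b, c, d}", where ?'k='k]
    by (intro ideal_add is_ideal_vars_prime) auto
  then show False
    using assms(5) by (auto simp: s_def mon_in_vars_prime_iff zero_set_ind)
qed

section \<open>Sequentially Cohen-Macaulay squarefree monomial ideals\<close>

lemma zideal_psubset_iff:
  "zideal \<D> \<subset> (zideal \<D>' :: ('v::finite, 'k::field) mpoly set) \<longleftrightarrow> \<D> \<subset> \<D>'"
  by (simp add: psubset_eq[of "zideal _"] less_le_not_le[of "\<D>"] subset_not_subset_eq zideal_subset_iff)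

lemma SCM_zideal_unmixed:
  assumes "down_closed \<D>" "clean d (- \<D>)" "\<D> \<noteq> UNIV"
  shows "SCM (zideal \<D> :: ('v::{finite, linorder}, 'k::field) mpoly set)"
proof -
  let ?M = "\<lambda>i::nat. zideal (if i = 0 then \<D> else UNIV) :: ('v, 'k) mpoly set"
  have "cohen_macaulay (zideal (\<D> \<union> - \<D>)) (zideal \<D> :: ('v, 'k) mpoly set)"
    using assms by (intro cohen_macaulay_zideal(1)) (auto simp: down_closed_def)
  then have "cohen_macaulay (?M (Suc 0)) (?M 0)"
    by (simp add: Compl_partition)
  moreover have "?M 0 \<subset> ?M (Suc 0)"
    using assms(3) by (auto simp: zideal_psubset_iff)
  moreover have "graded_ideal (?M i)" for i
    using assms(1) by (intro graded_ideal_zideal) (auto simp: down_closed_def)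
  ultimately show ?thesis
    unfolding SCM_def sequentially_CM_def
    by (intro exI[of _ 1] exI[of _ ?M]) (simp add: zideal_UNIV)
qed

lemma SCM_zideal_two_steps:
  assumes "down_closed \<D>" "down_closed \<E>" "\<D> \<subset> \<E>" "\<E> \<noteq> UNIV"
    and "clean d (\<E> - \<D>)" "clean e (- \<E>)" "d < e"
  shows "SCM (zideal \<D> :: ('v::{finite, linorder}, 'k::field) mpoly set)"
proof -
  define F where "F i = (if i = 0 then \<D> else if i = 1 then \<E> else UNIV)" for i :: nat
  let ?M = "\<lambda>i::nat. zideal (F i) :: ('v, 'k) mpoly set"
  have steps: "{..<2} = {0, 1 :: nat}"
    by auto
  have Un: "\<D> \<union> (\<E> - \<D>) = \<E>" "\<E> \<union> - \<E> = UNIV"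
    using assms(3) by auto
  have "cohen_macaulay (zideal (\<D> \<union> (\<E> - \<D>))) (zideal \<D> :: ('v, 'k) mpoly set)"
    "module_dim (zideal (\<D> \<union> (\<E> - \<D>))) (zideal \<D> :: ('v, 'k) mpoly set) = enat d"
    by (rule cohen_macaulay_zideal[OF assms(5,1)]; use assms(2,3) Un in auto)+
  moreover have "cohen_macaulay (zideal (\<E> \<union> - \<E>)) (zideal \<E> :: ('v, 'k) mpoly set)"
    "module_dim (zideal (\<E> \<union> - \<E>)) (zideal \<E> :: ('v, 'k) mpoly set) = enat e"
    by (rule cohen_macaulay_zideal[OF assms(6,2)]; use assms(4) Un in \<open>auto simp: down_closed_def\<close>)+
  ultimately have cm: "\<forall>i<2. cohen_macaulay (?M (Suc i)) (?M i)"
    and dim: "module_dim (?M 1) (?M 0) = enat d" "module_dim (?M 2) (?M 1) = enat e"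
    unfolding Un by (simp_all add: F_def less_2_cases_iff)
  have strict: "\<forall>i<2. ?M i \<subset> ?M (Suc i)"
    using assms(3,4) by (auto simp: less_2_cases_iff F_def zideal_psubset_iff)
  have graded: "graded_ideal (?M i)" for i
    using assms(1,2) by (intro graded_ideal_zideal) (auto simp: F_def down_closed_def)
  show ?thesis
    unfolding SCM_def sequentially_CM_def
  proof (intro exI[of _ 2] exI[of _ ?M] conjI allI impI)
    show "zideal (F 0) = (zideal \<D> :: ('v, 'k) mpoly set)" "zideal (F 2) = (UNIV :: ('v, 'k) mpoly set)"
      by (simp_all add: F_def zideal_UNIV)
    show "module_dim (?M (Suc i)) (?M i) < module_dim (?M (Suc (Suc i))) (?M (Suc i))" if "Suc i < 2" for i
      using that dim assms(7) by (simp add: numeral_2_eq_2)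
  qed (use cm strict graded in auto)
qed

text \<open>A prime over \<open>J\<close> contains the annihilator of some factor of the filtration. If its dimension is
  the largest possible, this is the last factor, because the dimensions increase.\<close>

lemma SCM_top_quotient:
  fixes J :: "('v::{finite, linorder}, 'k::field) mpoly set"
  assumes "SCM J" "keyideal (large_support (Suc e)) \<subseteq> J"
    and "J \<subseteq> vars_prime D0" "card (- D0) = Suc e"
  obtains Q rs where "graded_ideal Q" "J \<subseteq> Q" "weakly_regular rs UNIV Q"
    "set rs \<subseteq> max_graded_ideal" "Suc e \<le> length rs"
    "\<And>D. J \<subseteq> vars_prime D \<Longrightarrow> card (- D) = Suc e \<Longrightarrow> Q \<subseteq> vars_prime D"
proof -
  obtain r and M :: "nat \<Rightarrow> ('v, 'k) mpoly set" where M: "M 0 = J" "M r = UNIV"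
    "\<forall>i\<le>r. graded_ideal (M i)" "\<forall>i<r. M i \<subset> M (Suc i)"
    "\<forall>i<r. cohen_macaulay (M (Suc i)) (M i)"
    "\<forall>i. Suc i < r \<longrightarrow> module_dim (M (Suc i)) (M i) < module_dim (M (Suc (Suc i))) (M (Suc i))"
    using assms(1) unfolding SCM_def sequentially_CM_def by blast
  have M_ideal: "is_ideal (M i)" if "i \<le> r" for i
    using M(3) that by (simp add: graded_ideal_def)
  have J_le: "J \<subseteq> M i" if "i \<le> r" for i
    using that
  proof (induction i)
    case (Suc i)
    then show ?case
      using M(4) by (metis Suc_leD Suc_le_lessD order_trans psubset_imp_subset)
  qed (simp add: M(1))
  have dim_mono: "module_dim (M (Suc i)) (M i) < module_dim (M (Suc j)) (M j)" if "i < j" "j < r" for i j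
    using that
  proof (induction j)
    case (Suc j)
    then show ?case
      using M(6) by (metis Suc_lessD less_SucE less_trans)
  qed simp
  have top: "r \<noteq> 0 \<and> M (r - 1) \<subseteq> vars_prime D" if D: "J \<subseteq> vars_prime D" "card (- D) = Suc e" for D
  proof -
    let ?P = "vars_prime D :: ('v, 'k) mpoly set"
    have prime: "a \<notin> ?P \<Longrightarrow> b \<notin> ?P \<Longrightarrow> a * b \<notin> ?P" for a b
      using is_prime_ideal_vars_prime[of D] unfolding is_prime_ideal_def by blast
    have one: "1 \<notin> ?P"
      using mon_in_vars_prime_iff[of 0 D, where ?'k='k] by (simp add: mon_zero zero_set_zero)
    \<comment> \<open>Otherwise each factor is annihilated by some element outside
      \<open>?P\<close>; the product of these is outside \<open>?P\<close> and multiplies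
      \<open>1\<close> into \<open>J\<close>, against \<open>J \<subseteq> ?P\<close>.\<close>
    have "\<exists>i<r. annihilator (M (Suc i)) (M i) \<subseteq> ?P"
    proof (rule ccontr)
      assume neg: "\<not> ?thesis"
      have "\<exists>s. s \<notin> ?P \<and> (\<forall>x\<in>M i. s * x \<in> J)" if "i \<le> r" for i
        using that
      proof (induction i)
        case 0
        show ?case
          using one M(1) by (intro exI[of _ 1]) simp
      next
        case (Suc i)
        then obtain s where s: "s \<notin> ?P" "\<forall>x\<in>M i. s * x \<in> J"
          by auto
        have "i < r"
          using Suc.prems by simp
        then obtain t where t: "t \<notin> ?P" "t \<in> annihilator (M (Suc i)) (M i)"
          using neg by blast
        have "(s * t) * x \<in> J" if "x \<in> M (Suc i)" for x
          using s(2) t(2) that by (simp add: annihilator_def mult.assoc)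
        then show ?case
          using prime[OF s(1) t(1)] by blast
      qed
      then obtain s where "s \<notin> ?P" "s * 1 \<in> J"
        using M(2) by blast
      then show False
        using D(1) by auto
    qed
    then obtain i where i: "i < r" "annihilator (M (Suc i)) (M i) \<subseteq> ?P"
      by blast
    have ge: "enat (Suc e) \<le> module_dim (M (Suc i)) (M i)"
      using krull_dim_mod_ge[OF i(2)] D(2) by (simp add: module_dim_def)
    have last: "Suc (r - 1) = r"
      using i(1) by simp
    have "annihilator (M r) (M (r - 1)) = M (r - 1)"
      unfolding M(2) by (rule annihilator_UNIV[OF M_ideal]) simp
    moreover have "krull_dim_mod (M (r - 1)) \<le> enat (Suc e)"
      using assms(2) J_le[of "r - 1"] by (intro krull_dim_mod_le) auto
    ultimately have "module_dim (M (Suc (r - 1))) (M (r - 1)) \<le> enat (Suc e)"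
      unfolding last by (simp add: module_dim_def)
    \<comment> \<open>An earlier factor of dimension at least \<open>Suc e\<close> would push the
      last dimension beyond \<open>Suc e\<close>.\<close>
    then have "\<not> i < r - 1"
      using dim_mono[of i "r - 1"] ge i(1) by auto
    then have "i = r - 1"
      using i(1) by simp
    then show ?thesis
      using i \<open>annihilator (M r) (M (r - 1)) = M (r - 1)\<close> last by simp
  qed
  define Q where "Q = M (r - 1)"
  have r: "r \<noteq> 0" and Q_D0: "Q \<subseteq> vars_prime D0"
    using top[OF assms(3,4)] by (simp_all add: Q_def)
  have Q: "is_ideal Q" "graded_ideal Q"
    using M_ideal M(3) by (simp_all add: Q_def)
  have "mon 0 \<notin> (vars_prime D0 :: ('v, 'k) mpoly set)"
    by (simp add: mon_in_vars_prime_iff zero_set_zero)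
  then have "Q \<noteq> UNIV"
    using Q_D0 by blast
  then have "module_depth UNIV Q = module_dim UNIV Q"
    using M(2,5) r by (metis Q_def Suc_diff_1 cohen_macaulay_def diff_less neq0_conv zero_less_one)
  also have "\<dots> = krull_dim_mod Q"
    by (simp add: module_dim_def annihilator_UNIV[OF Q(1)])
  also have "\<dots> > enat e"
    using krull_dim_mod_ge[OF Q_D0] assms(4) by (simp add: Suc_ile_eq)
  finally obtain rs where rs: "e < length rs" "set rs \<subseteq> max_graded_ideal" "regular_sequence UNIV Q rs"
    unfolding module_depth_def less_Sup_iff by auto
  then have "weakly_regular rs UNIV Q"
    using regular_sequence_iff[OF is_ideal_UNIV] by blast
  then show thesis
    using that[of Q rs] Q(2) J_le[of "r - 1"] rs top by (simp add: Q_def Suc_leI)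
qed


section \<open>Matroids of rank four on six elements\<close>

text \<open>A basis is the complement of a pair \<open>{i, j}\<close> that is a basis of the dual matroid. Two
  elements that do not form such a pair are parallel in the dual.\<close>

definition cobase :: "('v::finite, 'k::field) mpoly set \<Rightarrow> 'v \<Rightarrow> 'v \<Rightarrow> bool"
  where "cobase J i j \<longleftrightarrow> i \<noteq> j \<and> ind (- {i, j}) \<in> min_gens J"

lemma exchange_ind:
  assumes "i \<in> S" "j \<notin> S"
  shows "Poly_Mapping.single j 1 + (ind S - Poly_Mapping.single i 1) = ind (insert j (S - {i}))"
  using assms by (intro poly_mapping_eqI) (auto simp: lookup_add lookup_minus lookup_single lookup_ind when_def)

locale rank_four_matroid =
  fixes J :: "('v::{finite, linorder}, 'k::field) mpoly set"
  assumes six: "CARD('v) = 6"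
    and matroidal: "matroidal J"
    and degree: "generated_in_degree 4 J"
    and supp: "ideal_supp J = UNIV"
    and gcd: "ideal_gcd J = 1"
begin

lemma J_eq: "J = ideal_gen (mon ` min_gens J)"
  using matroidal monomial_ideal_min_gens(1) by (auto simp: matroidal_def polymatroidal_def)

lemma min_gens_nonempty: "min_gens J \<noteq> {}"
  using supp by (auto simp: ideal_supp_eq)

lemma cobase_sym: "cobase J i j \<longleftrightarrow> cobase J j i"
  by (auto simp: cobase_def insert_commute)

lemma cobase_irrefl: "\<not> cobase J i i"
  by (simp add: cobase_def)

lemma min_gens_cases:
  assumes "u \<in> min_gens J"
  obtains i j where "cobase J i j" "u = ind (- {i, j})" "zero_set u = {i, j}"
proof -
  have u: "u = ind (- zero_set u)"
    using matroidal assms by (intro squarefree_eq_ind) (simp add: matroidal_def)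
  have "mdeg u = 4"
    using degree assms by (simp add: generated_in_degree_def)
  then have "card (- zero_set u) = 4"
    using mdeg_ind[of "- zero_set u"] u by simp
  then have "card (zero_set u) = 2"
    using card_add_card_Compl[of "zero_set u"] six by simp
  then obtain i j where "zero_set u = {i, j}" "i \<noteq> j"
    by (auto simp: card_2_iff)
  then show thesis
    using that[of i j] u assms by (simp add: cobase_def)
qed

lemma J_eq_zideal: "J = zideal {D. \<exists>i j. cobase J i j \<and> D \<subseteq> {i, j}}"
proof -
  have "up (min_gens J) = {k. \<exists>i j. cobase J i j \<and> zero_set k \<subseteq> {i, j}}"
  proof (intro set_eqI iffI)
    fix k assume "k \<in> up (min_gens J)"
    then obtain u where "u \<in> min_gens J" "divides u k"
      by (auto simp: up_def)
    then show "k \<in> {k. \<exists>i j. cobase J i j \<and> zero_set k \<subseteq> {i, j}}"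
      by (auto elim!: min_gens_cases simp: ind_divides_iff) blast
  next
    fix k assume "k \<in> {k. \<exists>i j. cobase J i j \<and> zero_set k \<subseteq> {i, j}}"
    then obtain i j where "cobase J i j" "zero_set k \<subseteq> {i, j}"
      by blast
    then show "k \<in> up (min_gens J)"
      by (auto simp: up_def cobase_def ind_divides_iff intro!: bexI[of _ "ind (- {i, j})"])
  qed
  then show ?thesis
    by (subst J_eq) (simp add: ideal_gen_mon zideal_def)
qed

lemma cobase_if_mon_in_J:
  assumes "mon (ind (- {i, j})) \<in> J" "i \<noteq> j"
  shows "cobase J i j"
proof -
  have "\<exists>k l. cobase J k l \<and> {i, j} \<subseteq> {k, l}"
    using assms(1) by (subst (asm) J_eq_zideal) (simp add: mon_in_zideal_iff zero_set_ind)
  then obtain k l where kl: "cobase J k l" "{i, j} \<subseteq> {k, l}"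
    by blast
  then have "i = k \<and> j = l \<or> i = l \<and> j = k"
    using assms(2) by auto
  then show ?thesis
    using kl(1) cobase_sym by blast
qed

text \<open>As the gcd is one, each variable is missing from some basis: the dual matroid has no
  loops.\<close>

lemma ex_cobase: "\<exists>j. cobase J i j"
proof -
  have "ideal_gcd J = mon 0"
    using gcd by (simp add: mon_zero)
  then obtain u where "u \<in> min_gens J" "lk u i = 0"
    using ideal_gcd_spec[OF min_gens_nonempty, of 0 i] by auto
  then have "i \<in> zero_set u"
    by (simp add: zero_set_def)
  obtain k l where "cobase J k l" "zero_set u = {k, l}"
    using \<open>u \<in> min_gens J\<close> by (rule min_gens_cases)
  then have "i = k \<or> i = l"
    using \<open>i \<in> zero_set u\<close> by simp
  then show ?thesis
    using \<open>cobase J k l\<close> cobase_sym by blast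
qed

text \<open>As the support is full, each variable lies in some basis: the dual matroid has no
  coloops.\<close>

lemma ex_cobase_avoiding: "\<exists>j k. cobase J j k \<and> i \<noteq> j \<and> i \<noteq> k"
proof -
  obtain u where "u \<in> min_gens J" "i \<notin> zero_set u"
    using supp by (auto simp: ideal_supp_eq)
  then show ?thesis
    by (auto elim!: min_gens_cases)
qed

text \<open>Exchanging \<open>j\<close> out of the complement of \<open>{i, k}\<close> against the
  complement of some \<open>{j, l}\<close> brings in \<open>i\<close> or \<open>k\<close>; the new
  basis is the complement of \<open>{j, k}\<close> or of \<open>{i, j}\<close>, and neither is
  one.\<close>

lemma parallel_trans:
  assumes "\<not> cobase J i j" "\<not> cobase J j k"
  shows "\<not> cobase J i k"
proof
  assume ik: "cobase J i k"
  obtain l where jl: "cobase J j l"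
    using ex_cobase by blast
  have j: "j \<noteq> i" "j \<noteq> k"
    using ik assms by auto
  have "\<exists>m. lk (ind (- {i, k})) m < lk (ind (- {j, l})) m \<and>
    Poly_Mapping.single m 1 + (ind (- {i, k}) - Poly_Mapping.single j 1) \<in> min_gens J"
  proof -
    have "\<forall>u\<in>min_gens J. \<forall>v\<in>min_gens J. \<forall>i. lk v i < lk u i \<longrightarrow>
      (\<exists>j. lk u j < lk v j \<and> Poly_Mapping.single j 1 + (u - Poly_Mapping.single i 1) \<in> min_gens J)"
      using matroidal unfolding matroidal_def polymatroidal_def by blast
    moreover have "ind (- {i, k}) \<in> min_gens J" "ind (- {j, l}) \<in> min_gens J"
      using ik jl by (simp_all add: cobase_def)
    moreover have "lk (ind (- {j, l})) j < lk (ind (- {i, k})) j"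
      using j by (simp add: lookup_ind)
    ultimately show ?thesis
      by blast
  qed
  then obtain m where m: "m \<in> {i, k}"
    and "Poly_Mapping.single m 1 + (ind (- {i, k}) - Poly_Mapping.single j 1) \<in> min_gens J"
    by (auto simp: lookup_ind split: if_splits)
  then have gen: "ind (insert m (- {i, k} - {j})) \<in> min_gens J"
    using j by (subst (asm) exchange_ind) auto
  from m show False
  proof (elim insertE emptyE)
    assume "m = i"
    moreover from this have "insert m (- {i, k} - {j}) = - {j, k}"
      using j ik by (auto simp: cobase_def)
    ultimately show False
      using gen assms(2) j by (simp add: cobase_def)
  next
    assume "m = k"
    moreover from this have "insert m (- {i, k} - {j}) = - {i, j}"
      using j ik by (auto simp: cobase_def)
    ultimately show False
      using gen assms(1) j by (simp add: cobase_def)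
  qed
qed

text \<open>If no two variables are parallel, every \<open>C\<close> with at most one element
  qualifies. A singleton is then chosen, so that the four forms of \<open>J\<close> correspond to
  \<open>card C = 1, 2, 3, 4\<close>.\<close>

definition single_class :: "'v set \<Rightarrow> bool"
  where "single_class C \<longleftrightarrow> (\<forall>i j. cobase J i j \<longleftrightarrow> i \<noteq> j \<and> \<not> (i \<in> C \<and> j \<in> C))"

lemma single_class_or_two_classes:
  obtains C where "single_class C" "C \<noteq> {}"
  | a b c d where "distinct [a, b, c, d]" "\<not> cobase J a b" "\<not> cobase J c d" "cobase J a c"
proof (cases "\<exists>a b. a \<noteq> b \<and> \<not> cobase J a b")
  case True
  then obtain a b where ab: "a \<noteq> b" "\<not> cobase J a b"
    by blast
  \<comment> \<open>The parallel class of \<open>a\<close>. If it does not account for all parallel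
    pairs, another pair \<open>c\<close>, \<open>d\<close> lies in a different class.\<close>
  define C where "C = {x. \<not> cobase J a x}"
  show thesis
  proof (cases "single_class C")
    case True
    then show thesis
      using that(1) cobase_irrefl by (auto simp: C_def)
  next
    case False
    then obtain c d where cd: "\<not> (cobase J c d \<longleftrightarrow> c \<noteq> d \<and> \<not> (c \<in> C \<and> d \<in> C))"
      by (auto simp: single_class_def)
    have "\<not> cobase J c d" if "c \<in> C" "d \<in> C"
      using that parallel_trans[of c a d] cobase_sym by (auto simp: C_def)
    then have cd: "\<not> cobase J c d" "c \<noteq> d" "c \<notin> C \<or> d \<notin> C"
      using cd cobase_irrefl by auto
    then have out: "cobase J a c" "cobase J a d"
      using parallel_trans[of a c d] parallel_trans[of a d c] cobase_sym by (auto simp: C_def)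
    then have "distinct [a, b, c, d]"
      using ab cd cobase_irrefl by auto
    then show thesis
      using that(2) ab cd out by blast
  qed
next
  case False
  then have "single_class {undefined}"
    using cobase_irrefl by (auto simp: single_class_def)
  then show thesis
    using that(1) by blast
qed

lemma not_SCM_if_two_classes:
  assumes "distinct [a, b, c, d]" "\<not> cobase J a b" "\<not> cobase J c d" "cobase J a c"
  shows "\<not> SCM J"
proof
  assume "SCM J"
  have "card {a, b, c, d} = 4"
    using assms(1) by simp
  then have "card (- {a, b, c, d}) = 2"
    using card_add_card_Compl[of "{a, b, c, d}"] six by simp
  then obtain e f where ef: "- {a, b, c, d} = {e, f}" "e \<noteq> f"
    by (auto simp: card_2_iff)
  have J_le: "J \<subseteq> vars_prime {x, y}" if "x \<noteq> y" "\<not> cobase J x y" for x y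
  proof -
    have "\<not> {x, y} \<subseteq> D" if "cobase J i j" "D \<subseteq> {i, j}" for i j D
    proof
      assume "{x, y} \<subseteq> D"
      then have "x = i \<and> y = j \<or> x = j \<and> y = i"
        using that \<open>x \<noteq> y\<close> by auto
      then show False
        using that(1) \<open>\<not> cobase J x y\<close> cobase_sym by auto
    qed
    then show ?thesis
      by (subst J_eq_zideal) (auto simp: vars_prime_eq_zideal zideal_subset_iff)
  qed
  have card4: "card (- {x, y}) = Suc 3" if "x \<noteq> y" for x y :: 'v
    using that card_add_card_Compl[of "{x, y}"] six by simp
  \<comment> \<open>A monomial in at least five variables omits at most one, and each variable
    belongs to a cobase; so the dimension is at most \<open>4\<close>.\<close>
  have "keyideal (large_support (Suc 3)) \<subseteq> J"
  proof (subst J_eq_zideal, unfold zideal_def, rule keyideal_mono, rule subsetI)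
    fix k :: "'v monomial" assume "k \<in> large_support (Suc 3)"
    then have "card (zero_set k) \<le> Suc 0"
      using card_add_card_Compl[of "zero_set k"] six by (simp add: large_support_def)
    then obtain i where "zero_set k \<subseteq> {i}"
      using card_le_Suc0_iff_eq[of "zero_set k"] by (cases "zero_set k = {}") auto
    then show "k \<in> {k. zero_set k \<in> {D. \<exists>i j. cobase J i j \<and> D \<subseteq> {i, j}}}"
      using ex_cobase[of i] by blast
  qed
  then obtain Q rs where Q: "graded_ideal Q" "J \<subseteq> Q" "weakly_regular rs UNIV Q"
    "set rs \<subseteq> max_graded_ideal" "Suc 3 \<le> length rs"
    "\<And>D. J \<subseteq> vars_prime D \<Longrightarrow> card (- D) = Suc 3 \<Longrightarrow> Q \<subseteq> vars_prime D"
    using SCM_top_quotient[OF \<open>SCM J\<close>, of 3 "{a, b}"] J_le[of a b] card4[of a b] assms by auto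
  have cross: "cobase J i j" if "i \<in> {a, b}" "j \<in> {c, d}" for i j
  proof -
    have "cobase J a j"
      using that(2) assms(3,4) parallel_trans[of a d c] cobase_sym by auto
    then show ?thesis
      using that(1) assms(2) parallel_trans[of a b j] by auto
  qed
  have cover: "set [e, f, a, b, c, d] = UNIV"
    using ef(1) by auto
  have dist: "distinct [e, f, a, b, c, d]"
    using ef assms(1) by auto
  show False
  proof (rule depth_obstruction[OF Q(1,3,4) _ dist cover])
    show "Q \<subseteq> vars_prime {a, b}" "Q \<subseteq> vars_prime {c, d}"
      using Q(6) J_le card4 assms by auto
    fix i j assume ij: "i \<in> {a, b}" "j \<in> {c, d}"
    \<comment> \<open>The partners of \<open>i\<close> and \<open>j\<close> in their pairs form a
      cobase, whose complement is \<open>{e, f, i, j}\<close>.\<close>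
    define i' where "i' = (if i = a then b else a)"
    define j' where "j' = (if j = c then d else c)"
    have "cobase J i' j'"
      by (rule cross) (auto simp: i'_def j'_def)
    then have "mon (ind (- {i', j'})) \<in> J"
      by (subst J_eq_zideal) (auto simp: mon_in_zideal_iff zero_set_ind)
    moreover have "- {i', j'} = {e, f, i, j}"
      using ij cover dist by (auto simp: i'_def j'_def)
    ultimately show "mon (ind {e, f, i, j}) \<in> Q"
      using Q(2) by auto
  qed (use Q(5) in simp)
qed

text \<open>If at most one variable \<open>z\<close> were outside \<open>C\<close>, every cobase
  would contain \<open>z\<close>.\<close>

lemma single_class_card:
  assumes "single_class C"
  shows "card C \<le> 4"
proof (rule ccontr)
  assume "\<not> card C \<le> 4"
  then have "card (- C) \<le> Suc 0"
    using card_add_card_Compl[of C] six by simp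
  then obtain z where "- C \<subseteq> {z}"
    using card_le_Suc0_iff_eq[of "- C"] by (cases "- C = {}") auto
  then show False
    using ex_cobase_avoiding[of z] assms by (auto simp: single_class_def)
qed

lemma J_eq_if_single_class:
  assumes "single_class C"
  shows "J = zideal {D. card D \<le> 2 \<and> card (D \<inter> C) \<le> 1}"
proof -
  have "(\<exists>i j. cobase J i j \<and> D \<subseteq> {i, j}) \<longleftrightarrow> card D \<le> 2 \<and> card (D \<inter> C) \<le> 1" for D
  proof
    assume "\<exists>i j. cobase J i j \<and> D \<subseteq> {i, j}"
    then obtain i j where ij: "i \<noteq> j" "\<not> (i \<in> C \<and> j \<in> C)" "D \<subseteq> {i, j}"
      using assms by (auto simp: single_class_def)
    then have "card D \<le> card {i, j}"
      by (intro card_mono) auto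
    moreover have "D \<inter> C \<subseteq> {i} \<or> D \<inter> C \<subseteq> {j}"
      using ij by auto
    then have "card (D \<inter> C) \<le> card {i}"
      by (metis card_mono finite.intros card_insert_disjoint empty_iff card.empty)
    ultimately show "card D \<le> 2 \<and> card (D \<inter> C) \<le> 1"
      using ij(1) by simp
  next
    assume D: "card D \<le> 2 \<and> card (D \<inter> C) \<le> 1"
    show "\<exists>i j. cobase J i j \<and> D \<subseteq> {i, j}"
    proof (cases "card D = 2")
      case True
      then obtain i j where ij: "D = {i, j}" "i \<noteq> j"
        by (auto simp: card_2_iff)
      have "\<not> (i \<in> C \<and> j \<in> C)"
      proof
        assume "i \<in> C \<and> j \<in> C"
        then have "D \<inter> C = D"
          using ij by auto
        then show False
          using D True by simp
      qed
      then show ?thesis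
        using ij assms by (auto simp: single_class_def)
    next
      case False
      then have "card D \<le> Suc 0"
        using D by simp
      then obtain i where "D \<subseteq> {i}"
        using card_le_Suc0_iff_eq[of D] by (cases "D = {}") auto
      then show ?thesis
        using ex_cobase[of i] by blast
    qed
  qed
  then show ?thesis
    by (subst J_eq_zideal) simp
qed

lemma SCM_if_single_class:
  assumes "single_class C"
  shows "SCM J"
proof -
  let ?D = "{D. card D \<le> 2 \<and> card (D \<inter> C) \<le> 1}"
  let ?E = "{D. card (D \<inter> C) \<le> 1}"
  have mono: "card (T \<inter> C) \<le> card (S \<inter> C)" "card T \<le> card S" if "T \<subseteq> S" for S T
    using that by (auto intro: card_mono)
  have down: "down_closed ?D" "down_closed ?E"
    by (auto simp: down_closed_def intro: le_trans[OF mono(1)] le_trans[OF mono(2)])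
  have split: "card (D \<inter> C) + card (D \<inter> - C) = card D" for D
  proof -
    have "D \<inter> C \<union> D \<inter> - C = D"
      by blast
    then show ?thesis
      using card_Un_disjoint[of "D \<inter> C" "D \<inter> - C"] by fastforce
  qed
  show ?thesis
  proof (cases "card C \<le> 1")
    case True
    have "card (D \<inter> C) \<le> 1" for D
      using True card_mono[of C "D \<inter> C"] by simp
    \<comment> \<open>Here every pair is a cobase, and the sets outside \<open>?D\<close> are those
      with three or more variables: the quotient is unmixed of dimension \<open>3\<close>.\<close>
    then have "- ?D = {D. {} \<subseteq> D \<and> D \<subseteq> UNIV \<and> 3 \<le> card (D \<inter> UNIV)}"
      by auto
    also have "clean 3 \<dots>"
      using six by (intro clean_at_least) auto
    finally have "clean 3 (- ?D)" .
    moreover have "UNIV \<notin> ?D"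
      using six by simp
    then have "?D \<noteq> UNIV"
      by blast
    ultimately have "SCM (zideal ?D :: ('v, 'k) mpoly set)"
      by (rule SCM_zideal_unmixed[OF down(1)])
    then show ?thesis
      using J_eq_if_single_class[OF assms] by simp
  next
    case False
    have "clean 4 {D. {} \<subseteq> D \<and> D \<subseteq> UNIV \<and> 2 \<le> card (D \<inter> C)}"
      using six by (intro clean_at_least) auto
    also have "{D. {} \<subseteq> D \<and> D \<subseteq> UNIV \<and> 2 \<le> card (D \<inter> C)} = - ?E"
      by auto
    finally have clean_top: "clean 4 (- ?E)" .
    \<comment> \<open>A set in \<open>?E\<close> but not in \<open>?D\<close> has at least three
      elements and at most one in \<open>C\<close>: either none in \<open>C\<close> and three or
      more outside, or one in \<open>C\<close> and two or more outside. Both kinds give factors of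
      dimension \<open>3\<close>.\<close>
    define \<S> where "\<S> p q = {D. {} \<subseteq> D \<and> D \<subseteq> UNIV \<and> card (D \<inter> C) = p \<and> q \<le> card (D \<inter> - C)}" for p q
    have clean_\<S>: "clean 3 (\<S> p q)" if "p + q = 3" for p q
      unfolding \<S>_def
    proof (rule clean_exact)
      fix A' X' :: "'v set"
      assume "A' \<subseteq> {} \<union> C" "A' \<subseteq> X'" "UNIV - C \<subseteq> X'" "card A' = card {} + p"
      then show "clean 3 {D. A' \<subseteq> D \<and> D \<subseteq> X' \<and> q \<le> card (D \<inter> - C)}"
        using that six by (intro clean_at_least) auto
    qed auto
    have "clean 3 (\<S> 0 3 \<union> \<S> 1 2)"
    proof (rule clean.union)
      fix S T assume "S \<in> \<S> 0 3" "T \<in> \<S> 1 2"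
      then show "\<not> T \<subseteq> S"
        using mono(1)[of T S] by (auto simp: \<S>_def)
    qed (auto intro: clean_\<S>)
    also have "\<S> 0 3 \<union> \<S> 1 2 = ?E - ?D"
    proof (rule set_eqI)
      fix D
      have "card (D \<inter> C) + card (D \<inter> - C) = card D"
        by (rule split)
      then show "D \<in> \<S> 0 3 \<union> \<S> 1 2 \<longleftrightarrow> D \<in> ?E - ?D"
        unfolding \<S>_def Un_iff Diff_iff mem_Collect_eq by (simp only: empty_subsetI subset_UNIV simp_thms) arith
    qed
    finally have clean_bottom: "clean 3 (?E - ?D)" .
    \<comment> \<open>One element of \<open>C\<close> together with all variables outside
      \<open>C\<close> witnesses \<open>?D \<subset> ?E\<close>; it has at least three elements
      because \<open>card C \<le> 4\<close>.\<close>
    obtain c where "c \<in> C"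
      using False by fastforce
    then have "insert c (- C) \<inter> C = {c}"
      by auto
    moreover have "card (insert c (- C)) = Suc (card (- C))"
      using \<open>c \<in> C\<close> by simp
    moreover have "2 \<le> card (- C)"
      using single_class_card[OF assms] card_add_card_Compl[of C] six by simp
    ultimately have "insert c (- C) \<in> ?E - ?D"
      by simp
    then have "?D \<subset> ?E"
      by auto
    moreover have "UNIV \<notin> ?E"
      using False by simp
    then have "?E \<noteq> UNIV"
      by blast
    ultimately have "SCM (zideal ?D :: ('v, 'k) mpoly set)"
      using down clean_top clean_bottom by (intro SCM_zideal_two_steps[of ?D ?E 3 4]) auto
    then show ?thesis
      using J_eq_if_single_class[OF assms] by simp
  qed
qed

end


section \<open>Ideals generated by squarefree monomials\<close>

abbreviation igen :: "'v::finite set set \<Rightarrow> ('v, 'k::field) mpoly set"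
  where "igen \<T> \<equiv> ideal_gen (mon ` ind ` \<T>)"

lemma igen_eq_zideal: "igen \<T> = zideal {D. \<exists>T\<in>\<T>. D \<subseteq> - T}"
  by (auto simp: ideal_gen_mon zideal_def up_def ind_divides_iff)

lemma mon_ind_in_igen_iff: "mon (ind T) \<in> (igen \<T> :: ('v::finite, 'k::field) mpoly set) \<longleftrightarrow> (\<exists>S\<in>\<T>. S \<subseteq> T)"
  by (simp add: igen_eq_zideal mon_in_zideal_iff zero_set_ind)

lemma igen_mono:
  assumes "\<forall>T\<in>\<T>. \<exists>S\<in>\<T>'. S \<subseteq> T"
  shows "igen \<T> \<subseteq> igen \<T>'"
  unfolding igen_eq_zideal
proof (intro zideal_mono subsetI)
  fix D assume "D \<in> {D. \<exists>T\<in>\<T>. D \<subseteq> - T}"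
  then obtain T where "T \<in> \<T>" "D \<subseteq> - T"
    by blast
  moreover obtain S where "S \<in> \<T>'" "S \<subseteq> T"
    using assms \<open>T \<in> \<T>\<close> by blast
  ultimately show "D \<in> {D. \<exists>T\<in>\<T>'. D \<subseteq> - T}"
    by blast
qed

lemma subset_Compl_insert_iff: "D \<subseteq> - insert x A \<longleftrightarrow> x \<notin> D \<and> D \<subseteq> - A"
  by blast

lemma times_igen:
  assumes "\<And>T. T \<in> \<T> \<Longrightarrow> A \<inter> T = {}"
  shows "mon (ind A) *o igen \<T> = igen ((\<union>) A ` \<T>)"
proof -
  have "(+) (ind A) ` ind ` \<T> = ind ` (\<union>) A ` \<T>"
    using assms by (auto simp: image_image ind_union intro!: image_cong)
  then show ?thesis
    by (simp add: times_ideal_gen_mon)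
qed

lemma plus_igen: "igen \<T> + igen \<T>' = igen (\<T> \<union> \<T>')"
  by (simp add: plus_ideal_gen_mon image_Un)

lemma min_gens_igen:
  assumes "\<And>T. T \<in> \<T> \<Longrightarrow> card T = d"
  shows "min_gens (igen \<T> :: ('v::finite, 'k::field) mpoly set) = ind ` \<T>"
  using assms by (intro min_gens_eq antichain_same_degree[of _ d]) (auto simp: mdeg_ind)

lemma card_Int_insert: "card (D \<inter> insert x A) = (if x \<in> D \<and> x \<notin> A then Suc (card (D \<inter> A)) else card (D \<inter> A))"
  for A :: "'v::finite set"
  by (auto simp: Int_insert_right insert_absorb)

lemma SCM_uniform_pairs:
  fixes a b c :: "'v::{finite, linorder}"
  assumes "distinct [a, b, c]"
  shows "SCM (igen {{a, b}, {a, c}, {b, c}} :: ('v, 'k::field) mpoly set)"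
proof -
  let ?D = "{D. \<exists>T\<in>{{a, b}, {a, c}, {b, c}}. D \<subseteq> - T}"
  have D: "?D = {D. card (D \<inter> {a, b, c}) \<le> 1}"
    using assms by (auto simp: card_Int_insert)
  have "card {a, b, c} \<le> CARD('v)"
    by (intro card_mono) auto
  then have "clean (CARD('v) - 2) {D. {} \<subseteq> D \<and> D \<subseteq> UNIV \<and> 2 \<le> card (D \<inter> {a, b, c})}"
    using assms by (intro clean_at_least) auto
  also have "{D. {} \<subseteq> D \<and> D \<subseteq> UNIV \<and> 2 \<le> card (D \<inter> {a, b, c})} = - ?D"
    unfolding D by auto
  finally have "clean (CARD('v) - 2) (- ?D)" .
  then show ?thesis
    unfolding igen_eq_zideal by (rule SCM_zideal_unmixed[rotated]) (auto simp: down_closed_def)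
qed

text \<open>The ideal is \<open>(a) \<inter> (b, c)\<close>, which is not unmixed. With
  \<open>(a)\<close>, encoded by \<open>?E\<close>, in between, the lower factor is isomorphic to
  the ring modulo \<open>(b, c)\<close> and the upper one is the ring modulo \<open>(a)\<close>, of
  one dimension more.\<close>

lemma SCM_product_pairs:
  fixes a b c :: "'v::{finite, linorder}"
  assumes "distinct [a, b, c]"
  shows "SCM (igen {{a, b}, {a, c}} :: ('v, 'k::field) mpoly set)"
proof -
  let ?D = "{D. \<exists>T\<in>{{a, b}, {a, c}}. D \<subseteq> - T}"
  let ?E = "{D. a \<notin> D}"
  have "card {a, b, c} \<le> CARD('v)"
    by (intro card_mono) auto
  then have card: "3 \<le> CARD('v)"
    using assms by simp
  have "clean (CARD('v) - 2) {D. {b, c} \<subseteq> D \<and> D \<subseteq> - {a}}"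
    using assms card by (intro clean_interval) auto
  also have "{D. {b, c} \<subseteq> D \<and> D \<subseteq> - {a}} = ?E - ?D"
    by (intro set_eqI) (simp add: subset_Compl_insert_iff, blast)
  finally have bottom: "clean (CARD('v) - 2) (?E - ?D)" .
  have "clean (CARD('v) - 1) {D. {a} \<subseteq> D \<and> D \<subseteq> UNIV}"
    using card by (intro clean_interval) auto
  also have "{D. {a} \<subseteq> D \<and> D \<subseteq> UNIV} = - ?E"
    by auto
  finally have top: "clean (CARD('v) - 1) (- ?E)" .
  have "{b, c} \<in> ?E" "{b, c} \<notin> ?D"
    using assms by auto
  moreover have "?D \<subseteq> ?E"
    by (auto simp: subset_Compl_insert_iff)
  ultimately have "?D \<subset> ?E"
    by blast
  have "down_closed ?D" "down_closed ?E"
    unfolding down_closed_def by blast+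
  moreover have "{a} \<notin> ?E"
    by simp
  then have "?E \<noteq> UNIV"
    by blast
  moreover have "CARD('v) - 2 < CARD('v) - 1"
    using card by simp
  ultimately show ?thesis
    unfolding igen_eq_zideal using bottom top \<open>?D \<subset> ?E\<close> by (intro SCM_zideal_two_steps)
qed

lemma matroidal_igen_pairs:
  fixes a b c :: "'v::{finite, linorder}"
  assumes "distinct [a, b, c]" "\<T> \<subseteq> {{a, b}, {a, c}, {b, c}}"
  shows "matroidal (igen \<T> :: ('v, 'k::field) mpoly set)"
    "generated_in_degree 2 (igen \<T> :: ('v, 'k) mpoly set)"
    "min_gens (igen \<T> :: ('v, 'k) mpoly set) = ind ` \<T>"
proof -
  have "card T = 2" if "T \<in> \<T>" for T
    using that assms by auto
  then show gens: "min_gens (igen \<T> :: ('v, 'k) mpoly set) = ind ` \<T>"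
    by (rule min_gens_igen)
  show degree: "generated_in_degree 2 (igen \<T> :: ('v, 'k) mpoly set)"
    using \<open>\<And>T. T \<in> \<T> \<Longrightarrow> card T = 2\<close> by (simp add: generated_in_degree_def gens mdeg_ind)
  have exchange: "\<exists>j. lk (ind S) j < lk (ind T) j \<and>
      Poly_Mapping.single j 1 + (ind S - Poly_Mapping.single i 1) \<in> ind ` \<T>"
    if ST: "S \<in> \<T>" "T \<in> \<T>" and "lk (ind T) i < lk (ind S) i" for S T i
  proof -
    have i: "i \<in> S" "i \<notin> T"
      using that(3) by (auto simp: lookup_ind split: if_splits)
    have "S \<in> {{a, b}, {a, c}, {b, c}}" "T \<in> {{a, b}, {a, c}, {b, c}}"
      by (rule subsetD[OF assms(2)], rule ST)+
    then have "\<exists>j. j \<in> T \<and> j \<notin> S \<and> insert j (S - {i}) = T"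
      using i assms(1) by (elim insertE emptyE) auto
    then obtain j where j: "j \<in> T" "j \<notin> S" "insert j (S - {i}) = T"
      by blast
    have "Poly_Mapping.single j 1 + (ind S - Poly_Mapping.single i 1) = ind T"
      using exchange_ind[OF i(1) j(2)] j(3) by simp
    then show ?thesis
      using j ST by (intro exI[of _ j]) (simp add: lookup_ind)
  qed
  have "monomial_ideal (igen \<T> :: ('v, 'k) mpoly set)"
    by (rule monomial_ideal_gen)
  moreover have "\<exists>d. generated_in_degree d (igen \<T> :: ('v, 'k) mpoly set)"
    using degree by blast
  ultimately have "polymatroidal (igen \<T> :: ('v, 'k) mpoly set)"
    unfolding polymatroidal_def gens using exchange by blast
  then show "matroidal (igen \<T> :: ('v, 'k) mpoly set)"
    unfolding matroidal_def gens by (auto simp: lookup_ind)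
qed

text \<open>A gcd without \<open>x\<close> means that some generator avoids \<open>x\<close>; being
  squarefree of degree two in three variables, it is the product of the other two.\<close>

lemma pair_in_min_gens:
  fixes I :: "('v::finite, 'k::field) mpoly set"
  assumes "matroidal I" "generated_in_degree 2 I" "ideal_supp I = S" "card S = 3"
    and "ideal_gcd I = mon g" "lk g x = 0" "x \<in> S"
  shows "mon (ind (S - {x})) \<in> I"
proof -
  have "min_gens I \<noteq> {}"
    using assms(3,7) by (auto simp: ideal_supp_eq)
  then obtain u where u: "u \<in> min_gens I" "lk u x = 0"
    using ideal_gcd_spec[OF _ assms(5)] assms(6) by metis
  have u_ind: "u = ind (- zero_set u)"
    using assms(1) u(1) by (intro squarefree_eq_ind) (simp add: matroidal_def)
  have "- zero_set u \<subseteq> S - {x}"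
    using u assms(3) by (auto simp: ideal_supp_eq zero_set_def)
  moreover have "card (- zero_set u) = 2"
    using assms(2) u(1) mdeg_ind[of "- zero_set u"] u_ind by (simp add: generated_in_degree_def)
  ultimately have "- zero_set u = S - {x}"
    using assms(4,7) by (intro card_subset_eq) auto
  then have "u = ind (S - {x})"
    using u_ind by simp
  moreover have "mon u \<in> ideal_gen (mon ` min_gens I)"
    using u(1) ideal_gen_superset by blast
  moreover have "ideal_gen (mon ` min_gens I) = I"
    using assms(1) monomial_ideal_min_gens(1)[of I] by (simp add: matroidal_def polymatroidal_def)
  ultimately show ?thesis
    by metis
qed


section \<open>The decomposition\<close>

lemma distinct_sixD:
  assumes "distinct [p1, p2, p3, p4, p5, p6]"
  shows "p1 \<noteq> p2" "p1 \<noteq> p3" "p1 \<noteq> p4" "p1 \<noteq> p5" "p1 \<noteq> p6" "p2 \<noteq> p3" "p2 \<noteq> p4" "p2 \<noteq> p5" "p2 \<noteq> p6"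
    "p3 \<noteq> p4" "p3 \<noteq> p5" "p3 \<noteq> p6" "p4 \<noteq> p5" "p4 \<noteq> p6" "p5 \<noteq> p6"
  using assms by simp_all

text \<open>Decides which bases are covered by the first four summands; those whose complement is
  inside \<open>{p1, p2, p3}\<close> are left for \<open>J4\<close>. For the smaller
  \<open>\<T>\<close>, pairs such as \<open>{p1, p4}\<close> have to be excluded, since their
  complement would call for \<open>{p5, p6}\<close>.\<close>

lemma pair_residual_iff:
  assumes "distinct [p1, p2, p3, p4, p5, p6]" "i \<in> {p1, p2, p3, p4, p5, p6}" "j \<in> {p1, p2, p3, p4, p5, p6}" "i \<noteq> j"
    and "\<T> = {{p4, p5}, {p4, p6}, {p5, p6}} \<or>
      \<T> = {{p4, p5}, {p4, p6}} \<and> \<not> (i \<in> {p1, p2, p3, p4} \<and> j \<in> {p1, p2, p3, p4})"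
  shows "(\<exists>S \<in> (\<union>) {p1, p2, p3} ` {{p4}, {p5}, {p6}} \<union> (\<union>) {p1, p2} ` \<T> \<union>
      (\<union>) {p1, p3} ` \<T> \<union> (\<union>) {p2, p3} ` \<T>. S \<subseteq> - {i, j}) \<longleftrightarrow> \<not> (i \<in> {p1, p2, p3} \<and> j \<in> {p1, p2, p3})"
proof -
  note ne = distinct_sixD[OF assms(1)]
  note ne = ne ne[THEN not_sym]
  have i: "i = p1 \<or> i = p2 \<or> i = p3 \<or> i = p4 \<or> i = p5 \<or> i = p6" 
   and j: "j = p1 \<or> j = p2 \<or> j = p3 \<or> j = p4 \<or> j = p5 \<or> j = p6"
    using assms(2,3) by simp_all
  show ?thesis 
    using assms(5)
  proof (elim disjE conjE)
    assume T: "\<T> = {{p4, p5}, {p4, p6}, {p5, p6}}"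
    show ?thesis
      using i j assms(4) unfolding T
      by (elim disjE) (simp_all add: ne)
  next
    assume T: "\<T> = {{p4, p5}, {p4, p6}}" and "\<not> (i \<in> {p1, p2, p3, p4} \<and> j \<in> {p1, p2, p3, p4})"
    then show ?thesis
      using i j assms(4) unfolding T
      by (elim disjE) (simp_all add: ne)
  qed
qed

text \<open>Read off from the two omitted variables: a generator of the first summand omits two of
  \<open>p4, p5, p6\<close>, one of the other summands omits one of \<open>p1, p2, p3\<close> and
  one of \<open>p4, p5, p6\<close>. These pairs avoid \<open>C\<close> in at least one
  element.\<close>

lemma generators_are_bases:
  assumes "distinct [p1, p2, p3, p4, p5, p6]" "UNIV = {p1, p2, p3, p4, p5, p6}"
    and "\<T> = {{p4, p5}, {p4, p6}, {p5, p6}} \<and> C \<subseteq> {p1, p2, p3} \<or>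
      \<T> = {{p4, p5}, {p4, p6}} \<and> C \<subseteq> {p1, p2, p3, p4}"
    and "S \<in> (\<union>) {p1, p2, p3} ` {{p4}, {p5}, {p6}} \<union> (\<union>) {p1, p2} ` \<T> \<union>
      (\<union>) {p1, p3} ` \<T> \<union> (\<union>) {p2, p3} ` \<T>"
  shows "\<exists>i j. i \<noteq> j \<and> \<not> (i \<in> C \<and> j \<in> C) \<and> - {i, j} \<subseteq> S"
proof -
  have cover: "- {i, j} \<subseteq> S \<longleftrightarrow> {p1, p2, p3, p4, p5, p6} \<subseteq> {i, j} \<union> S" for i j
    using assms(2) by blast
  note ne = distinct_sixD[OF assms(1)]
  note ne = ne ne[THEN not_sym]
  have witness: ?thesis if "i \<noteq> j" "i \<notin> C \<or> j \<notin> C" "{p1, p2, p3, p4, p5, p6} \<subseteq> {i, j} \<union> S" for i j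
  proof -
    have "- {i, j} \<subseteq> S"
      using that(3) cover by metis
    then show ?thesis
      using that(1,2) by blast
  qed
  have C: "p5 \<notin> C" "p6 \<notin> C"
    using assms(3) ne by auto
  have T_C: "\<T> = {{p4, p5}, {p4, p6}} \<or> p4 \<notin> C \<and> \<T> = {{p4, p5}, {p4, p6}, {p5, p6}}"
    using assms(3) ne by auto
  have outer: ?thesis if "S \<in> (\<union>) {p1, p2, p3} ` {{p4}, {p5}, {p6}}"
    using that witness[of p5 p6] witness[of p4 p6] witness[of p4 p5] C
    by (elim imageE insertE emptyE) (simp_all add: ne)
  have inner: ?thesis if "S \<in> (\<union>) {p1, p2} ` U \<union> (\<union>) {p1, p3} ` U \<union> (\<union>) {p2, p3} ` U"
    "U = {{p4, p5}, {p4, p6}}" for U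
    using that(1) unfolding that(2)
    using witness[of p3 p6] witness[of p3 p5] witness[of p2 p6] witness[of p2 p5] witness[of p1 p6]
      witness[of p1 p5] C
    by (elim UnE imageE insertE emptyE) (simp_all add: ne)
  have extra: ?thesis if "S \<in> (\<union>) {p1, p2} ` {{p5, p6}} \<union> (\<union>) {p1, p3} ` {{p5, p6}} \<union> (\<union>) {p2, p3} ` {{p5, p6}}"
    "p4 \<notin> C"
    using that witness[of p3 p4] witness[of p2 p4] witness[of p1 p4]
    by (elim UnE imageE insertE emptyE) (simp_all add: ne)
  consider "S \<in> (\<union>) {p1, p2, p3} ` {{p4}, {p5}, {p6}}"
    | "S \<in> (\<union>) {p1, p2} ` \<T> \<union> (\<union>) {p1, p3} ` \<T> \<union> (\<union>) {p2, p3} ` \<T>"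
    using assms(4) by (elim UnE) simp_all
  then show ?thesis
  proof cases
    case 2
    from T_C show ?thesis
    proof (elim disjE conjE)
      assume "p4 \<notin> C" and T: "\<T> = {{p4, p5}, {p4, p6}, {p5, p6}}"
      \<comment> \<open>A product with \<open>{p5, p6}\<close> omits \<open>p4\<close> and one of
        \<open>p1, p2, p3\<close>, so it needs \<open>p4 \<notin> C\<close>; the other products do
        not, hence the split.\<close>
      define U V where "U = {{p4, p5}, {p4, p6}}" "V = {{p5, p6}}"
      have "\<T> = U \<union> V"
        unfolding T U_V_def by blast
      then have "S \<in> ((\<union>) {p1, p2} ` U \<union> (\<union>) {p1, p2} ` V) \<union> ((\<union>) {p1, p3} ` U \<union> (\<union>) {p1, p3} ` V) \<union>
          ((\<union>) {p2, p3} ` U \<union> (\<union>) {p2, p3} ` V)"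
        using 2 by (simp only: image_Un)
      then consider "S \<in> (\<union>) {p1, p2} ` U \<union> (\<union>) {p1, p3} ` U \<union> (\<union>) {p2, p3} ` U"
        | "S \<in> (\<union>) {p1, p2} ` V \<union> (\<union>) {p1, p3} ` V \<union> (\<union>) {p2, p3} ` V"
        unfolding Un_iff by argo
      then show ?thesis
        using inner[OF _ U_V_def(1)] extra[folded U_V_def(2)] \<open>p4 \<notin> C\<close> by cases
    qed (use 2 inner in simp)
  qed (rule outer)
qed

lemma mon_ind_in_times:
  fixes X :: "('v::finite, 'k::field) mpoly set"
  assumes "mon (ind T) \<in> mon (ind A) *o X"
  shows "A \<subseteq> T"
proof -
  have "mon (ind A) dvd (mon (ind T) :: ('v, 'k) mpoly)"
    using assms by (auto simp: elt_set_times_def)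
  then show ?thesis
    by (simp add: mon_dvd_mon_iff ind_divides_ind_iff)
qed

context rank_four_matroid
begin

lemma SCM_iff_single_class: "SCM J \<longleftrightarrow> (\<exists>C. single_class C \<and> C \<noteq> {})"
proof
  assume "SCM J"
  then show "\<exists>C. single_class C \<and> C \<noteq> {}"
    using single_class_or_two_classes not_SCM_if_two_classes by metis
qed (use SCM_if_single_class in blast)

lemma cobase_if_product_in_J:
  assumes "mon (ind A) *o I \<subseteq> J" "mon (ind B) \<in> I" "A \<inter> B = {}" "A \<union> B = - {i, j}" "i \<noteq> j"
  shows "cobase J i j"
proof -
  have "mon (ind A) * mon (ind B) \<in> J"
    using assms(1,2) by blast
  then show ?thesis
    using assms(3-5) by (intro cobase_if_mon_in_J) (simp_all add: mon_mult ind_union)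
qed

text \<open>The summands produce enough cobases to make \<open>p5\<close> and \<open>p6\<close>
  parallel to nothing else, and also \<open>p4\<close> if the gcds are one. Two nontrivial classes
  would then need four elements inside \<open>{p1, p2, p3}\<close>; in the other case
  \<open>p1, p2, p3\<close> are mutually parallel, and two classes inside
  \<open>{p1, p2, p3, p4}\<close> would merge.\<close>

lemma SCM_if_decomposition:
  fixes J1 J2 J3 :: "('v, 'k) mpoly set"
  assumes p: "distinct [p1, p2, p3, p4, p5, p6]" "UNIV = {p1, p2, p3, p4, p5, p6}"
    and S0: "mon (ind {p1, p2, p3}) *o igen {{p4}, {p5}, {p6}} \<subseteq> J"
    and S: "mon (ind {p1, p2}) *o J1 \<subseteq> J" "mon (ind {p1, p3}) *o J2 \<subseteq> J" "mon (ind {p2, p3}) *o J3 \<subseteq> J"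
    and I: "\<forall>I\<in>{J1, J2, J3}. matroidal I \<and> generated_in_degree 2 I \<and> ideal_supp I = {p4, p5, p6}"
    and gcd: "(\<forall>I\<in>{J1, J2, J3}. ideal_gcd I = 1) \<or> (\<forall>I\<in>{J1, J2, J3}. ideal_gcd I = Var p4) \<and>
      (\<forall>i\<in>{p1, p2, p3}. \<forall>j\<in>{p1, p2, p3}. \<not> cobase J i j)"
  shows "SCM J"
proof -
  note ne = distinct_sixD[OF p(1)]
  note ne = ne ne[THEN not_sym]
  have Compl_iff: "A = - {i, j} \<longleftrightarrow> {i, j} \<inter> A = {} \<and> {p1, p2, p3, p4, p5, p6} \<subseteq> {i, j} \<union> A" for A i j
    unfolding p(2)[symmetric] by auto
  have "mon (ind {x}) \<in> (igen {{p4}, {p5}, {p6}} :: ('v, 'k) mpoly set)" if "x \<in> {p4, p5, p6}" for x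
    unfolding mon_ind_in_igen_iff using that by auto
  then have upper: "cobase J p5 p6" "cobase J p4 p6" "cobase J p4 p5"
    using cobase_if_product_in_J[OF S0, of "{p4}" p5 p6] cobase_if_product_in_J[OF S0, of "{p5}" p4 p6]
      cobase_if_product_in_J[OF S0, of "{p6}" p4 p5]
    by (simp_all add: ne Compl_iff)
  have mixed: "cobase J p3 x \<and> cobase J p2 x \<and> cobase J p1 x"
    if x: "x \<in> {p4, p5, p6}" "(\<forall>I\<in>{J1, J2, J3}. ideal_gcd I = 1) \<or> x \<noteq> p4" for x
  proof -
    have "\<exists>g. ideal_gcd I = mon g \<and> lk g x = 0" if "I \<in> {J1, J2, J3}" for I
    proof (cases "ideal_gcd I = 1")
      case True
      then show ?thesis
        by (intro exI[of _ 0]) (simp add: mon_zero)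
    next
      case False
      then have "ideal_gcd I = mon (ind {p4})" "x \<noteq> p4"
        using gcd x(2) that by (auto simp: Var_eq_ind)
      then show ?thesis
        by (intro exI[of _ "ind {p4}"]) (simp add: lookup_ind)
    qed
    moreover have "card {p4, p5, p6} = 3"
      by (simp add: ne)
    ultimately have "mon (ind ({p4, p5, p6} - {x})) \<in> I" if "I \<in> {J1, J2, J3}" for I
      using pair_in_min_gens[of I "{p4, p5, p6}" _ x] that I x(1) by metis
    then have in_I: "mon (ind ({p4, p5, p6} - {x})) \<in> J1" "mon (ind ({p4, p5, p6} - {x})) \<in> J2"
      "mon (ind ({p4, p5, p6} - {x})) \<in> J3"
      by simp_all
    have x_ne: "x \<noteq> p1" "x \<noteq> p2" "x \<noteq> p3"
      using x(1) ne by auto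
    have "cobase J p3 x"
      by (rule cobase_if_product_in_J[OF S(1) in_I(1)]) (use x(1) x_ne in \<open>auto simp: ne Compl_iff\<close>)
    moreover have "cobase J p2 x"
      by (rule cobase_if_product_in_J[OF S(2) in_I(2)]) (use x(1) x_ne in \<open>auto simp: ne Compl_iff\<close>)
    moreover have "cobase J p1 x"
      by (rule cobase_if_product_in_J[OF S(3) in_I(3)]) (use x(1) x_ne in \<open>auto simp: ne Compl_iff\<close>)
    ultimately show ?thesis
      by blast
  qed
  have mixed56: "cobase J i x" if "i \<in> {p1, p2, p3}" "x \<in> {p5, p6}" for i x
    using mixed[of x] that ne by auto
  have cases6: "i \<in> {p1, p2, p3} \<or> i = p4 \<or> i = p5 \<or> i = p6" for i
    using p(2) by blast
  have parallel: "i \<in> {p1, p2, p3, p4}" if "\<not> cobase J i j" "i \<noteq> j" for i j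
  proof -
    have "cobase J p5 j" if "p5 \<noteq> j"
      using cases6[of j] that upper mixed56[of j p5] cobase_sym by auto
    moreover have "cobase J p6 j" if "p6 \<noteq> j"
      using cases6[of j] that upper mixed56[of j p6] cobase_sym by auto
    ultimately show ?thesis
      using cases6[of i] that by auto
  qed
  consider C where "single_class C"
    | a b c d where "distinct [a, b, c, d]" "\<not> cobase J a b" "\<not> cobase J c d" "cobase J a c"
    using single_class_or_two_classes by metis
  then show ?thesis
  proof cases
    case 1
    then show ?thesis
      by (rule SCM_if_single_class)
  next
    case 2
    then have four: "a \<in> {p1, p2, p3, p4}" "b \<in> {p1, p2, p3, p4}" "c \<in> {p1, p2, p3, p4}" "d \<in> {p1, p2, p3, p4}"
      using parallel[of a b] parallel[of b a] parallel[of c d] parallel[of d c] cobase_sym by auto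
    show ?thesis
    proof (cases "\<forall>I\<in>{J1, J2, J3}. ideal_gcd I = 1")
      case True
      have p4: "cobase J p4 j" if "j \<noteq> p4" for j
        using cases6[of j] that upper mixed[of p4] True cobase_sym by auto
      have "p4 \<notin> {a, b, c, d}"
        using p4[of a] p4[of b] p4[of c] p4[of d] 2 cobase_sym[of _ p4] by auto
      then have "{a, b, c, d} \<subseteq> {p1, p2, p3}"
        using four by auto
      then have "card {a, b, c, d} \<le> card {p1, p2, p3}"
        by (intro card_mono) auto
      then show ?thesis
        using 2 by (simp add: ne)
    next
      case False
      then have par: "\<not> cobase J i j" if "i \<in> {p1, p2, p3}" "j \<in> {p1, p2, p3}" for i j
        using gcd that by blast
      \<comment> \<open>At most one of the four elements is \<open>p4\<close>; the others are
        mutually parallel, which joins the two supposed classes.\<close>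
      have "\<not> cobase J a c"
      proof (cases "a = p4 \<or> c = p4")
        case True
        then show ?thesis
        proof
          assume "a = p4"
          then have "\<not> cobase J b c"
            using four 2 by (intro par) auto
          then show ?thesis
            using parallel_trans 2 by blast
        next
          assume "c = p4"
          then have "\<not> cobase J a d"
            using four 2 by (intro par) auto
          then show ?thesis
            using parallel_trans[of a d c] 2 cobase_sym by blast
        qed
      next
        case False
        then show ?thesis
          using four by (intro par) auto
      qed
      then show ?thesis
        using 2 by blast
    qed
  qed
qed

text \<open>All of \<open>J1\<close>, \<open>J2\<close>, \<open>J3\<close> can be the same ideal
  \<open>igen \<T>\<close>, whose shape depends only on whether \<open>p4\<close> belongs to
  \<open>C\<close>. The family \<open>\<F>\<close> collects the bases that the other summands miss;
  each contains \<open>p4\<close> and \<open>p5\<close>, so that \<open>igen \<F>\<close> lies in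
  \<open>igen \<T>\<close>.\<close>

lemma decomposition_if_single_class:
  assumes p: "distinct [p1, p2, p3, p4, p5, p6]" "UNIV = {p1, p2, p3, p4, p5, p6}"
    and C: "single_class C" "\<T> = {{p4, p5}, {p4, p6}, {p5, p6}} \<and> C \<subseteq> {p1, p2, p3} \<or>
      \<T> = {{p4, p5}, {p4, p6}} \<and> C = {p1, p2, p3, p4}"
  defines "S0 \<equiv> mon (ind {p1, p2, p3}) *o igen {{p4}, {p5}, {p6}} :: ('v, 'k) mpoly set"
    and "S1 \<equiv> mon (ind {p1, p2}) *o igen \<T> :: ('v, 'k) mpoly set"
    and "S2 \<equiv> mon (ind {p1, p3}) *o igen \<T> :: ('v, 'k) mpoly set"
    and "S3 \<equiv> mon (ind {p2, p3}) *o igen \<T> :: ('v, 'k) mpoly set"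
    and "\<F> \<equiv> {- {i, j} | i j. i \<in> {p1, p2, p3} \<and> j \<in> {p1, p2, p3} \<and> cobase J i j}"
  shows "{u \<in> min_gens J. mon u \<notin> S0 \<union> S1 \<union> S2 \<union> S3} = ind ` \<F>"
    "J = S0 + S1 + S2 + S3 + igen \<F>" "igen \<F> \<subseteq> (igen \<T> :: ('v, 'k) mpoly set)"
    "card (min_gens (igen \<F> :: ('v, 'k) mpoly set)) = card \<F>"
proof -
  note ne = distinct_sixD[OF p(1)]
  note ne = ne ne[THEN not_sym]
  let ?U = "(\<union>) {p1, p2, p3} ` {{p4}, {p5}, {p6}} \<union> (\<union>) {p1, p2} ` \<T> \<union>
      (\<union>) {p1, p3} ` \<T> \<union> (\<union>) {p2, p3} ` \<T>"
  have T_sub: "T \<subseteq> {p4, p5, p6}" if "T \<in> \<T>" for T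
    using C(2) that by auto
  have "S0 = igen ((\<union>) {p1, p2, p3} ` {{p4}, {p5}, {p6}})" "S1 = igen ((\<union>) {p1, p2} ` \<T>)"
    "S2 = igen ((\<union>) {p1, p3} ` \<T>)" "S3 = igen ((\<union>) {p2, p3} ` \<T>)"
    unfolding S0_def S1_def S2_def S3_def using T_sub ne by (intro times_igen; force)+
  then have S: "S0 + S1 + S2 + S3 = igen ?U"
    and mem: "mon (ind T) \<in> S0 \<union> S1 \<union> S2 \<union> S3 \<longleftrightarrow> (\<exists>R\<in>?U. R \<subseteq> T)" for T
    by (simp_all only: plus_igen mon_ind_in_igen_iff Un_iff bex_Un)
  have UNIV: "i \<in> {p1, p2, p3, p4, p5, p6}" for i
    using p(2) by blast
  have residual: "mon (ind (- {i, j})) \<in> S0 \<union> S1 \<union> S2 \<union> S3 \<longleftrightarrow> \<not> (i \<in> {p1, p2, p3} \<and> j \<in> {p1, p2, p3})"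
    if "cobase J i j" for i j
    unfolding mem
  proof (rule pair_residual_iff[OF p(1) UNIV UNIV])
    show "i \<noteq> j"
      using that by (simp add: cobase_def)
    show "\<T> = {{p4, p5}, {p4, p6}, {p5, p6}} \<or>
      \<T> = {{p4, p5}, {p4, p6}} \<and> \<not> (i \<in> {p1, p2, p3, p4} \<and> j \<in> {p1, p2, p3, p4})"
    proof -
      have "\<not> (i \<in> C \<and> j \<in> C)"
        using C(1) that by (simp add: single_class_def)
      then show ?thesis
        using C(2) by metis
    qed
  qed
  show F: "{u \<in> min_gens J. mon u \<notin> S0 \<union> S1 \<union> S2 \<union> S3} = ind ` \<F>"
  proof (intro set_eqI iffI)
    fix u assume u: "u \<in> {u \<in> min_gens J. mon u \<notin> S0 \<union> S1 \<union> S2 \<union> S3}"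
    then obtain i j where "cobase J i j" "u = ind (- {i, j})"
      using min_gens_cases by blast
    then show "u \<in> ind ` \<F>"
      using u residual unfolding \<F>_def by blast
  next
    fix u assume "u \<in> ind ` \<F>"
    then obtain i j where "cobase J i j" "u = ind (- {i, j})" "i \<in> {p1, p2, p3}" "j \<in> {p1, p2, p3}"
      unfolding \<F>_def by blast
    then show "u \<in> {u \<in> min_gens J. mon u \<notin> S0 \<union> S1 \<union> S2 \<union> S3}"
      using residual unfolding cobase_def by blast
  qed
  show "igen \<F> \<subseteq> (igen \<T> :: ('v, 'k) mpoly set)"
  proof (intro igen_mono ballI)
    fix T assume "T \<in> \<F>"
    then obtain i j where "T = - {i, j}" "i \<in> {p1, p2, p3}" "j \<in> {p1, p2, p3}"
      unfolding \<F>_def by blast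
    then have "{p4, p5} \<subseteq> T"
      using ne by auto
    then show "\<exists>S\<in>\<T>. S \<subseteq> T"
      using C(2) by blast
  qed
  show "J = S0 + S1 + S2 + S3 + igen \<F>"
  proof
    have "mon u \<in> igen (?U \<union> \<F>)" if "u \<in> min_gens J" for u
    proof (cases "mon u \<in> S0 \<union> S1 \<union> S2 \<union> S3")
      case True
      obtain i j where "u = ind (- {i, j})"
        using \<open>u \<in> min_gens J\<close> by (rule min_gens_cases)
      then obtain R where R: "R \<in> ?U" "R \<subseteq> - {i, j}"
        using True mem by metis
      show ?thesis
        unfolding \<open>u = ind (- {i, j})\<close> mon_ind_in_igen_iff by (rule bexI[of "\<lambda>S. S \<subseteq> - {i, j}", OF R(2) UnI1[OF R(1)]])
    next
      case False
      then have "u \<in> ind ` \<F>"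
        using that F by blast
      then show ?thesis
        by (auto simp: mon_ind_in_igen_iff simp del: image_insert)
    qed
    then have "ideal_gen (mon ` min_gens J) \<subseteq> igen (?U \<union> \<F>)"
      by (intro ideal_gen_minimal is_ideal_ideal_gen) blast
    then show "J \<subseteq> S0 + S1 + S2 + S3 + igen \<F>"
      unfolding S plus_igen using J_eq by (rule ord_eq_le_trans[rotated])
    have bases: "\<exists>i j. cobase J i j \<and> - T \<subseteq> {i, j}" if "T \<in> ?U \<union> \<F>" for T
    proof (cases "T \<in> ?U")
      case True
      then have "\<exists>i j. i \<noteq> j \<and> \<not> (i \<in> C \<and> j \<in> C) \<and> - {i, j} \<subseteq> T"
        using C(2) by (intro generators_are_bases[OF p]) auto
      then show ?thesis
        using C(1) unfolding single_class_def by blast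
    next
      case False
      then have "T \<in> \<F>"
        using that by (metis UnE)
      then obtain i j where "cobase J i j" "T = - {i, j}"
        unfolding \<F>_def by blast
      then show ?thesis
        by auto
    qed
    have "igen (?U \<union> \<F>) \<subseteq> J"
      unfolding igen_eq_zideal
    proof (subst J_eq_zideal, intro zideal_mono subsetI)
      fix D assume "D \<in> {D. \<exists>T\<in>?U \<union> \<F>. D \<subseteq> - T}"
      then obtain T where T: "T \<in> ?U \<union> \<F>" "D \<subseteq> - T"
        unfolding mem_Collect_eq by (elim bexE)
      obtain i j where "cobase J i j" "- T \<subseteq> {i, j}"
        using bases[OF T(1)] by (elim exE conjE)
      then show "D \<in> {D. \<exists>i j. cobase J i j \<and> D \<subseteq> {i, j}}"
        using order_trans[OF T(2)] by blast
    qed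
    then show "S0 + S1 + S2 + S3 + igen \<F> \<subseteq> J"
      unfolding S plus_igen .
  qed
  have "card T = 4" if T: "T \<in> \<F>" for T
  proof -
    obtain i j where "T = - {i, j}" "i \<noteq> j"
      using T unfolding \<F>_def cobase_def by blast
    then show ?thesis
      using card_add_card_Compl[of "{i, j}"] six by simp
  qed
  then have "min_gens (igen \<F> :: ('v, 'k) mpoly set) = ind ` \<F>"
    by (rule min_gens_igen)
  then show "card (min_gens (igen \<F> :: ('v, 'k) mpoly set)) = card \<F>"
    by (simp add: card_image inj_on_def ind_inject)
qed

end

lemma ex_enumeration:
  fixes C :: "'v::finite set"
  assumes "CARD('v) = n"
  shows "\<exists>y :: nat \<Rightarrow> 'v. bij_betw y {1..n} UNIV \<and> C = y ` {1..card C}"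
proof -
  have card: "card C \<le> n"
    using assms card_mono[of UNIV C] by simp
  obtain f where f: "bij_betw f {1..card C} C"
    using finite_same_card_bij[of "{1..card C}" C] by auto
  have "card {card C + 1..n} = card (- C)"
    using card_add_card_Compl[of C] assms by simp
  then obtain g where g: "bij_betw g {card C + 1..n} (- C)"
    using finite_same_card_bij[of "{card C + 1..n}" "- C"] by auto
  define y where "y i = (if i \<in> {1..card C} then f i else g i)" for i
  have yf: "bij_betw y {1..card C} C"
    using f by (subst bij_betw_cong[of _ y f]) (auto simp: y_def)
  have "bij_betw y {card C + 1..n} (- C)"
    using g by (subst bij_betw_cong[of _ y g]) (auto simp: y_def)
  with yf have "bij_betw y ({1..card C} \<union> {card C + 1..n}) (C \<union> - C)"
    by (rule bij_betw_combine) auto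
  moreover have "{1..card C} \<union> {card C + 1..n} = {1..n}"
    using card by auto
  ultimately show ?thesis
    using yf by (intro exI[of _ y]) (simp add: bij_betw_def)
qed

lemma six_enumeration:
  assumes "bij_betw y {1..6::nat} UNIV"
  shows "distinct [y 1, y 2, y 3, y 4, y 5, y 6]" "UNIV = {y 1, y 2, y 3, y 4, y 5, y 6}"
proof -
  have six: "{1..6::nat} = {1, 2, 3, 4, 5, 6}"
    by auto
  show "UNIV = {y 1, y 2, y 3, y 4, y 5, y 6}"
    using assms unfolding bij_betw_def six by simp
  show "distinct [y 1, y 2, y 3, y 4, y 5, y 6]"
    using assms unfolding bij_betw_def six by simp
qed

lemma ideal_gcd_uniform_pairs:
  fixes a b c :: "'v::{finite, linorder}"
  assumes "distinct [a, b, c]"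
  shows "ideal_gcd (igen {{a, b}, {a, c}, {b, c}} :: ('v, 'k::field) mpoly set) = 1"
proof -
  have "\<exists>T\<in>{{a, b}, {a, c}, {b, c}}. i \<notin> T" for i
    using assms by auto
  then have "ideal_gcd (igen {{a, b}, {a, c}, {b, c}} :: ('v, 'k) mpoly set) = mon 0"
    using matroidal_igen_pairs(3)[OF assms order_refl, where ?'k='k]
    by (intro ideal_gcd_eq) (auto simp: divides_def lookup_ind)
  then show ?thesis
    by (simp add: mon_zero)
qed

lemma ideal_gcd_product_pairs:
  fixes a b c :: "'v::{finite, linorder}"
  assumes "distinct [a, b, c]"
  shows "ideal_gcd (igen {{a, b}, {a, c}} :: ('v, 'k::field) mpoly set) = Var a"
proof -
  have "min_gens (igen {{a, b}, {a, c}} :: ('v, 'k) mpoly set) = ind ` {{a, b}, {a, c}}"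
    by (rule matroidal_igen_pairs(3)[OF assms]) blast
  then have "ideal_gcd (igen {{a, b}, {a, c}} :: ('v, 'k) mpoly set) = mon (ind {a})"
    using assms by (intro ideal_gcd_eq) (auto simp: divides_def lookup_ind)
  then show ?thesis
    by (simp only: Var_eq_ind)
qed

theorem proposition4p10:
  fixes J :: "('v::{finite, linorder}, 'k::field) mpoly set"
  assumes "CARD('v) = 6"
    and "matroidal J"
    and "generated_in_degree 4 J"
    and "ideal_supp J = UNIV"
    and "ideal_gcd J = 1"
  shows "SCM J \<longleftrightarrow>
    (\<exists>(y :: nat \<Rightarrow> 'v) (J1 :: ('v, 'k) mpoly set) J2 J3 J4.
      bij_betw y {1..6} UNIV \<and>
      (let Y = (\<lambda>i. Var (y i) :: ('v, 'k) mpoly);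
           P = ideal_gen {Y 4, Y 5, Y 6};
           S0 = (Y 1 * Y 2 * Y 3) *o P;
           S1 = (Y 1 * Y 2) *o J1;
           S2 = (Y 1 * Y 3) *o J2;
           S3 = (Y 2 * Y 3) *o J3
       in J = S0 + S1 + S2 + S3 + J4 \<and>
          (\<forall>I \<in> {J1, J2, J3}. SCM I \<and> matroidal I \<and> generated_in_degree 2 I \<and>
             ideal_supp I = {y 4, y 5, y 6}) \<and>
          J4 = ideal_gen (mon ` {u \<in> min_gens J. mon u \<notin> S0 \<union> S1 \<union> S2 \<union> S3}) \<and>
          J4 \<subseteq> J1 \<inter> J2 \<inter> J3 \<and>
          (((\<forall>I \<in> {J1, J2, J3}. ideal_gcd I = 1) \<and> card (min_gens J4) = 3) \<or>
           ((\<forall>I \<in> {J1, J2, J3}. ideal_gcd I = 1) \<and> card (min_gens J4) = 2) \<or>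
           ((\<forall>I \<in> {J1, J2, J3}. ideal_gcd I = 1) \<and> J4 = {0}) \<or>
           ((\<forall>I \<in> {J1, J2, J3}. ideal_gcd I = Y 4) \<and> J4 = {0}))))"
    (is "_ \<longleftrightarrow> ?decomposes")
proof -
  interpret rank_four_matroid J
    using assms by unfold_locales
  have monomials:
    "ideal_gen {Var (y 4), Var (y 5), Var (y 6)} = (igen {{y 4}, {y 5}, {y 6}} :: ('v, 'k) mpoly set)"
    "mon (ind {y 1, y 2}) * Var (y 3) = (mon (ind {y 1, y 2, y 3}) :: ('v, 'k) mpoly)"
    "Var (y 1) * Var (y 2) = (mon (ind {y 1, y 2}) :: ('v, 'k) mpoly)"
    "Var (y 1) * Var (y 3) = (mon (ind {y 1, y 3}) :: ('v, 'k) mpoly)"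
    "Var (y 2) * Var (y 3) = (mon (ind {y 2, y 3}) :: ('v, 'k) mpoly)"
    if "distinct [y 1, y 2, y 3, y 4, y 5, y 6]" for y :: "nat \<Rightarrow> 'v"
    using that by (simp_all add: Var_eq_ind mon_mult ind_union insert_commute)
  show ?thesis
  proof
    assume "SCM J"
    then obtain C where C: "single_class C" "C \<noteq> {}"
      using SCM_iff_single_class by blast
    obtain y where y: "bij_betw y {1..6::nat} UNIV" "C = y ` {1..card C}"
      using ex_enumeration[OF six] by blast
    note p = six_enumeration[OF y(1)]
    note ne = distinct_sixD[OF p(1)]
    note ne = ne ne[THEN not_sym]
    note ne = ne ne[unfolded One_nat_def]
    have "1 \<le> card C"
      using C(2) by (simp add: Suc_le_eq card_gt_0_iff)
    then have "card C = 1 \<or> card C = 2 \<or> card C = 3 \<or> card C = 4"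
      using single_class_card[OF C(1)] by auto
    moreover have "{1..1::nat} = {1}" "{1..2::nat} = {1, 2}" "{1..3::nat} = {1, 2, 3}" "{1..4::nat} = {1, 2, 3, 4}"
      by auto
    ultimately have C_cases: "C = {y 1} \<or> C = {y 1, y 2} \<or> C = {y 1, y 2, y 3} \<or> C = {y 1, y 2, y 3, y 4}"
      using y(2) by (elim disjE) (simp_all only: image_insert image_empty, simp_all)
    define \<T> where "\<T> = (if C = {y 1, y 2, y 3, y 4} then {{y 4, y 5}, {y 4, y 6}}
      else {{y 4, y 5}, {y 4, y 6}, {y 5, y 6}})"
    define \<F> where "\<F> = {- {i, j} | i j. i \<in> {y 1, y 2, y 3} \<and> j \<in> {y 1, y 2, y 3} \<and> cobase J i j}"
    let ?I = "igen \<T> :: ('v, 'k) mpoly set" and ?J4 = "igen \<F> :: ('v, 'k) mpoly set"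
    have "\<T> = {{y 4, y 5}, {y 4, y 6}, {y 5, y 6}} \<and> C \<subseteq> {y 1, y 2, y 3} \<or>
      \<T> = {{y 4, y 5}, {y 4, y 6}} \<and> C = {y 1, y 2, y 3, y 4}"
      using C_cases by (auto simp: \<T>_def)
    note decomposition = decomposition_if_single_class[OF p C(1) this, folded \<F>_def]
    have d: "distinct [y 4, y 5, y 6]"
      by (simp add: ne)
    have T_sub: "\<T> \<subseteq> {{y 4, y 5}, {y 4, y 6}, {y 5, y 6}}"
      by (auto simp: \<T>_def)
    have "SCM ?I"
      using SCM_uniform_pairs[OF d] SCM_product_pairs[OF d] by (auto simp: \<T>_def simp del: image_insert)
    moreover have "ideal_supp ?I = {y 4, y 5, y 6}"
      unfolding ideal_supp_eq matroidal_igen_pairs(3)[OF d T_sub] by (auto simp: zero_set_ind \<T>_def)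
    ultimately have I: "\<forall>I\<in>{?I, ?I, ?I}. SCM I \<and> matroidal I \<and> generated_in_degree 2 I \<and>
        ideal_supp I = {y 4, y 5, y 6}"
      using matroidal_igen_pairs(1,2)[OF d T_sub] by simp
    have F_iff: "\<F> = {- {i, j} | i j. i \<in> {y 1, y 2, y 3} \<and> j \<in> {y 1, y 2, y 3} \<and> i \<noteq> j \<and> \<not> (i \<in> C \<and> j \<in> C)}"
      using C(1) by (simp only: \<F>_def single_class_def)
    have F_mem: "- {i, j} \<in> \<F>"
      if "i \<in> {y 1, y 2, y 3}" "j \<in> {y 1, y 2, y 3}" "i \<noteq> j" "\<not> (i \<in> C \<and> j \<in> C)" for i j
      unfolding F_iff using that by blast
    have gcd: "ideal_gcd ?I = (if C = {y 1, y 2, y 3, y 4} then Var (y 4) else 1)"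
      using ideal_gcd_uniform_pairs[OF d] ideal_gcd_product_pairs[OF d]
      by (auto simp: \<T>_def simp del: image_insert)
    have zero: "?J4 = {0}" if "{y 1, y 2, y 3} \<subseteq> C"
    proof -
      have "\<F> = {}"
        using that unfolding F_iff by blast
      then show ?thesis
        by (simp add: ideal_gen_empty)
    qed
    \<comment> \<open>The sizes \<open>1, 2, 3, 4\<close> of \<open>C\<close> yield (a), (b), (c),
      (d): of the three pairs in \<open>{y 1, y 2, y 3}\<close>, those not inside \<open>C\<close>
      number \<open>3, 2, 0, 0\<close>, and only in the last case does \<open>y 4\<close> divide all
      generators of \<open>?I\<close>.\<close>
    have conditions: "(\<forall>I \<in> {?I, ?I, ?I}. ideal_gcd I = 1) \<and> card (min_gens ?J4) = 3 \<or>
      (\<forall>I \<in> {?I, ?I, ?I}. ideal_gcd I = 1) \<and> card (min_gens ?J4) = 2 \<or>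
      (\<forall>I \<in> {?I, ?I, ?I}. ideal_gcd I = 1) \<and> ?J4 = {0} \<or>
      (\<forall>I \<in> {?I, ?I, ?I}. ideal_gcd I = Var (y 4)) \<and> ?J4 = {0}"
      using C_cases
    proof (elim disjE)
      assume C: "C = {y 1}"
      have "\<F> = {- {y 1, y 2}, - {y 1, y 3}, - {y 2, y 3}}"
      proof
        show "\<F> \<subseteq> {- {y 1, y 2}, - {y 1, y 3}, - {y 2, y 3}}"
          unfolding F_iff C by (auto simp: ne insert_commute)
        show "{- {y 1, y 2}, - {y 1, y 3}, - {y 2, y 3}} \<subseteq> \<F>"
          using F_mem[of "y 1" "y 2"] F_mem[of "y 1" "y 3"] F_mem[of "y 2" "y 3"] by (simp add: C ne)
      qed
      also have "card \<dots> = 3"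
        by (simp add: doubleton_eq_iff ne)
      finally show ?thesis
        using gcd decomposition(4) by (simp add: C ne)
    next
      assume C: "C = {y 1, y 2}"
      have "\<F> = {- {y 1, y 3}, - {y 2, y 3}}"
      proof
        show "\<F> \<subseteq> {- {y 1, y 3}, - {y 2, y 3}}"
          unfolding F_iff C by (auto simp: ne insert_commute)
        show "{- {y 1, y 3}, - {y 2, y 3}} \<subseteq> \<F>"
          using F_mem[of "y 1" "y 3"] F_mem[of "y 2" "y 3"] by (simp add: C ne)
      qed
      also have "card \<dots> = 2"
        by (simp add: doubleton_eq_iff ne)
      finally have "card \<F> = 2" .
      moreover have "y 3 \<notin> C"
        by (simp add: C ne)
      then have "C \<noteq> {y 1, y 2, y 3, y 4}"
        by blast
      ultimately show ?thesis
        using gcd decomposition(4) by simp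
    next
      assume C: "C = {y 1, y 2, y 3}"
      then have "C \<noteq> {y 1, y 2, y 3, y 4}"
        using ne by auto
      then show ?thesis
        using gcd zero C by simp
    next
      assume C: "C = {y 1, y 2, y 3, y 4}"
      then show ?thesis
        using gcd zero by simp
    qed
    show ?decomposes
      unfolding Let_def
    proof (rule exI[of _ y], rule exI[of _ ?I], rule exI[of _ ?I], rule exI[of _ ?I], rule exI[of _ ?J4],
        unfold monomials[OF p(1)], intro conjI y(1) I conditions decomposition(2))
      show "?J4 = ideal_gen (mon ` {u \<in> min_gens J. mon u \<notin>
          mon (ind {y 1, y 2, y 3}) *o (igen {{y 4}, {y 5}, {y 6}} :: ('v, 'k) mpoly set) \<union>
          mon (ind {y 1, y 2}) *o ?I \<union> mon (ind {y 1, y 3}) *o ?I \<union> mon (ind {y 2, y 3}) *o ?I})"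
        by (simp only: decomposition(1))
      show "?J4 \<subseteq> ?I \<inter> ?I \<inter> ?I"
        using decomposition(3) by (simp only: Int_absorb)
    qed
  next
    assume ?decomposes
    then obtain y :: "nat \<Rightarrow> 'v" and J1 J2 J3 J4 :: "('v, 'k) mpoly set" where y: "bij_betw y {1..6} UNIV"
      and decomposition:
        "let Y = (\<lambda>i. Var (y i) :: ('v, 'k) mpoly);
           P = ideal_gen {Y 4, Y 5, Y 6};
           S0 = (Y 1 * Y 2 * Y 3) *o P;
           S1 = (Y 1 * Y 2) *o J1;
           S2 = (Y 1 * Y 3) *o J2;
           S3 = (Y 2 * Y 3) *o J3
       in J = S0 + S1 + S2 + S3 + J4 \<and>
          (\<forall>I \<in> {J1, J2, J3}. SCM I \<and> matroidal I \<and> generated_in_degree 2 I \<and>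
             ideal_supp I = {y 4, y 5, y 6}) \<and>
          J4 = ideal_gen (mon ` {u \<in> min_gens J. mon u \<notin> S0 \<union> S1 \<union> S2 \<union> S3}) \<and>
          J4 \<subseteq> J1 \<inter> J2 \<inter> J3 \<and>
          (((\<forall>I \<in> {J1, J2, J3}. ideal_gcd I = 1) \<and> card (min_gens J4) = 3) \<or>
           ((\<forall>I \<in> {J1, J2, J3}. ideal_gcd I = 1) \<and> card (min_gens J4) = 2) \<or>
           ((\<forall>I \<in> {J1, J2, J3}. ideal_gcd I = 1) \<and> J4 = {0}) \<or>
           ((\<forall>I \<in> {J1, J2, J3}. ideal_gcd I = Y 4) \<and> J4 = {0}))"
      by blast
    note p = six_enumeration[OF y]
    note ne = distinct_sixD[OF p(1)]
    note ne = ne ne[THEN not_sym]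
    define S0 where "S0 = mon (ind {y 1, y 2, y 3}) *o (igen {{y 4}, {y 5}, {y 6}} :: ('v, 'k) mpoly set)"
    define S1 where "S1 = mon (ind {y 1, y 2}) *o J1"
    define S2 where "S2 = mon (ind {y 1, y 3}) *o J2"
    define S3 where "S3 = mon (ind {y 2, y 3}) *o J3"
    have J: "J = S0 + S1 + S2 + S3 + J4"
      and I: "\<forall>I \<in> {J1, J2, J3}. matroidal I \<and> generated_in_degree 2 I \<and> ideal_supp I = {y 4, y 5, y 6}"
      and J4: "J4 = ideal_gen (mon ` {u \<in> min_gens J. mon u \<notin> S0 \<union> S1 \<union> S2 \<union> S3})"
      and gcd: "(\<forall>I \<in> {J1, J2, J3}. ideal_gcd I = 1) \<or> (\<forall>I \<in> {J1, J2, J3}. ideal_gcd I = Var (y 4)) \<and> J4 = {0}"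
      using decomposition unfolding Let_def monomials[OF p(1)] S0_def S1_def S2_def S3_def by blast+
    have "is_ideal J1" "is_ideal J2" "is_ideal J3"
      using I monomial_ideal_min_gens(1) is_ideal_ideal_gen
      unfolding matroidal_def polymatroidal_def by (metis insertI1 insertI2)+
    then have ideals: "is_ideal S0" "is_ideal S1" "is_ideal S2" "is_ideal S3" "is_ideal J4"
      unfolding S0_def S1_def S2_def S3_def J4 by (simp_all only: is_ideal_times is_ideal_ideal_gen)
    have "S0 \<subseteq> J" "S1 \<subseteq> J" "S2 \<subseteq> J" "S3 \<subseteq> J"
      unfolding J
      by (intro subset_trans[OF _ ideal_plus_upper1] ideal_plus_upper2 is_ideal_plus ideals order_refl)+
    \<comment> \<open>Monomials in the first four summands are divisible by at least two of
      \<open>y 1, y 2, y 3\<close>. The basis complementary to such a pair is divisible by only one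
      of them, so it would be a nonzero element of \<open>J4\<close>.\<close>
    moreover have "\<not> cobase J i j" if ij: "i \<in> {y 1, y 2, y 3}" "j \<in> {y 1, y 2, y 3}" and "J4 = {0}" for i j
    proof
      assume cobase: "cobase J i j"
      then have "i \<noteq> j" "ind (- {i, j}) \<in> min_gens J"
        by (simp_all add: cobase_def)
      have "\<not> {y 1, y 2, y 3} \<subseteq> - {i, j}" "\<not> {y 1, y 2} \<subseteq> - {i, j}" "\<not> {y 1, y 3} \<subseteq> - {i, j}"
        "\<not> {y 2, y 3} \<subseteq> - {i, j}"
        using ij \<open>i \<noteq> j\<close> by auto
      then have "mon (ind (- {i, j})) \<notin> S0 \<union> S1 \<union> S2 \<union> S3"
        unfolding S0_def S1_def S2_def S3_def by (metis UnE mon_ind_in_times)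
      then have "mon (ind (- {i, j})) \<in> mon ` {u \<in> min_gens J. mon u \<notin> S0 \<union> S1 \<union> S2 \<union> S3}"
        using \<open>ind (- {i, j}) \<in> min_gens J\<close> by (intro imageI) simp
      then have "mon (ind (- {i, j})) \<in> J4"
        unfolding J4 by (rule subsetD[OF ideal_gen_superset])
      then have "mon (ind (- {i, j})) = (0 :: ('v, 'k) mpoly)"
        using \<open>J4 = {0}\<close> by simp
      then show False
        using keys_mon[of "ind (- {i, j})", where ?'k='k] by simp
    qed
    ultimately show "SCM J"
      using gcd unfolding S0_def S1_def S2_def S3_def by (intro SCM_if_decomposition[OF p _ _ _ _ I]) auto
  qed
qed

end
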